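(* Let $\Omega\subset\mathbb{R}^N$ be bounded and $p$ log-Hölder continuous in $\Omega$. Let $u\in W^{1,p(x)}(\Omega)$ be a weak solution to $$\Delta_{p(x)}u=f\quad\text{in }\Omega$$ with $f\in L^{q_0(x)}(\Omega)$, where $q_0\in C(\Omega)$ is such that $\max\{1,\frac{N}{p(x)}\}<q_0(x)$ in $\Omega$. Then $u$ is locally bounded.
   Context: $N$ is the spatial dimension. Standing assumptions on the exponent: $1<p_1\le p(x)\le p_2<\infty$ in $\Omega$ and $p$ is continuous up to the boundary. $p$ is log-Hölder continuous in $\Omega$ if $|p(x)-p(y)|\le\omega(|x-y|)$ for all $x,y$ in any ball $B_R(x_0)\subset\Omega$, with a modulus $\omega$ independent of the ball satisfying $\omega(r)=C/|\log r|$ for $0<r\le1/2$. For a variable exponent $m(x)$, $L^{m(x)}(\Omega)$ is the set of measurable $u$ with $|u|^{m(x)}\in L^1(\Omega)$; $\|u\|_{p(\cdot)}=\inf\{\lambda>0:\int_\Omega(|u(x)|/\lambda)^{p(x)}dx\le1\}$. $W^{1,p(x)}(\Omega)$ is the set of $u\in L^{p(x)}(\Omega)$ with distributional gradient in $L^{p(x)}(\Omega)$, with norm $\|u\|_{p(\cdot)}+\||\nabla u|\|_{p(\cdot)}$; $W_0^{1,p(x)}(\Omega)$ is the closure in it of its compactly supported elements. $\Delta_{p(x)}u=\mathrm{div}(|\nabla u|^{p(x)-2}\nabla u)$. A weak solution of $\Delta_{p(x)}u=f$ is $u\in W^{1,p(x)}(\Omega)$ with $-\int_\Omega|\nabla u|^{p(x)-2}\nabla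 u\cdot\nabla\phi\,dx=\int_\Omega f\phi\,dx$ for every $\phi\in L^\infty(\Omega)\cap W_0^{1,p(x)}(\Omega)$. *)

theory Defs
  imports "HOL-Analysis.Analysis"
begin

text \<open>Variable exponent Lebesgue spaces on a set \<open>\<Omega>\<close>, for scalar and vector valued functions.
  Functions are total; only their values on \<open>\<Omega>\<close> matter, and almost everywhere equal functions
  are not identified.\<close>

definition Lvar :: "'a::euclidean_space set \<Rightarrow> ('a \<Rightarrow> real) \<Rightarrow> ('a \<Rightarrow> 'b::euclidean_space) set" where
  "Lvar \<Omega> m = {u \<in> borel_measurable (lebesgue_on \<Omega>).
                integrable (lebesgue_on \<Omega>) (\<lambda>x. norm (u x) powr m x)}"

text \<open>The Luxemburg norm. The modular is an extended nonnegative integral, because the Bochner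
  integral of a non-integrable function is \<open>0\<close> and would spuriously satisfy the bound.\<close>

definition Lvar_norm :: "'a::euclidean_space set \<Rightarrow> ('a \<Rightarrow> real) \<Rightarrow> ('a \<Rightarrow> 'b::euclidean_space) \<Rightarrow> real" where
  "Lvar_norm \<Omega> p u =
     Inf {l. l > 0 \<and> (\<integral>\<^sup>+x. ennreal ((norm (u x) / l) powr p x) \<partial>lebesgue_on \<Omega>) \<le> 1}"

definition Linfty :: "'a::euclidean_space set \<Rightarrow> ('a \<Rightarrow> real) set" where
  "Linfty \<Omega> = {u \<in> borel_measurable (lebesgue_on \<Omega>). \<exists>M. AE x in lebesgue_on \<Omega>. \<bar>u x\<bar> \<le> M}"

definition locally_bounded :: "'a::euclidean_space set \<Rightarrow> ('a \<Rightarrow> real) \<Rightarrow> bool" where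
  "locally_bounded \<Omega> u \<longleftrightarrow> (\<forall>K. compact K \<and> K \<subseteq> \<Omega> \<longrightarrow> u \<in> Linfty K)"

text \<open>\<open>Ck k f\<close>: \<open>f\<close> is \<open>k\<close> times continuously differentiable on the whole space (for
  \<open>k > 0\<close>: differentiable with all partial derivatives of class \<open>k - 1\<close>).\<close>

primrec Ck :: "nat \<Rightarrow> ('a::euclidean_space \<Rightarrow> real) \<Rightarrow> bool" where
  "Ck 0 f \<longleftrightarrow> continuous_on UNIV f"
| "Ck (Suc k) f \<longleftrightarrow> (\<forall>x. f differentiable (at x)) \<and>
     (\<forall>i\<in>Basis. Ck k (\<lambda>x. frechet_derivative f (at x) i))"

definition test_functions :: "'a::euclidean_space set \<Rightarrow> ('a \<Rightarrow> real) set" where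
  "test_functions \<Omega> = {\<psi>. (\<forall>k. Ck k \<psi>) \<and>
     compact (closure {x. \<psi> x \<noteq> 0}) \<and> closure {x. \<psi> x \<noteq> 0} \<subseteq> \<Omega>}"

definition has_distr_gradient ::
  "'a::euclidean_space set \<Rightarrow> ('a \<Rightarrow> real) \<Rightarrow> ('a \<Rightarrow> 'a) \<Rightarrow> bool" where
  "has_distr_gradient \<Omega> u G \<longleftrightarrow>
     (\<forall>K. compact K \<and> K \<subseteq> \<Omega> \<longrightarrow> u absolutely_integrable_on K \<and> G absolutely_integrable_on K) \<and>
     (\<forall>\<psi>\<in>test_functions \<Omega>. \<forall>i\<in>Basis.
        (LINT x|lebesgue_on \<Omega>. u x * frechet_derivative \<psi> (at x) i)
          = - (LINT x|lebesgue_on \<Omega>. (G x \<bullet> i) * \<psi> x))"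

text \<open>The distributional gradient is determined up to null sets; this picks a representative.\<close>

definition distr_gradient :: "'a::euclidean_space set \<Rightarrow> ('a \<Rightarrow> real) \<Rightarrow> 'a \<Rightarrow> 'a" where
  "distr_gradient \<Omega> u = (SOME G. has_distr_gradient \<Omega> u G)"

definition W1var :: "'a::euclidean_space set \<Rightarrow> ('a \<Rightarrow> real) \<Rightarrow> ('a \<Rightarrow> real) set" where
  "W1var \<Omega> p = {u \<in> Lvar \<Omega> p. \<exists>G \<in> Lvar \<Omega> p. has_distr_gradient \<Omega> u G}"

definition W1var_norm :: "'a::euclidean_space set \<Rightarrow> ('a \<Rightarrow> real) \<Rightarrow> ('a \<Rightarrow> real) \<Rightarrow> real" where
  "W1var_norm \<Omega> p u = Lvar_norm \<Omega> p u + Lvar_norm \<Omega> p (distr_gradient \<Omega> u)"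

definition compactly_supported_in :: "'a::euclidean_space set \<Rightarrow> ('a \<Rightarrow> real) \<Rightarrow> bool" where
  "compactly_supported_in \<Omega> u \<longleftrightarrow>
     (\<exists>K. compact K \<and> K \<subseteq> \<Omega> \<and> (AE x in lebesgue_on \<Omega>. x \<notin> K \<longrightarrow> u x = 0))"

definition W1var0 :: "'a::euclidean_space set \<Rightarrow> ('a \<Rightarrow> real) \<Rightarrow> ('a \<Rightarrow> real) set" where
  "W1var0 \<Omega> p = {u \<in> W1var \<Omega> p. \<forall>\<epsilon>>0. \<exists>v \<in> W1var \<Omega> p.
     compactly_supported_in \<Omega> v \<and> W1var_norm \<Omega> p (\<lambda>x. u x - v x) < \<epsilon>}"

text \<open>The modulus \<open>\<omega>\<close> is prescribed only on \<open>(0, 1/2]\<close>; beyond that it is an arbitrary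
  nondecreasing function.\<close>

definition log_Holder :: "'a::euclidean_space set \<Rightarrow> ('a \<Rightarrow> real) \<Rightarrow> bool" where
  "log_Holder \<Omega> p \<longleftrightarrow>
     (\<exists>\<omega> C. mono_on {0..} \<omega> \<and> \<omega> 0 = 0 \<and> (\<forall>r. 0 < r \<and> r \<le> 1/2 \<longrightarrow> \<omega> r = C / \<bar>ln r\<bar>) \<and>
        (\<forall>x0 R. ball x0 R \<subseteq> \<Omega> \<longrightarrow>
           (\<forall>x\<in>ball x0 R. \<forall>y\<in>ball x0 R. \<bar>p x - p y\<bar> \<le> \<omega> (dist x y))))"

text \<open>Where the gradient vanishes, the field \<open>|\<nabla>u|\<^bsup>p-2\<^esup> \<nabla>u\<close> is \<open>0\<close>, also for \<open>p < 2\<close>.\<close>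

definition weak_solution_px ::
  "'a::euclidean_space set \<Rightarrow> ('a \<Rightarrow> real) \<Rightarrow> ('a \<Rightarrow> real) \<Rightarrow> ('a \<Rightarrow> real) \<Rightarrow> bool" where
  "weak_solution_px \<Omega> p f u \<longleftrightarrow> u \<in> W1var \<Omega> p \<and>
     (\<forall>\<phi> \<in> Linfty \<Omega> \<inter> W1var0 \<Omega> p.
        - (LINT x|lebesgue_on \<Omega>.
             (norm (distr_gradient \<Omega> u x) powr (p x - 2)) *\<^sub>R distr_gradient \<Omega> u x
               \<bullet> distr_gradient \<Omega> \<phi> x)
          = (LINT x|lebesgue_on \<Omega>. f x * \<phi> x))"

end

(* The equation is tested with a power of a cutoff times a truncation of u - k, which gives a
   Caccioppoli inequality on the superlevel sets of u. On a small ball p varies only between q and P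
   with P below the Sobolev exponent of q, so the levels K + 1 - 2^-j on shrinking balls can be
   iterated in the manner of De Giorgi. In place of the Sobolev inequality the iteration uses a
   weak-type bound for superlevel sets, obtained by comparing a function with its averages over
   balls; it loses nothing as long as all exponent conditions are strict inequalities. Truncations
   of Sobolev functions are differentiated through the L1 convergence of difference quotients. *)

theory Submission
  imports Defs
begin

section \<open>Smooth functions\<close>

text \<open>The energy of u is measured with the varying exponent p(x), while the gain of
  integrability is proved for a constant exponent q below p(x). The two meet through inequalities
  such as t^q \<le> 1 + t^p, whose constant 1 is paid by the measure of a superlevel set or of a
  ball. All estimates are run on one quantity, the integral of (U - k)^+ to the power
  \<open>tau\<close>. Here \<open>tau\<close> is at least P, so that it controls every power p(x),
  and at least the conjugate exponent of qf, so that it controls the product with f. The energy is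
  bounded by the power 1 - 1/qf of this quantity, the weak-type bound contributes a further power
  q/N, and the sum exceeds 1 exactly when qf > N/q. This is where N/p < q0 enters, once p and q0
  have been replaced by nearby constants. That the quantity is finite at all comes from a bootstrap
  starting at the exponent q. The weak-type bound rests on translations and on exchanging integrals,
  so functions are first made Borel and extended to the whole space by a cutoff.\<close>

lemma Ck_Suc_D: "Ck (Suc k) f \<Longrightarrow> Ck k f"
proof (induction k arbitrary: f)
  case 0
  then show ?case
    by (auto intro!: continuous_at_imp_continuous_on differentiable_imp_continuous_within)
next
  case (Suc k)
  from Suc.prems have "\<forall>i\<in>Basis. Ck (Suc k) (\<lambda>x. frechet_derivative f (at x) i)" and d: "\<forall>x. f differentiable (at x)"
    unfolding Ck.simps(2)[of "Suc k"] by blast+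
  with Suc.IH have "\<forall>i\<in>Basis. Ck k (\<lambda>x. frechet_derivative f (at x) i)" by blast
  with d show ?case unfolding Ck.simps(2) by blast
qed

lemma Ck_SucI:
  assumes "\<And>x. (f has_derivative f' x) (at x)" "\<And>i. i \<in> Basis \<Longrightarrow> Ck k (\<lambda>x. f' x i)"
  shows "Ck (Suc k) f"
proof -
  have "frechet_derivative f (at x) = f' x" for x
    using frechet_derivative_at[OF assms(1)] by simp
  then show ?thesis using assms by (auto simp: differentiable_def)
qed

lemma Ck_Suc_has_derivative:
  "Ck (Suc k) f \<Longrightarrow> (f has_derivative frechet_derivative f (at x)) (at x)"
  by (simp add: frechet_derivative_works)

lemma Ck_const: "Ck k (\<lambda>_. c)"
proof (induction k arbitrary: c)
  case (Suc k)
  show ?case by (rule Ck_SucI[where f'="\<lambda>_ _. 0"]) (use Suc in \<open>auto intro!: derivative_eq_intros\<close>)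
qed simp

lemma Ck_inner: "Ck k (\<lambda>x. x \<bullet> v)"
proof (cases k)
  case (Suc j)
  then show ?thesis
    by (auto simp del: Ck.simps intro!: Ck_SucI[where f'="\<lambda>_ h. h \<bullet> v"] Ck_const derivative_eq_intros)
qed (auto intro: continuous_intros)

lemma Ck_add: "Ck k f \<Longrightarrow> Ck k g \<Longrightarrow> Ck k (\<lambda>x. f x + g x)"
proof (induction k arbitrary: f g)
  case (Suc k)
  note d = Suc.prems[THEN Ck_Suc_has_derivative]
  show ?case
    by (rule Ck_SucI[OF has_derivative_add[OF d]]) (use Suc in auto)
qed (auto intro: continuous_intros)

lemma Ck_mult: "Ck k f \<Longrightarrow> Ck k g \<Longrightarrow> Ck k (\<lambda>x. f x * g x)"
proof (induction k arbitrary: f g)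
  case (Suc k)
  note d = Suc.prems[THEN Ck_Suc_has_derivative]
  show ?case
    by (rule Ck_SucI[OF has_derivative_mult[OF d]], intro Ck_add Suc.IH)
       (use Suc.prems Ck_Suc_D in auto)
qed (auto intro: continuous_intros)

lemma Ck_prod: "(\<And>i. i \<in> A \<Longrightarrow> Ck k (f i)) \<Longrightarrow> Ck k (\<lambda>x. \<Prod>i\<in>A. f i x)"
  by (induction A rule: infinite_finite_induct) (auto intro!: Ck_const Ck_mult)

lemma Ck_sum: "(\<And>i. i \<in> A \<Longrightarrow> Ck k (f i)) \<Longrightarrow> Ck k (\<lambda>x. \<Sum>i\<in>A. f i x)"
  by (induction A rule: infinite_finite_induct) (auto intro!: Ck_const Ck_add)

lemma Ck_power: "Ck k f \<Longrightarrow> Ck k (\<lambda>x. f x ^ n)"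
  by (induction n) (auto intro!: Ck_const Ck_mult)

lemma Ck_compose:
  fixes f :: "real \<Rightarrow> real"
  shows "Ck k f \<Longrightarrow> Ck k g \<Longrightarrow> Ck k (\<lambda>x. f (g x))"
proof (induction k arbitrary: f g)
  case 0
  then show ?case by (auto intro: continuous_on_compose2)
next
  case (Suc k)
  note d = Suc.prems[THEN Ck_Suc_has_derivative]
  \<comment> \<open>A linear map on the reals is multiplication by its value at 1. Each partial
    derivative of the composition is therefore a product, the shape to which \<open>Ck_mult\<close>
    and the induction hypothesis apply.\<close>
  have *: "((\<lambda>x. f (g x)) has_derivative
      (\<lambda>h. frechet_derivative f (at (g x)) 1 * frechet_derivative g (at x) h)) (at x)" for x
  proof -
    have "frechet_derivative f (at (g x)) h = frechet_derivative f (at (g x)) 1 * h" for h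
      using linear_scale[OF has_derivative_linear[OF d(1)[of "g x"]], of h 1] by simp
    then show ?thesis
      by (rule has_derivative_eq_rhs[OF has_derivative_compose[OF d(2)[of x] d(1)[of "g x"]], OF ext])
  qed
  show ?case
    by (rule Ck_SucI[OF *], intro Ck_mult Suc.IH[where f="\<lambda>t. frechet_derivative f (at t) 1"])
       (use Suc.prems Ck_Suc_D in auto)
qed

lemma Ck_inverse:
  shows "Ck k f \<Longrightarrow> (\<And>x. f x > 0) \<Longrightarrow> Ck k (\<lambda>x. inverse (f x))"
proof (induction k)
  case 0
  then show ?case by (auto intro!: continuous_intros simp: less_imp_neq[THEN not_sym])
next
  case (Suc k)
  note d = Suc.prems(1)[THEN Ck_Suc_has_derivative]
  have "f x \<noteq> 0" for x using Suc.prems(2)[of x] by simp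
  note * = Deriv.has_derivative_inverse[OF this d]
  have "Ck k (\<lambda>x. (-1) * (inverse (f x) * frechet_derivative f (at x) i * inverse (f x)))" if "i \<in> Basis" for i
    using Suc that Ck_Suc_D[OF Suc.prems(1)] by (intro Ck_mult Ck_const) auto
  then show ?case
    by (intro Ck_SucI[OF *]) auto
qed

subsection \<open>A smooth step\<close>

text \<open>The factor \<open>poly q (1/t)\<close> makes the family closed under differentiation, so
  that smoothness is an induction over the order of differentiability with \<open>q\<close>
  arbitrary. The function e^(-1/t) itself is \<open>flat 1\<close>.\<close>

definition flat :: "real poly \<Rightarrow> real \<Rightarrow> real" where
  "flat q t = (if t \<le> 0 then 0 else poly q (1/t) * exp (- 1/t))"

lemma poly_div_exp_tendsto_0: "((\<lambda>s::real. poly q s / exp s) \<longlongrightarrow> 0) at_top"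
proof -
  have "((\<lambda>s. \<Sum>i\<le>degree q. coeff q i * (s ^ i / exp s)) \<longlongrightarrow> (\<Sum>i\<le>degree q. coeff q i * 0)) at_top"
    by (intro tendsto_intros tendsto_power_div_exp_0)
  then show ?thesis by (simp add: poly_altdef sum_divide_distrib)
qed

text \<open>With s = 1/t the chain rule turns q(s) e^(-s) into s^2 (q(s) - q'(s)) e^(-s), and
  \<open>[:0,0,1:]\<close> is the polynomial s^2. Only t = 0 needs an argument beyond
  calculus.\<close>

lemma flat_has_derivative:
  "(flat q has_real_derivative flat ([:0,0,1:] * (q - pderiv q)) t) (at t)"
proof -
  consider "t < 0" | "t = 0" | "t > 0" by linarith
  then show ?thesis
  proof cases
    case 1
    have "((\<lambda>_. 0) has_real_derivative 0) (at t)" by simp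
    then have "(flat q has_real_derivative 0) (at t)"
      by (rule has_field_derivative_transform_within_open[where S="{..<0}"])
         (use 1 in \<open>auto simp: flat_def\<close>)
    then show ?thesis using 1 by (simp add: flat_def)
  next
    case 2
    \<comment> \<open>\<open>pCons 0 q\<close> is s q(s): under s = 1/h the division by h in the
      difference quotient at 0 becomes the additional factor s, and the exponential beats any
      polynomial.\<close>
    have "((\<lambda>s. poly (pCons 0 q) s / exp s) \<longlongrightarrow> 0) at_top"
      by (rule poly_div_exp_tendsto_0)
    then have r: "((\<lambda>h. poly (pCons 0 q) (inverse h) / exp (inverse h)) \<longlongrightarrow> 0) (at_right 0)"
      by (rule filterlim_compose[OF _ filterlim_inverse_at_top_right])
    have "((\<lambda>h. flat q h / h) \<longlongrightarrow> 0) (at_right 0)"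
      by (rule Lim_transform_eventually[OF r])
         (auto simp: eventually_at_right_field flat_def exp_minus field_simps intro!: exI[of _ 1])
    moreover have "((\<lambda>h. flat q h / h) \<longlongrightarrow> 0) (at_left 0)"
      by (rule Lim_transform_eventually[OF tendsto_const])
         (auto simp: eventually_at_left_field flat_def intro!: exI[of _ "-1"])
    ultimately have "((\<lambda>h. flat q h / h) \<longlongrightarrow> 0) (at 0)"
      by (simp add: filterlim_split_at)
    then show ?thesis using 2 by (simp add: DERIV_def flat_def)
  next
    case 3
    have "((\<lambda>t. poly q (1/t) * exp (- 1/t)) has_real_derivative flat ([:0,0,1:] * (q - pderiv q)) t) (at t)"
      using 3 by (auto intro!: derivative_eq_intros poly_DERIV simp: flat_def)
         (simp add: field_simps power2_eq_square)
    then show ?thesis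
      by (rule has_field_derivative_transform_within_open[where S="{0<..}"])
         (use 3 in \<open>auto simp: flat_def\<close>)
  qed
qed

lemma Ck_flat: "Ck k (flat q)"
proof (induction k arbitrary: q)
  case 0
  show ?case
    using flat_has_derivative[of q] by (auto intro!: continuous_at_imp_continuous_on DERIV_isCont)
next
  case (Suc k)
  show ?case
    by (rule Ck_SucI[OF flat_has_derivative[unfolded has_field_derivative_def]]) (use Suc in simp)
qed

definition smooth_step :: "real \<Rightarrow> real" where
  "smooth_step t = flat 1 t * inverse (flat 1 t + flat 1 (1 - t))"

lemma flat_1_nonneg: "flat 1 t \<ge> 0" by (simp add: flat_def)
lemma flat_1_pos: "t > 0 \<Longrightarrow> flat 1 t > 0" by (simp add: flat_def)
lemma flat_1_denom_pos: "flat 1 t + flat 1 (1 - t) > 0"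
  using flat_1_nonneg[of t] flat_1_nonneg[of "1-t"] flat_1_pos[of t] flat_1_pos[of "1-t"]
  by (cases "t > 0") linarith+

lemma Ck_smooth_step: "Ck k smooth_step"
proof -
  have "Ck k (\<lambda>t::real. flat 1 (1 + t \<bullet> (-1)))"
    by (intro Ck_compose[OF Ck_flat] Ck_add Ck_const Ck_inner)
  then have "Ck k (\<lambda>t. flat 1 (1 - t))" by (simp add: inner_real_def)
  then show ?thesis
    unfolding smooth_step_def[abs_def] by (intro Ck_mult Ck_inverse Ck_add Ck_flat flat_1_denom_pos)
qed

lemma smooth_step_0: "t \<le> 0 \<Longrightarrow> smooth_step t = 0" by (simp add: smooth_step_def flat_def)

lemma smooth_step_1: "t \<ge> 1 \<Longrightarrow> smooth_step t = 1"
  using flat_1_pos[of t] by (simp add: smooth_step_def flat_def)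

lemma smooth_step_range: "0 \<le> smooth_step t" "smooth_step t \<le> 1"
  using flat_1_nonneg[of t] flat_1_nonneg[of "1-t"] flat_1_denom_pos[of t]
  by (auto simp: smooth_step_def field_simps)

lemma smooth_step_has_derivative: "(smooth_step has_real_derivative deriv smooth_step t) (at t)"
  using Ck_smooth_step[of "Suc 0"] by (auto simp: DERIV_deriv_iff_real_differentiable)

lemma deriv_smooth_step_bounded: "\<exists>L>0. \<forall>t. \<bar>deriv smooth_step t\<bar> \<le> L"
proof -
  have *: "frechet_derivative smooth_step (at t) 1 = deriv smooth_step t" for t
    using smooth_step_has_derivative[of t] by (simp add: has_field_derivative_def frechet_derivative_at[symmetric])
  have "continuous_on UNIV (deriv smooth_step)"
    using Ck_smooth_step[of "Suc 0"] by (simp add: *)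
  then have "compact (deriv smooth_step ` {0..1})"
    by (intro compact_continuous_image) (auto intro: continuous_on_subset)
  then obtain L where L: "L > 0" "\<forall>y\<in>deriv smooth_step ` {0..1}. norm y \<le> L"
    using compact_imp_bounded bounded_pos by metis
  have "deriv smooth_step t = 0" if "t < 0" for t
  proof -
    have "(smooth_step has_real_derivative 0) (at t)"
      by (rule has_field_derivative_transform_within_open[where S="{..<0}" and f="\<lambda>_. 0"])
         (use that in \<open>auto simp: smooth_step_0\<close>)
    then show ?thesis by (rule DERIV_imp_deriv)
  qed
  moreover have "deriv smooth_step t = 0" if "t > 1" for t
  proof -
    have "(smooth_step has_real_derivative 0) (at t)"
      by (rule has_field_derivative_transform_within_open[where S="{1<..}" and f="\<lambda>_. 1"])
         (use that in \<open>auto simp: smooth_step_1\<close>)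
    then show ?thesis by (rule DERIV_imp_deriv)
  qed
  ultimately have "\<bar>deriv smooth_step t\<bar> \<le> L" for t
    using L by (cases "t < 0"; cases "t > 1") auto
  with L(1) show ?thesis by blast
qed

subsection \<open>Test functions\<close>

definition grad :: "('a::euclidean_space \<Rightarrow> real) \<Rightarrow> 'a \<Rightarrow> 'a" where
  "grad f x = (\<Sum>i\<in>Basis. frechet_derivative f (at x) i *\<^sub>R i)"

lemma grad_inner_Basis: "i \<in> Basis \<Longrightarrow> grad f x \<bullet> i = frechet_derivative f (at x) i"
  by (simp add: grad_def inner_sum_left inner_Basis if_distrib[where f="\<lambda>c. _ * c"] cong: if_cong)

lemma grad_inner:
  assumes "f differentiable (at x)"
  shows "grad f x \<bullet> v = frechet_derivative f (at x) v"
proof -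
  have "linear (frechet_derivative f (at x))" using assms by (rule linear_frechet_derivative)
  then have "frechet_derivative f (at x) v = (\<Sum>i\<in>Basis. (v \<bullet> i) * frechet_derivative f (at x) i)"
    by (subst (1) euclidean_representation[symmetric, of v]) (simp add: linear_sum linear_scale)
  moreover have "grad f x \<bullet> v = (\<Sum>i\<in>Basis. (v \<bullet> i) * frechet_derivative f (at x) i)"
    unfolding grad_def inner_sum_left by (intro sum.cong) (simp_all add: inner_commute)
  ultimately show ?thesis by simp
qed

lemma has_derivative_grad:
  "f differentiable (at x) \<Longrightarrow> (f has_derivative (\<lambda>v. grad f x \<bullet> v)) (at x)"
  by (simp add: grad_inner frechet_derivative_works)

lemma grad_eqI:
  assumes "(f has_derivative (\<lambda>v. g \<bullet> v)) (at x)"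
  shows "grad f x = g"
  using frechet_derivative_at[OF assms, symmetric] by (simp add: grad_def euclidean_representation)

lemma test_functions_has_derivative:
  "\<psi> \<in> test_functions \<Omega> \<Longrightarrow> (\<psi> has_derivative (\<lambda>v. grad \<psi> x \<bullet> v)) (at x)"
  using Ck.simps(2)[of 0 \<psi>] by (intro has_derivative_grad) (auto simp: test_functions_def simp del: Ck.simps)

lemma continuous_on_grad:
  "Ck (Suc 0) f \<Longrightarrow> continuous_on UNIV (grad f)"
  unfolding grad_def[abs_def] by (intro continuous_on_sum continuous_on_scaleR continuous_on_const) simp

lemma continuous_on_grad_test: "\<psi> \<in> test_functions \<Omega> \<Longrightarrow> continuous_on UNIV (grad \<psi>)"
  by (intro continuous_on_grad) (auto simp: test_functions_def simp del: Ck.simps)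

lemma continuous_on_test: "\<psi> \<in> test_functions \<Omega> \<Longrightarrow> continuous_on UNIV \<psi>"
  using Ck.simps(1)[of \<psi>] by (auto simp: test_functions_def simp del: Ck.simps)

lemma test_functions_borel [measurable_dest]: "\<psi> \<in> test_functions \<Omega> \<Longrightarrow> \<psi> \<in> borel_measurable borel"
  by (intro borel_measurable_continuous_onI continuous_on_test)

lemma grad_test_borel: "\<psi> \<in> test_functions \<Omega> \<Longrightarrow> grad \<psi> \<in> borel_measurable borel"
  by (intro borel_measurable_continuous_onI continuous_on_grad_test)

lemma test_functions_mono: "\<psi> \<in> test_functions A \<Longrightarrow> A \<subseteq> B \<Longrightarrow> \<psi> \<in> test_functions B"
  by (auto simp: test_functions_def)

lemma test_functions_mult:
  assumes "\<psi> \<in> test_functions A" "\<forall>k. Ck k f"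
  shows "(\<lambda>x. f x * \<psi> x) \<in> test_functions A"
proof -
  have s: "closure {x. f x * \<psi> x \<noteq> 0} \<subseteq> closure {x. \<psi> x \<noteq> 0}"
    by (intro closure_mono) auto
  moreover have "compact (closure {x. f x * \<psi> x \<noteq> 0})"
    using assms(1) s unfolding test_functions_def
    by (metis (mono_tags, lifting) closed_closure compact_closure compact_eq_bounded_closed bounded_subset mem_Collect_eq)
  ultimately show ?thesis using assms by (auto simp: test_functions_def intro!: Ck_mult)
qed

lemma grad_mult:
  assumes "(f has_derivative (\<lambda>v. grad f x \<bullet> v)) (at x)" "(g has_derivative (\<lambda>v. grad g x \<bullet> v)) (at x)"
  shows "grad (\<lambda>x. f x * g x) x = f x *\<^sub>R grad g x + g x *\<^sub>R grad f x"
  by (rule grad_eqI) (rule has_derivative_eq_rhs[OF has_derivative_mult[OF assms]],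
    auto simp: fun_eq_iff inner_simps)

lemma grad_test_0:
  assumes "\<psi> \<in> test_functions A" "x \<notin> A"
  shows "\<psi> x = 0" "grad \<psi> x = 0"
proof -
  let ?S = "closure {x. \<psi> x \<noteq> 0}"
  have x: "x \<notin> ?S" using assms by (auto simp: test_functions_def)
  then show "\<psi> x = 0" using closure_subset[of "{x. \<psi> x \<noteq> 0}"] by auto
  have "(\<psi> has_derivative (\<lambda>v. 0 \<bullet> v)) (at x)"
    by (rule has_derivative_transform_within_open[where s="- ?S" and f="\<lambda>_. 0"])
       (use x closure_subset[of "{x. \<psi> x \<noteq> 0}"] in auto)
  then show "grad \<psi> x = 0" by (rule grad_eqI)
qed

lemma test_functions_support:
  assumes "\<psi> \<in> test_functions A"
  shows "\<psi> \<in> test_functions (closure {x. \<psi> x \<noteq> 0})" "compact (closure {x. \<psi> x \<noteq> 0})" "closure {x. \<psi> x \<noteq> 0} \<subseteq> A"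
  using assms by (auto simp: test_functions_def)

lemma compact_support_bounded:
  fixes f :: "'a::euclidean_space \<Rightarrow> 'b::real_normed_vector"
  assumes "continuous_on UNIV f" "compact K" "\<And>x. x \<notin> K \<Longrightarrow> f x = 0"
  shows "\<exists>B>0. \<forall>x. norm (f x) \<le> B"
proof -
  have "compact (f ` K)" using assms by (intro compact_continuous_image) (auto intro: continuous_on_subset)
  then obtain B where "B > 0" "\<forall>y\<in>f ` K. norm y \<le> B"
    using compact_imp_bounded bounded_pos by metis
  then show ?thesis using assms(3) by (metis imageI less_le_not_le linear norm_zero)
qed

lemma test_bounded:
  assumes "\<psi> \<in> test_functions A" shows "\<exists>B>0. \<forall>x. \<bar>\<psi> x\<bar> \<le> B"
  using compact_support_bounded[OF continuous_on_test[OF assms] test_functions_support(2)[OF assms]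
      grad_test_0(1)[OF test_functions_support(1)[OF assms]]] by simp

lemma grad_test_bounded:
  assumes "\<psi> \<in> test_functions A" shows "\<exists>B>0. \<forall>x. norm (grad \<psi> x) \<le> B"
  using compact_support_bounded[OF continuous_on_grad_test[OF assms] test_functions_support(2)[OF assms]
      grad_test_0(2)[OF test_functions_support(1)[OF assms]]] .

lemma test_functionsI:
  assumes "\<And>k. Ck k \<psi>" "compact K" "K \<subseteq> \<Omega>" "\<And>x. x \<notin> K \<Longrightarrow> \<psi> x = 0"
  shows "\<psi> \<in> test_functions \<Omega>"
proof -
  have "closure {x. \<psi> x \<noteq> 0} \<subseteq> K"
    using assms by (intro closure_minimal) (auto intro: compact_imp_closed)
  moreover then have "compact (closure {x. \<psi> x \<noteq> 0})"
    using assms(2) by (meson bounded_subset closed_closure compact_eq_bounded_closed)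
  ultimately show ?thesis using assms by (auto simp: test_functions_def)
qed

text \<open>These functions feed the fundamental lemma. In each coordinate two steps of slope
  proportional to n are multiplied. As \<open>smooth_step\<close> vanishes at 0 itself, the limit is
  exact on the boundary of the open box, not just almost everywhere.\<close>

lemma box_indicator_test_limit:
  fixes a b :: "'a::euclidean_space"
  shows "\<exists>\<psi>. (\<forall>n. \<psi> n \<in> test_functions UNIV) \<and> (\<forall>n x. 0 \<le> \<psi> n x \<and> \<psi> n x \<le> 1) \<and>
    (\<forall>x. (\<lambda>n. \<psi> n x) \<longlonglongrightarrow> indicator (box a b) x)"
proof -
  define \<psi> where "\<psi> n x = (\<Prod>i\<in>Basis. smooth_step (real n * (x \<bullet> i - a \<bullet> i)) * smooth_step (real n * (b \<bullet> i - x \<bullet> i)))" for n x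
  have "Ck k (\<lambda>x. smooth_step (real n * (x \<bullet> i - a \<bullet> i)))" "Ck k (\<lambda>x. smooth_step (real n * (b \<bullet> i - x \<bullet> i)))" for n i k
  proof -
    have "(\<lambda>x. real n * (x \<bullet> i - a \<bullet> i)) = (\<lambda>x. x \<bullet> (real n *\<^sub>R i) + (- real n * (a \<bullet> i)))"
      "(\<lambda>x. real n * (b \<bullet> i - x \<bullet> i)) = (\<lambda>x. x \<bullet> (- real n *\<^sub>R i) + real n * (b \<bullet> i))"
      by (auto simp: fun_eq_iff algebra_simps)
    moreover have "Ck k (\<lambda>x. x \<bullet> (real n *\<^sub>R i) + (- real n * (a \<bullet> i)))" "Ck k (\<lambda>x. x \<bullet> (- real n *\<^sub>R i) + real n * (b \<bullet> i))"
      by (intro Ck_add Ck_const Ck_inner)+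
    ultimately show "Ck k (\<lambda>x. smooth_step (real n * (x \<bullet> i - a \<bullet> i)))" "Ck k (\<lambda>x. smooth_step (real n * (b \<bullet> i - x \<bullet> i)))"
      by (simp_all only: Ck_compose[OF Ck_smooth_step])
  qed
  then have C: "Ck k (\<psi> n)" for k n
    unfolding \<psi>_def[abs_def] by (intro Ck_prod Ck_mult)
  have lim: "(\<lambda>n. \<psi> n x) \<longlonglongrightarrow> indicator (box a b) x" for x
  proof (cases "x \<in> box a b")
    case True
    have *: "(\<lambda>n. smooth_step (real n * c)) \<longlonglongrightarrow> 1" if "c > 0" for c
    proof (rule Lim_transform_eventually[OF tendsto_const])
      have "eventually (\<lambda>n. real n > 1 / c) sequentially"
        using filterlim_real_sequentially filterlim_at_top_dense by metis
      then show "eventually (\<lambda>n. 1 = smooth_step (real n * c)) sequentially"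
        by eventually_elim (use that in \<open>auto simp: smooth_step_1 field_simps\<close>)
    qed
    have "(\<lambda>n. \<psi> n x) \<longlonglongrightarrow> (\<Prod>i\<in>(Basis::'a set). 1 * 1)"
      unfolding \<psi>_def using True by (intro tendsto_prod tendsto_mult *) (auto simp: mem_box)
    then show ?thesis using True by simp
  next
    case False
    then obtain i where "i \<in> Basis" "x \<bullet> i \<le> a \<bullet> i \<or> b \<bullet> i \<le> x \<bullet> i" by (auto simp: mem_box)
    then have "smooth_step (real n * (x \<bullet> i - a \<bullet> i)) * smooth_step (real n * (b \<bullet> i - x \<bullet> i)) = 0" for n
      by (auto simp: smooth_step_0 mult_nonneg_nonpos)
    with \<open>i \<in> Basis\<close> have "\<psi> n x = 0" for n unfolding \<psi>_def by (auto intro!: prod_zero)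
    then show ?thesis using False by simp
  qed
  have "\<psi> n x = 0" if "x \<notin> cbox a b" for n x
  proof -
    from that obtain i where "i \<in> Basis" "x \<bullet> i \<le> a \<bullet> i \<or> b \<bullet> i \<le> x \<bullet> i" by (force simp: mem_box)
    then have "smooth_step (real n * (x \<bullet> i - a \<bullet> i)) * smooth_step (real n * (b \<bullet> i - x \<bullet> i)) = 0"
      by (auto simp: smooth_step_0 mult_nonneg_nonpos)
    with \<open>i \<in> Basis\<close> show "\<psi> n x = 0" unfolding \<psi>_def by (auto intro!: prod_zero)
  qed
  then have "\<psi> n \<in> test_functions UNIV" for n
    by (intro test_functionsI[where K="cbox a b"] C) auto
  moreover have "0 \<le> \<psi> n x \<and> \<psi> n x \<le> 1" for n x
    unfolding \<psi>_def by (auto intro!: prod_nonneg prod_le_1 mult_nonneg_nonneg mult_le_one simp: smooth_step_range)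
  ultimately show ?thesis using lim by blast
qed

text \<open>The step is applied to R^2 - |x - x0|^2, a polynomial, because the norm is not smooth at
  the centre. Its gradient has length at most 2R, and dividing by R^2 - r^2 = (R - r)(R + r) leaves
  2 / (R - r). The constant comes before all balls in the quantifier order, as the iteration needs
  one constant for infinitely many pairs of radii.\<close>

lemma ball_cutoff:
  "\<exists>L>0. \<forall>(x0::'a::euclidean_space) r R. 0 < r \<and> r < R \<longrightarrow>
     (\<exists>\<eta>. \<eta> \<in> test_functions (cball x0 R) \<and> (\<forall>x. 0 \<le> \<eta> x \<and> \<eta> x \<le> 1) \<and>
        (\<forall>x\<in>cball x0 r. \<eta> x = 1) \<and> (\<forall>x. norm (grad \<eta> x) \<le> L / (R - r)))"
proof -
  obtain L where L: "L > 0" "\<And>t. \<bar>deriv smooth_step t\<bar> \<le> L" using deriv_smooth_step_bounded by blast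
  show ?thesis
  proof (intro exI[of _ "2 * L"] conjI allI impI)
    fix x0 :: 'a and r R :: real
    assume rR: "0 < r \<and> r < R"
    define s where "s = R^2 - r^2"
    have s: "s > 0" using rR by (simp add: s_def power2_eq_square mult_strict_mono)
    define \<eta> where "\<eta> x = smooth_step ((R^2 - (x - x0) \<bullet> (x - x0)) / s)" for x
    have "(x - x0) \<bullet> (x - x0) = (\<Sum>i\<in>Basis. ((x \<bullet> i) + - (x0 \<bullet> i)) * ((x \<bullet> i) + - (x0 \<bullet> i)))" for x
      by (subst euclidean_inner) (simp add: inner_diff_left)
    then have "(\<lambda>x. (R^2 - (x - x0) \<bullet> (x - x0)) / s) =
        (\<lambda>x. R^2/s + (-1/s) * (\<Sum>i\<in>Basis. ((x \<bullet> i) + - (x0 \<bullet> i)) * ((x \<bullet> i) + - (x0 \<bullet> i))))"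
      by (simp add: diff_divide_distrib)
    moreover have "Ck k (\<lambda>x. R^2/s + (-1/s) * (\<Sum>i\<in>Basis. ((x \<bullet> i) + - (x0 \<bullet> i)) * ((x \<bullet> i) + - (x0 \<bullet> i))))" for k
      by (intro Ck_mult Ck_add Ck_const Ck_inner Ck_sum)
    ultimately have C: "Ck k \<eta>" for k
      unfolding \<eta>_def[abs_def] by (intro Ck_compose[OF Ck_smooth_step]) simp
    have n2: "(x - x0) \<bullet> (x - x0) = (dist x0 x)^2" for x
      by (subst dist_commute) (simp add: dist_norm power2_norm_eq_inner)
    have z: "\<eta> x = 0" if "x \<notin> cball x0 R" for x
    proof -
      have "R^2 \<le> (dist x0 x)^2" using that rR by (intro power_mono) auto
      then show ?thesis using s by (simp add: \<eta>_def n2 smooth_step_0 divide_nonpos_pos)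
    qed
    have o: "\<eta> x = 1" if "x \<in> cball x0 r" for x
    proof -
      have "(dist x0 x)^2 \<le> r^2" using that by (intro power_mono) auto
      then show ?thesis using s by (simp add: \<eta>_def n2 smooth_step_1 s_def)
    qed
    have T: "\<eta> \<in> test_functions (cball x0 R)"
      using z by (intro test_functionsI[where K="cball x0 R"] C) auto
    have g: "grad \<eta> x = (deriv smooth_step ((R^2 - (x - x0) \<bullet> (x - x0)) / s) * (- 2 / s)) *\<^sub>R (x - x0)" for x
    proof (rule grad_eqI)
      have "((\<lambda>x. (R^2 - (x - x0) \<bullet> (x - x0)) / s) has_derivative (\<lambda>v. (- 2 / s) * ((x - x0) \<bullet> v))) (at x)"
        using s by (auto intro!: derivative_eq_intros simp: inner_commute fun_eq_iff)
      from has_derivative_compose[OF this smooth_step_has_derivative[unfolded has_field_derivative_def]]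
      show "(\<eta> has_derivative (\<bullet>) ((deriv smooth_step ((R^2 - (x - x0) \<bullet> (x - x0)) / s) * (- 2 / s)) *\<^sub>R (x - x0))) (at x)"
        unfolding \<eta>_def[abs_def] by (rule has_derivative_eq_rhs) (simp add: fun_eq_iff)
    qed
    have "norm (grad \<eta> x) \<le> 2 * L / (R - r)" for x
    proof (cases "x \<in> cball x0 R")
      case True
      have "norm (grad \<eta> x) = \<bar>deriv smooth_step ((R^2 - (x - x0) \<bullet> (x - x0)) / s)\<bar> * (2 / s) * norm (x - x0)"
        using s by (simp add: g abs_mult)
      also have "\<dots> \<le> L * (2 / s) * R"
        using True L s rR by (intro mult_mono) (auto simp: dist_norm norm_minus_commute)
      also have "\<dots> = 2 * L * R / ((R - r) * (R + r))"
        by (simp add: s_def power2_eq_square algebra_simps)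
      also have "\<dots> \<le> 2 * L * (R + r) / ((R - r) * (R + r))"
        using rR L by (intro divide_right_mono mult_left_mono) auto
      also have "\<dots> = 2 * L / (R - r)" using rR by simp
      finally show ?thesis .
    next
      case False
      then show ?thesis using grad_test_0(2)[OF T False] L rR by simp
    qed
    with T o show "\<exists>\<eta>. \<eta> \<in> test_functions (cball x0 R) \<and> (\<forall>x. 0 \<le> \<eta> x \<and> \<eta> x \<le> 1) \<and>
        (\<forall>x\<in>cball x0 r. \<eta> x = 1) \<and> (\<forall>x. norm (grad \<eta> x) \<le> 2 * L / (R - r))"
      by (intro exI[of _ \<eta>]) (auto simp: \<eta>_def smooth_step_range)
  qed (use L in simp)
qed

section \<open>Weak gradients on the whole space\<close>

subsection \<open>Translations\<close>

lemma lborel_distr_translate: "distr lborel borel (\<lambda>x::'a::euclidean_space. x + c) = lborel"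
proof -
  have "(\<lambda>x. x + c) = (+) c" by (simp add: fun_eq_iff add.commute)
  then show ?thesis using lborel_distr_plus[of c] by simp
qed

lemma nn_integral_translate:
  fixes c :: "'a::euclidean_space"
  assumes [measurable]: "f \<in> borel_measurable borel"
  shows "(\<integral>\<^sup>+x. f (x + c) \<partial>lborel) = (\<integral>\<^sup>+x. f x \<partial>lborel)"
  by (subst (2) lborel_distr_translate[of c, symmetric]) (simp add: nn_integral_distr)

lemma integral_translate:
  fixes c :: "'a::euclidean_space" and f :: "'a \<Rightarrow> 'b::{banach, second_countable_topology}"
  assumes [measurable]: "f \<in> borel_measurable borel"
  shows "(\<integral>x. f (x + c) \<partial>lborel) = (\<integral>x. f x \<partial>lborel)"
  by (subst (2) lborel_distr_translate[of c, symmetric]) (simp add: integral_distr)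

lemma integrable_translate:
  fixes c :: "'a::euclidean_space" and f :: "'a \<Rightarrow> 'b::{banach, second_countable_topology}"
  assumes "integrable lborel f"
  shows "integrable lborel (\<lambda>x. f (x + c))"
proof -
  have [measurable]: "f \<in> borel_measurable borel" using assms by auto
  from assms show ?thesis
    by (subst (asm) lborel_distr_translate[of c, symmetric]) (simp add: integrable_distr_eq)
qed

lemma Ck_translate: "Ck k f \<Longrightarrow> Ck k (\<lambda>x. f (x - c))"
proof (induction k arbitrary: f)
  case 0
  then show ?case by (auto intro!: continuous_on_compose2[of UNIV f] continuous_intros)
next
  case (Suc k)
  have "((\<lambda>x. f (x - c)) has_derivative frechet_derivative f (at (x - c))) (at x)" for x
  proof -
    have "((\<lambda>x. x - c) has_derivative (\<lambda>h. h)) (at x)" by (auto intro!: derivative_eq_intros)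
    from has_derivative_compose[OF this Ck_Suc_has_derivative[OF Suc.prems]] show ?thesis .
  qed
  then show ?case by (rule Ck_SucI) (use Suc in \<open>auto intro!: Suc.IH[of "\<lambda>x. frechet_derivative f (at x) _"]\<close>)
qed

lemma test_functions_translate:
  assumes "\<psi> \<in> test_functions UNIV"
  shows "(\<lambda>x. \<psi> (x - c)) \<in> test_functions UNIV"
proof (rule test_functionsI[where K="(+) c ` closure {x. \<psi> x \<noteq> 0}"])
  show "compact ((+) c ` closure {x. \<psi> x \<noteq> 0})"
    by (intro compact_translation test_functions_support[OF assms])
  show "\<psi> (x - c) = 0" if "x \<notin> (+) c ` closure {x. \<psi> x \<noteq> 0}" for x
    using that closure_subset[of "{x. \<psi> x \<noteq> 0}"] by (force simp: image_iff)
qed (use assms in \<open>auto simp: test_functions_def intro!: Ck_translate\<close>)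

lemma grad_translate:
  assumes "\<psi> \<in> test_functions UNIV"
  shows "grad (\<lambda>x. \<psi> (x - c)) x = grad \<psi> (x - c)"
  by (rule grad_eqI, rule has_derivative_eq_rhs[OF has_derivative_compose[OF _ test_functions_has_derivative[OF assms]]])
     (auto intro!: derivative_eq_intros)

lemma test_lipschitz:
  assumes "\<psi> \<in> test_functions A"
  shows "\<exists>B>0. \<forall>x y. \<bar>\<psi> x - \<psi> y\<bar> \<le> B * norm (x - y)"
proof -
  obtain B where B: "B > 0" "\<And>x. norm (grad \<psi> x) \<le> B" using grad_test_bounded[OF assms] by blast
  have "norm (\<psi> x - \<psi> y) \<le> B * norm (x - y)" for x y
  proof (rule differentiable_bound[where S=UNIV and f'="\<lambda>x v. grad \<psi> x \<bullet> v"])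
    show "onorm (\<lambda>v. grad \<psi> x \<bullet> v) \<le> B" for x
    proof (rule onorm_bound)
      show "norm (grad \<psi> x \<bullet> v) \<le> B * norm v" for v
        using order_trans[OF Cauchy_Schwarz_ineq2 mult_right_mono[OF B(2)[of x] norm_ge_zero[of v]]] by simp
    qed (use B in simp)
  qed (use test_functions_has_derivative[OF assms] in auto)
  with B(1) show ?thesis by auto
qed

subsection \<open>The fundamental lemma of the calculus of variations\<close>

text \<open>Dominated convergence carries the hypothesis from test functions to indicators of boxes.
  Boxes form an intersection-stable generator of the Borel sets, so g has integral 0 over every
  Borel set and is the density of the zero measure.\<close>

lemma fundamental_lemma:
  fixes g :: "'a::euclidean_space \<Rightarrow> real"
  assumes g: "integrable lborel g"
    and z: "\<And>\<psi>. \<psi> \<in> test_functions UNIV \<Longrightarrow> (\<integral>x. g x * \<psi> x \<partial>lborel) = 0"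
  shows "AE x in lborel. g x = 0"
proof -
  have [measurable]: "g \<in> borel_measurable borel" using g by auto
  have box: "(LINT x:box a b|lborel. g x) = 0" for a b
  proof -
    obtain \<psi> where \<psi>: "\<And>n. \<psi> n \<in> test_functions UNIV" "\<And>n x. 0 \<le> \<psi> n x \<and> \<psi> n x \<le> 1"
      "\<And>x. (\<lambda>n. \<psi> n x) \<longlonglongrightarrow> indicator (box a b) x"
      using box_indicator_test_limit[of a b] by blast
    have [measurable]: "\<psi> n \<in> borel_measurable borel" for n using \<psi>(1) test_functions_borel by blast
    have "(\<lambda>n. \<integral>x. g x * \<psi> n x \<partial>lborel) \<longlonglongrightarrow> (\<integral>x. g x * indicator (box a b) x \<partial>lborel)"
    proof (rule integral_dominated_convergence[where w="\<lambda>x. \<bar>g x\<bar>"])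
      show "AE x in lborel. (\<lambda>n. g x * \<psi> n x) \<longlonglongrightarrow> g x * indicator (box a b) x"
        by (intro AE_I2 tendsto_intros \<psi>)
      show "AE x in lborel. norm (g x * \<psi> n x) \<le> \<bar>g x\<bar>" for n
        using \<psi>(2)[of n] by (auto simp: abs_mult intro!: mult_left_le)
    qed (use g in auto)
    then have "(\<integral>x. g x * indicator (box a b) x \<partial>lborel) = 0"
      using z[OF \<psi>(1)] LIMSEQ_unique[OF _ tendsto_const] by force
    then show ?thesis by (simp add: set_lebesgue_integral_def mult.commute)
  qed
  \<comment> \<open>The integral over the whole space is needed for complements in the induction
    over the sigma-algebra; no single box provides it.\<close>
  have all: "(\<integral>x. g x \<partial>lborel) = 0"
  proof -
    let ?A = "\<lambda>n::nat. box (- (real n *\<^sub>R One)) (real n *\<^sub>R One) :: 'a set"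
    have "(\<lambda>n. \<integral>x. indicator (?A n) x *\<^sub>R g x \<partial>lborel) \<longlonglongrightarrow> (\<integral>x. g x \<partial>lborel)"
    proof (rule integral_dominated_convergence[where w="\<lambda>x. \<bar>g x\<bar>"])
      have "(\<lambda>n. indicator (?A n) x *\<^sub>R g x) \<longlonglongrightarrow> g x" for x
      proof -
        obtain m where m: "x \<in> ?A m" using UN_box_eq_UNIV by blast
        have "x \<in> ?A n" if "n \<ge> m" for n
        proof -
          have "real m \<le> real n" using that by simp
          with m show ?thesis by (force simp: mem_box)
        qed
        then have "eventually (\<lambda>n. x \<in> ?A n) sequentially"
          unfolding eventually_sequentially by blast
        then have "eventually (\<lambda>n. indicator (?A n) x *\<^sub>R g x = g x) sequentially"
          by eventually_elim simp
        then show ?thesis by (rule tendsto_eventually)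
      qed
      then show "AE x in lborel. (\<lambda>n. indicator (?A n) x *\<^sub>R g x) \<longlonglongrightarrow> g x" by auto
    qed (use g in \<open>auto simp: indicator_def\<close>)
    with box show ?thesis unfolding set_lebesgue_integral_def
      using LIMSEQ_unique[OF _ tendsto_const] by force
  qed
  have "(LINT x:A|lborel. g x) = 0" if "A \<in> sigma_sets UNIV (range (\<lambda>(a, b). box a b::'a set))" for A
  proof (rule sigma_sets_induct_disjoint[OF _ _ that, where P="\<lambda>A. (LINT x:A|lborel. g x) = 0"])
    have sig: "sigma_sets UNIV (range (\<lambda>(a, b). box a b::'a set)) = sets borel" by (simp add: borel_eq_box)
    have si: "set_integrable lborel A g" if "A \<in> sets borel" for A
      unfolding set_integrable_def using that g by (intro integrable_mult_indicator) auto
    show "Int_stable (range (\<lambda>(a, b). box a b::'a set))"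
      by (auto simp: Int_stable_def box_Int_box)
    show "(LINT x:UNIV - A|lborel. g x) = 0"
      if A: "A \<in> sigma_sets UNIV (range (\<lambda>(a, b). box a b::'a set))" "(LINT x:A|lborel. g x) = 0" for A
    proof -
      have [measurable]: "A \<in> sets borel" using A sig by simp
      have "(LINT x:A \<union> (UNIV - A)|lborel. g x) = (LINT x:A|lborel. g x) + (LINT x:UNIV - A|lborel. g x)"
        by (rule set_integral_Un) (auto intro!: si)
      then show ?thesis using A(2) all by (simp add: set_lebesgue_integral_def)
    qed
    show "(LINT x:(\<Union>i. A i)|lborel. g x) = 0"
      if "disjoint_family A" "range A \<subseteq> sigma_sets UNIV (range (\<lambda>(a, b). box a b::'a set))"
        "\<And>i. (LINT x:A i|lborel. g x) = 0" for A :: "nat \<Rightarrow> _"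
    proof -
      have [measurable]: "A i \<in> sets borel" for i using that(2) sig by auto
      have "(LINT x:(\<Union>i. A i)|lborel. g x) = (\<Sum>i. (LINT x:(A i)|lborel. g x))"
        using that(1) by (intro lebesgue_integral_countable_add si) (auto simp: disjoint_family_on_def)
      then show ?thesis using that(3) by simp
    qed
  qed (use box in \<open>auto simp: set_lebesgue_integral_def\<close>)
  then have "(LINT x:A|lborel. g x) = (LINT x:A|lborel. 0)" if "A \<in> sets lborel" for A
    using that by (simp add: borel_eq_box)
  from density_unique_real[OF g _ this] show ?thesis by simp
qed

subsection \<open>Continuity of translations in the mean\<close>

lemma emeasure_cball_less_top: "emeasure lborel (cball (x::'a::euclidean_space) r) < top"
  using emeasure_bounded_finite[OF bounded_cball, of x r] by simp

definition clamp :: "real \<Rightarrow> real \<Rightarrow> real" where "clamp M t = max (- M) (min M t)"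

text \<open>Measurability supplies continuous functions converging almost everywhere, but with no
  control of their size or support. Clamping at M and multiplying by a tent function creates an
  integrable majorant, so that the convergence holds in L1 too.\<close>

lemma continuous_dense_bounded:
  fixes g :: "'a::euclidean_space \<Rightarrow> real"
  assumes [measurable]: "g \<in> borel_measurable borel"
    and M: "\<And>x. \<bar>g x\<bar> \<le> M" and R: "\<And>x. norm x \<ge> R \<Longrightarrow> g x = 0" and e: "e > 0"
  shows "\<exists>c S. continuous_on UNIV c \<and> (\<forall>x. norm x \<ge> S \<longrightarrow> c x = 0) \<and> integrable lborel c \<and>
    (\<integral>x. \<bar>g x - c x\<bar> \<partial>lborel) < e"
proof -
  have M0: "M \<ge> 0" using M[of 0] by linarith
  have "g measurable_on UNIV"
    by (subst measurable_on_iff_borel_measurable) (auto simp: lebesgue_on_UNIV_eq intro!: measurable_completion)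
  then obtain N h where N: "negligible N" and h: "\<And>n. continuous_on UNIV (h n)"
    "\<And>x. x \<notin> N \<Longrightarrow> (\<lambda>n. h n x) \<longlonglongrightarrow> g x"
    unfolding measurable_on_def by auto
  \<comment> \<open>The tent equals 1 wherever \<open>norm x \<le> R\<close>, hence wherever g may
    be nonzero, and clamping at M does not alter g. So neither modification changes the
    limit.\<close>
  define c where "c n x = clamp M (h n x) * max 0 (min 1 (R + 1 - norm x))" for n x
  have cc: "continuous_on UNIV (c n)" for n
    unfolding c_def[abs_def] clamp_def by (intro continuous_intros h)
  then have [measurable]: "c n \<in> borel_measurable borel" for n by (rule borel_measurable_continuous_onI)
  have c0: "c n x = 0" if "norm x \<ge> R + 1" for n x using that by (simp add: c_def)
  have cM: "\<bar>c n x\<bar> \<le> M * indicator (cball 0 (R + 1)) x" for n x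
  proof (cases "norm x \<le> R + 1")
    case True
    have "\<bar>c n x\<bar> \<le> M * 1" unfolding c_def abs_mult using M0 by (intro mult_mono) (auto simp: clamp_def)
    then show ?thesis using True by simp
  next
    case False then show ?thesis using c0[of x n] by simp
  qed
  have gM: "\<bar>g x\<bar> \<le> M * indicator (cball 0 (R + 1)) x" for x
    using M[of x] R[of x] by (cases "norm x \<le> R + 1") auto
  have intM: "integrable lborel (\<lambda>x::'a. M * indicator (cball 0 (R + 1)) x)"
    by (intro integrable_mult_right integrable_real_indicator) (auto simp: emeasure_cball_less_top)
  have "AE x in lebesgue. x \<notin> N"
    using N by (simp add: negligible_iff_null_sets AE_not_in)
  then have "AE x in lborel. x \<notin> N"
    by (simp only: AE_completion_iff)
  have "(\<lambda>n. \<integral>x. \<bar>g x - c n x\<bar> \<partial>lborel) \<longlonglongrightarrow> (\<integral>x. 0 \<partial>(lborel :: 'a measure))"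
  proof (rule integral_dominated_convergence[where w="\<lambda>x. 2 * (M * indicator (cball 0 (R + 1)) x)"])
    show "AE x in lborel. (\<lambda>n. \<bar>g x - c n x\<bar>) \<longlonglongrightarrow> 0"
      using \<open>AE x in lborel. x \<notin> N\<close>
    proof eventually_elim
      case (elim x)
      have "(\<lambda>n. c n x) \<longlonglongrightarrow> clamp M (g x) * max 0 (min 1 (R + 1 - norm x))"
        unfolding c_def clamp_def by (intro tendsto_intros h elim)
      also have "clamp M (g x) * max 0 (min 1 (R + 1 - norm x)) = g x"
        using M[of x] R[of x] by (cases "norm x \<ge> R") (auto simp: clamp_def)
      finally show ?case
        using tendsto_rabs[OF tendsto_diff[OF tendsto_const, of "\<lambda>n. c n x" "g x" sequentially "g x"]] by simp
    qed
    show "AE x in lborel. norm \<bar>g x - c n x\<bar> \<le> 2 * (M * indicator (cball 0 (R + 1)) x)" for n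
    proof (rule AE_I2)
      show "norm \<bar>g x - c n x\<bar> \<le> 2 * (M * indicator (cball 0 (R + 1)) x)" for x
        using cM[of n x] gM[of x] by (simp only: real_norm_def)
    qed
  qed (use intM in auto)
  then have "eventually (\<lambda>n. (\<integral>x. \<bar>g x - c n x\<bar> \<partial>lborel) < e) sequentially"
    using e by (auto intro: order_tendstoD)
  then obtain n where n: "(\<integral>x. \<bar>g x - c n x\<bar> \<partial>lborel) < e" by (auto simp: eventually_sequentially)
  have "integrable lborel (c n)"
    by (rule Bochner_Integration.integrable_bound[OF intM]) (use cM M0 in \<open>auto simp: abs_mult\<close>)
  with n cc c0 show ?thesis by blast
qed

lemma continuous_dense_L1:
  fixes g :: "'a::euclidean_space \<Rightarrow> real"
  assumes g: "integrable lborel g" and e: "e > 0"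
  shows "\<exists>c S. continuous_on UNIV c \<and> (\<forall>x. norm x \<ge> S \<longrightarrow> c x = 0) \<and> integrable lborel c \<and>
    (\<integral>x. \<bar>g x - c x\<bar> \<partial>lborel) < e"
proof -
  have [measurable]: "g \<in> borel_measurable borel" using g by auto
  define f where "f n x = clamp (real n) (g x) * indicator (ball 0 (real n)) x" for n :: nat and x
  have [measurable]: "ball (0::'a) r \<in> sets borel" for r by simp
  have [measurable]: "f n \<in> borel_measurable borel" for n
    unfolding f_def[abs_def] clamp_def by measurable
  have fg: "\<bar>f n x\<bar> \<le> \<bar>g x\<bar>" for n x by (auto simp: f_def clamp_def indicator_def)
  have "(\<lambda>n. \<integral>x. \<bar>g x - f n x\<bar> \<partial>lborel) \<longlonglongrightarrow> (\<integral>x. 0 \<partial>(lborel :: 'a measure))"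
  proof (rule integral_dominated_convergence[where w="\<lambda>x. 2 * \<bar>g x\<bar>"])
    have "(\<lambda>n. \<bar>g x - f n x\<bar>) \<longlonglongrightarrow> 0" for x
    proof (rule tendsto_eventually)
      obtain m :: nat where m: "max (\<bar>g x\<bar>) (norm x) < real m" using reals_Archimedean2 by blast
      then have "\<bar>g x - f n x\<bar> = 0" if "n \<ge> m" for n
      proof -
        have "real n \<ge> real m" using that by simp
        with m show ?thesis by (auto simp: f_def clamp_def)
      qed
      then show "eventually (\<lambda>n. \<bar>g x - f n x\<bar> = 0) sequentially" by (auto simp: eventually_sequentially)
    qed
    then show "AE x in lborel. (\<lambda>n. \<bar>g x - f n x\<bar>) \<longlonglongrightarrow> 0" by auto
    show "AE x in lborel. norm \<bar>g x - f n x\<bar> \<le> 2 * \<bar>g x\<bar>" for n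
    proof (rule AE_I2)
      show "norm \<bar>g x - f n x\<bar> \<le> 2 * \<bar>g x\<bar>" for x
        using fg[of n x] by (simp only: real_norm_def)
    qed
  qed (use g in auto)
  note lim = this
  have "eventually (\<lambda>n. (\<integral>x. \<bar>g x - f n x\<bar> \<partial>lborel) < e/2) sequentially"
    using order_tendstoD(2)[OF lim, of "e/2"] e by simp
  then obtain n where n: "(\<integral>x. \<bar>g x - f n x\<bar> \<partial>lborel) < e/2" by (auto simp: eventually_sequentially)
  obtain c S where c: "continuous_on UNIV c" "\<forall>x. norm x \<ge> S \<longrightarrow> c x = 0" "integrable lborel c"
    "(\<integral>x. \<bar>f n x - c x\<bar> \<partial>lborel) < e/2"
  proof -
    have "\<bar>f n x\<bar> \<le> real n" "real n \<le> norm x \<Longrightarrow> f n x = 0" for x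
      by (auto simp: f_def clamp_def indicator_def)
    moreover have "e / 2 > 0" using e by simp
    moreover have "f n \<in> borel_measurable borel" by simp
    ultimately show ?thesis
      using continuous_dense_bounded[of "f n" "real n" "real n" "e/2"] that by blast
  qed
  have fi: "integrable lborel (f n)"
    by (rule Bochner_Integration.integrable_bound[OF g]) (use fg in auto)
  have "(\<integral>x. \<bar>g x - c x\<bar> \<partial>lborel) \<le> (\<integral>x. \<bar>g x - f n x\<bar> + \<bar>f n x - c x\<bar> \<partial>lborel)"
    using g fi c(3) by (intro integral_mono) auto
  also have "\<dots> < e" using g fi c n by (subst Bochner_Integration.integral_add) auto
  finally show ?thesis using c by blast
qed

lemma continuous_translate_L1:
  fixes g :: "'a::euclidean_space \<Rightarrow> real"
  assumes g: "integrable lborel g" and e: "e > 0"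
  shows "\<exists>d>0. \<forall>z. norm z < d \<longrightarrow> (\<integral>\<^sup>+x. \<bar>g (x + z) - g x\<bar> \<partial>lborel) \<le> ennreal e"
proof -
  have [measurable]: "g \<in> borel_measurable borel" using g by auto
  obtain c S0 where c: "continuous_on UNIV c" "\<And>x. norm x \<ge> S0 \<Longrightarrow> c x = 0" "integrable lborel c"
    "(\<integral>x. \<bar>g x - c x\<bar> \<partial>lborel) < e/3"
    using continuous_dense_L1[OF g divide_pos_pos[OF e zero_less_numeral]] by blast
  have [measurable]: "c \<in> borel_measurable borel" using c by auto
  define S where "S = max S0 0"
  have cS: "c x = 0" if "norm x \<ge> S" for x using c(2) that by (simp add: S_def)
  define V where "V = measure lborel (cball (0::'a) (S + 1))"
  have V: "emeasure lborel (cball (0::'a) (S + 1)) = ennreal V" "V \<ge> 0"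
    by (simp_all add: V_def emeasure_eq_ennreal_measure less_imp_neq[OF emeasure_cball_less_top])
  have "uniformly_continuous_on (cball 0 (S + 2)) c"
    by (intro compact_uniformly_continuous) (auto intro: continuous_on_subset[OF c(1)])
  moreover have "e / (3 * (V + 1)) > 0" using e V by simp
  ultimately obtain d where d: "d > 0"
    "\<And>x y. x \<in> cball 0 (S+2) \<Longrightarrow> y \<in> cball 0 (S+2) \<Longrightarrow> dist y x < d \<Longrightarrow> dist (c y) (c x) < e / (3 * (V + 1))"
    unfolding uniformly_continuous_on_def by metis
  show ?thesis
  proof (intro exI[of _ "min d 1"] conjI allI impI)
    fix z :: 'a assume z: "norm z < min d 1"
    have b: "\<bar>c (x + z) - c x\<bar> \<le> e / (3 * (V + 1)) * indicator (cball 0 (S + 1)) x" for x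
    proof (cases "norm x \<le> S + 1")
      case True
      then have "norm (x + z) \<le> S + 2" using z norm_triangle_ineq[of x z] by linarith
      then have "dist (c (x + z)) (c x) < e / (3 * (V + 1))"
        using True z by (intro d(2)) (simp_all add: dist_norm[of "x + z" x])
      then show ?thesis using True by (simp add: dist_real_def)
    next
      case False
      then have "norm (x + z) \<ge> S" using z norm_diff_ineq[of x z] by linarith
      then show ?thesis using False cS[of x] cS[of "x + z"] by simp
    qed
    have i1: "(\<integral>\<^sup>+x. \<bar>c (x + z) - c x\<bar> \<partial>lborel) \<le> ennreal (e/3)"
    proof -
      have "(\<integral>\<^sup>+x. \<bar>c (x + z) - c x\<bar> \<partial>lborel) \<le> (\<integral>\<^sup>+x. ennreal (e / (3 * (V + 1))) * indicator (cball (0::'a) (S + 1)) x \<partial>lborel)"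
      proof (rule nn_integral_mono)
        show "ennreal \<bar>c (x + z) - c x\<bar> \<le> ennreal (e / (3 * (V + 1))) * indicator (cball 0 (S + 1)) x" for x
          using b[of x] by (cases "x \<in> cball 0 (S + 1)") (simp_all add: ennreal_leI)
      qed
      also have "\<dots> = ennreal (e / (3 * (V + 1)) * V)"
        using V e by (simp add: nn_integral_cmult_indicator ennreal_mult'[symmetric])
      also have "\<dots> \<le> ennreal (e/3)" using V e by (intro ennreal_leI) (simp add: field_simps)
      finally show ?thesis .
    qed
    have i2: "(\<integral>\<^sup>+x. \<bar>g x - c x\<bar> \<partial>lborel) \<le> ennreal (e/3)"
      using c(4) g c(3) by (subst nn_integral_eq_integral) (auto intro!: ennreal_leI)
    have i3: "(\<integral>\<^sup>+x. \<bar>g (x + z) - c (x + z)\<bar> \<partial>lborel) \<le> ennreal (e/3)"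
      using i2 nn_integral_translate[of "\<lambda>x. ennreal \<bar>g x - c x\<bar>" z] by simp
    have "(\<integral>\<^sup>+x. \<bar>g (x + z) - g x\<bar> \<partial>lborel) \<le>
       (\<integral>\<^sup>+x. ennreal \<bar>g (x + z) - c (x + z)\<bar> + (ennreal \<bar>c (x + z) - c x\<bar> + ennreal \<bar>g x - c x\<bar>) \<partial>lborel)"
      by (intro nn_integral_mono) (auto simp flip: ennreal_plus intro!: ennreal_leI)
    also have "\<dots> = (\<integral>\<^sup>+x. \<bar>g (x + z) - c (x + z)\<bar> \<partial>lborel) + ((\<integral>\<^sup>+x. \<bar>c (x + z) - c x\<bar> \<partial>lborel) + (\<integral>\<^sup>+x. \<bar>g x - c x\<bar> \<partial>lborel))"
      by (subst nn_integral_add, simp, simp)+ simp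
    also have "\<dots> \<le> ennreal (e/3) + (ennreal (e/3) + ennreal (e/3))"
      by (intro add_mono i1 i2 i3)
    also have "\<dots> = ennreal e" using e by (simp flip: ennreal_plus)
    finally show "(\<integral>\<^sup>+x. \<bar>g (x + z) - g x\<bar> \<partial>lborel) \<le> ennreal e" .
  qed (use d in auto)
qed

subsection \<open>Weak gradients and difference quotients\<close>

text \<open>Functions live on the whole space and are integrable there, so that translates are again
  admissible and no domain has to be tracked. Arbitrary directions v are used because difference
  quotients are taken along arbitrary vectors.\<close>

definition weak_grad :: "('a::euclidean_space \<Rightarrow> real) \<Rightarrow> ('a \<Rightarrow> 'a) \<Rightarrow> bool" where
  "weak_grad w H \<longleftrightarrow> integrable lborel w \<and> integrable lborel H \<and>
     (\<forall>\<psi>\<in>test_functions UNIV. \<forall>v. (\<integral>x. w x * (grad \<psi> x \<bullet> v) \<partial>lborel) = - (\<integral>x. (H x \<bullet> v) * \<psi> x \<partial>lborel))"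

lemma weak_gradD:
  assumes "weak_grad w H"
  shows "integrable lborel w" "integrable lborel H" "w \<in> borel_measurable borel" "H \<in> borel_measurable borel"
    "\<psi> \<in> test_functions UNIV \<Longrightarrow> (\<integral>x. w x * (grad \<psi> x \<bullet> v) \<partial>lborel) = - (\<integral>x. (H x \<bullet> v) * \<psi> x \<partial>lborel)"
  using assms by (auto simp: weak_grad_def)

lemma pair_integrableI:
  fixes f :: "'a::euclidean_space \<Rightarrow> 'b::euclidean_space \<Rightarrow> real"
  assumes [measurable]: "case_prod f \<in> borel_measurable (lborel \<Otimes>\<^sub>M lborel)"
    and "(\<integral>\<^sup>+t. (\<integral>\<^sup>+x. ennreal \<bar>f x t\<bar> \<partial>lborel) \<partial>lborel) < \<infinity>"
  shows "integrable (lborel \<Otimes>\<^sub>M lborel) (case_prod f)"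
proof (rule integrableI_bounded)
  have "(\<integral>\<^sup>+p. ennreal (norm (case_prod f p)) \<partial>(lborel \<Otimes>\<^sub>M lborel)) =
      (\<integral>\<^sup>+t. (\<integral>\<^sup>+x. ennreal \<bar>f x t\<bar> \<partial>lborel) \<partial>lborel)"
    by (subst lborel_pair.nn_integral_snd[symmetric]) (auto simp: case_prod_unfold)
  then show "(\<integral>\<^sup>+p. ennreal (norm (case_prod f p)) \<partial>(lborel \<Otimes>\<^sub>M lborel)) < \<infinity>" using assms(2) by simp
qed simp

lemma test_function_increment:
  assumes "\<psi> \<in> test_functions UNIV"
  shows "(\<integral>t. indicator {0..1::real} t * (grad \<psi> (y - t *\<^sub>R z) \<bullet> z) \<partial>lborel) = \<psi> y - \<psi> (y - z)"
proof -
  have "(\<integral>t. indicator {0..1::real} t *\<^sub>R (- (grad \<psi> (y - t *\<^sub>R z) \<bullet> z)) \<partial>lborel) = \<psi> (y - 1 *\<^sub>R z) - \<psi> (y - 0 *\<^sub>R z)"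
  proof (rule integral_FTC_Icc)
    show "((\<lambda>t. \<psi> (y - t *\<^sub>R z)) has_vector_derivative - (grad \<psi> (y - t *\<^sub>R z) \<bullet> z)) (at t within {0..1})" for t
    proof -
      have "((\<lambda>t. y - t *\<^sub>R z) has_derivative (\<lambda>h. - (h *\<^sub>R z))) (at t within {0..1})"
        by (auto intro!: derivative_eq_intros)
      from has_derivative_compose[OF this test_functions_has_derivative[OF assms]]
      show ?thesis by (simp add: has_vector_derivative_def)
    qed
    show "continuous_on {0..1} (\<lambda>t. - (grad \<psi> (y - t *\<^sub>R z) \<bullet> z))"
      by (intro continuous_intros continuous_on_compose2[OF continuous_on_grad_test[OF assms]]) auto
  qed simp
  then show ?thesis by simp
qed

lemma weak_grad_segment_integrable:
  assumes W: "weak_grad w H"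
  shows "integrable (lborel \<Otimes>\<^sub>M lborel) (\<lambda>(x, t). indicator {0..1::real} t * (H (x + t *\<^sub>R z) \<bullet> z))"
proof (rule pair_integrableI)
  note [measurable] = weak_gradD(3,4)[OF W]
  show "(\<lambda>(x, t). indicator {0..1::real} t * (H (x + t *\<^sub>R z) \<bullet> z)) \<in> borel_measurable (lborel \<Otimes>\<^sub>M lborel)"
    by measurable
  have "(\<integral>\<^sup>+x. ennreal \<bar>indicator {0..1::real} t * (H (x + t *\<^sub>R z) \<bullet> z)\<bar> \<partial>lborel) =
      indicator {0..1::real} t * (\<integral>\<^sup>+x. ennreal \<bar>H x \<bullet> z\<bar> \<partial>lborel)" for t
    using nn_integral_translate[of "\<lambda>x. ennreal \<bar>H x \<bullet> z\<bar>" "t *\<^sub>R z"]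
    by (auto simp: indicator_def)
  moreover have "(\<integral>\<^sup>+x. ennreal \<bar>H x \<bullet> z\<bar> \<partial>lborel) < \<infinity>"
    using weak_gradD(2)[OF W] integrable_inner_left[of z lborel H] by (simp add: integrable_iff_bounded)
  ultimately show "(\<integral>\<^sup>+t. (\<integral>\<^sup>+x. ennreal \<bar>indicator {0..1::real} t * (H (x + t *\<^sub>R z) \<bullet> z)\<bar> \<partial>lborel) \<partial>lborel) < \<infinity>"
    by (simp add: nn_integral_multc)
qed

text \<open>This is the fundamental theorem of calculus along a segment. Against a test function,
  the translation by t z moves to the other factor, the weak gradient identity moves the derivative
  there as well, and the classical theorem for the test function finishes. The fundamental lemma
  then removes the test function.\<close>

lemma weak_grad_segment:
  assumes W: "weak_grad w H"
  shows "AE x in lborel. w (x + z) - w x = (\<integral>t. indicator {0..1::real} t * (H (x + t *\<^sub>R z) \<bullet> z) \<partial>lborel)"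
proof -
  note [measurable] = weak_gradD(3,4)[OF W]
  define F where "F x t = indicator {0..1::real} t * (H (x + t *\<^sub>R z) \<bullet> z)" for x t
  have F: "integrable (lborel \<Otimes>\<^sub>M lborel) (case_prod F)"
    using weak_grad_segment_integrable[OF W, of z] by (simp add: F_def[abs_def])
  define K where "K x = (\<integral>t. F x t \<partial>lborel)" for x
  have K: "integrable lborel K"
    unfolding K_def[abs_def] by (rule lborel_pair.integrable_fst[OF F])
  have [measurable]: "K \<in> borel_measurable borel" using K by auto
  have w1: "integrable lborel (\<lambda>x. w (x + z))" by (rule integrable_translate[OF weak_gradD(1)[OF W]])
  have "AE x in lborel. w (x + z) - w x - K x = 0"
  proof (rule fundamental_lemma)
    show "integrable lborel (\<lambda>x. w (x + z) - w x - K x)"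
      using w1 K weak_gradD(1)[OF W] by auto
    fix \<psi> :: "'a \<Rightarrow> real" assume T: "\<psi> \<in> test_functions UNIV"
    have [measurable]: "\<psi> \<in> borel_measurable borel" "grad \<psi> \<in> borel_measurable borel"
      using T test_functions_borel grad_test_borel by blast+
    obtain B where B: "B > 0" "\<And>x. \<bar>\<psi> x\<bar> \<le> B" using test_bounded[OF T] by blast
    obtain B' where B': "B' > 0" "\<And>x. norm (grad \<psi> x) \<le> B'" using grad_test_bounded[OF T] by blast
    have bd: "integrable lborel (\<lambda>x. f x * \<psi> x)" if f: "integrable lborel f" for f :: "'a \<Rightarrow> real"
    proof (rule Bochner_Integration.integrable_bound[of _ "\<lambda>x. B * f x"])
      show "AE x in lborel. norm (f x * \<psi> x) \<le> norm (B * f x)"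
        using B by (auto simp: abs_mult mult.commute intro!: mult_right_mono)
    qed (use f in auto)
    have FP: "integrable (lborel \<Otimes>\<^sub>M lborel) (\<lambda>(x, t). F x t * \<psi> x)"
    proof (rule Bochner_Integration.integrable_bound[of _ "\<lambda>p. B * case_prod F p"])
      show "AE p in lborel \<Otimes>\<^sub>M lborel. norm (case p of (x, t) \<Rightarrow> F x t * \<psi> x) \<le> norm (B * case_prod F p)"
        using B by (intro AE_I2) (auto simp: abs_mult mult.commute intro!: mult_right_mono)
      show "(\<lambda>(x, t). F x t * \<psi> x) \<in> borel_measurable (lborel \<Otimes>\<^sub>M lborel)"
        using borel_measurable_integrable[OF F] unfolding F_def by measurable
    qed (use F in auto)
    \<comment> \<open>\<open>G\<close> is the integrand after both the shift and the derivative have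
      been moved to the test function. Its joint integrability justifies exchanging the integrals
      back.\<close>
    define G where "G y t = indicator {0..1::real} t * (w y * (grad \<psi> (y - t *\<^sub>R z) \<bullet> z))" for y t
    have G: "integrable (lborel \<Otimes>\<^sub>M lborel) (case_prod G)"
    proof (rule pair_integrableI)
      show "case_prod G \<in> borel_measurable (lborel \<Otimes>\<^sub>M lborel)" unfolding G_def by measurable
      have "(\<integral>\<^sup>+t. (\<integral>\<^sup>+x. ennreal \<bar>G x t\<bar> \<partial>lborel) \<partial>lborel) \<le>
         (\<integral>\<^sup>+t. indicator {0..1::real} t * (\<integral>\<^sup>+x. ennreal (\<bar>w x\<bar> * (B' * norm z)) \<partial>lborel) \<partial>lborel)"
      proof (rule nn_integral_mono)
        fix t :: real
        have "\<bar>grad \<psi> (x - t *\<^sub>R z) \<bullet> z\<bar> \<le> B' * norm z" for x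
          using order_trans[OF Cauchy_Schwarz_ineq2 mult_right_mono[OF B'(2) norm_ge_zero]] .
        then show "(\<integral>\<^sup>+x. ennreal \<bar>G x t\<bar> \<partial>lborel) \<le> indicator {0..1::real} t * (\<integral>\<^sup>+x. ennreal (\<bar>w x\<bar> * (B' * norm z)) \<partial>lborel)"
          by (cases "t \<in> {0..1}") (auto simp: G_def abs_mult intro!: nn_integral_mono ennreal_leI mult_left_mono)
      qed
      also have "\<dots> = (\<integral>\<^sup>+x. ennreal (\<bar>w x\<bar> * (B' * norm z)) \<partial>lborel)"
        by (simp add: nn_integral_multc)
      also have "\<dots> < \<infinity>"
      proof -
        have "integrable lborel (\<lambda>x. w x * (B' * norm z))" using weak_gradD(1)[OF W] by (rule integrable_mult_left)
        then show ?thesis using B'(1) unfolding integrable_iff_bounded by (simp add: abs_mult)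
      qed
      finally show "(\<integral>\<^sup>+t. (\<integral>\<^sup>+x. ennreal \<bar>G x t\<bar> \<partial>lborel) \<partial>lborel) < \<infinity>" .
    qed
    have "(\<integral>x. K x * \<psi> x \<partial>lborel) = (\<integral>x. (\<integral>t. F x t * \<psi> x \<partial>lborel) \<partial>lborel)"
      unfolding K_def by simp
    also have "\<dots> = (\<integral>t. (\<integral>x. F x t * \<psi> x \<partial>lborel) \<partial>lborel)"
      by (rule lborel_pair.Fubini_integral[OF FP, symmetric])
    also have "\<dots> = (\<integral>t. - (\<integral>y. G y t \<partial>lborel) \<partial>lborel)"
    proof (rule Bochner_Integration.integral_cong[OF refl])
      fix t :: real
      have "(\<integral>x. F x t * \<psi> x \<partial>lborel) = indicator {0..1::real} t * (\<integral>x. (H (x + t *\<^sub>R z) \<bullet> z) * \<psi> ((x + t *\<^sub>R z) - t *\<^sub>R z) \<partial>lborel)"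
        unfolding F_def by (simp add: mult.assoc)
      also have "\<dots> = indicator {0..1::real} t * (\<integral>y. (H y \<bullet> z) * \<psi> (y - t *\<^sub>R z) \<partial>lborel)"
        by (subst integral_translate[of "\<lambda>y. (H y \<bullet> z) * \<psi> (y - t *\<^sub>R z)"]) auto
      also have "\<dots> = indicator {0..1::real} t * - (\<integral>y. w y * (grad \<psi> (y - t *\<^sub>R z) \<bullet> z) \<partial>lborel)"
        using weak_gradD(5)[OF W test_functions_translate[OF T, of "t *\<^sub>R z"], of z]
        by (simp add: grad_translate[OF T])
      also have "\<dots> = - (\<integral>y. G y t \<partial>lborel)" by (simp add: G_def)
      finally show "(\<integral>x. F x t * \<psi> x \<partial>lborel) = - (\<integral>y. G y t \<partial>lborel)" .
    qed
    also have "\<dots> = - (\<integral>y. (\<integral>t. G y t \<partial>lborel) \<partial>lborel)"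
      using lborel_pair.Fubini_integral[OF G] by simp
    also have "\<dots> = - (\<integral>y. w y * (\<psi> y - \<psi> (y - z)) \<partial>lborel)"
    proof -
      have "(\<integral>t. G y t \<partial>lborel) = w y * (\<integral>t. indicator {0..1::real} t * (grad \<psi> (y - t *\<^sub>R z) \<bullet> z) \<partial>lborel)" for y
        unfolding G_def by (subst integral_mult_right_zero[symmetric]) (simp add: ac_simps)
      then show ?thesis by (simp add: test_function_increment[OF T])
    qed
    also have "\<dots> = (\<integral>y. w y * \<psi> (y - z) \<partial>lborel) - (\<integral>y. w y * \<psi> y \<partial>lborel)"
    proof -
      have "integrable lborel (\<lambda>y. w y * \<psi> (y - z))"
        using integrable_translate[OF bd[OF w1], of "- z"] by simp
      then show ?thesis using bd[OF weak_gradD(1)[OF W]]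
        by (simp add: right_diff_distrib)
    qed
    also have "(\<integral>y. w y * \<psi> (y - z) \<partial>lborel) = (\<integral>x. w (x + z) * \<psi> x \<partial>lborel)"
      using integral_translate[of "\<lambda>y. w y * \<psi> (y - z)" z] by simp
    finally show "(\<integral>x. (w (x + z) - w x - K x) * \<psi> x \<partial>lborel) = 0"
      using bd[OF w1] bd[OF weak_gradD(1)[OF W]] bd[OF K] by (simp add: left_diff_distrib)
  qed
  then show ?thesis by eventually_elim (simp add: K_def F_def)
qed

lemma weak_grad_segment_bound:
  assumes W: "weak_grad w H"
  shows "AE x in lborel. ennreal \<bar>w (x + z) - w x - c x\<bar> \<le>
    (\<integral>\<^sup>+t. indicator {0..1::real} t * ennreal \<bar>H (x + t *\<^sub>R z) \<bullet> z - c x\<bar> \<partial>lborel)"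
  using weak_grad_segment[OF W, of z] lborel_pair.AE_integrable_fst[OF weak_grad_segment_integrable[OF W, of z]]
proof eventually_elim
  case (elim x)
  have i: "integrable lborel (\<lambda>t. indicator {0..1::real} t * c x)"
    by (intro integrable_mult_left integrable_real_indicator) auto
  have "w (x + z) - w x - c x = (\<integral>t. indicator {0..1::real} t * (H (x + t *\<^sub>R z) \<bullet> z) \<partial>lborel) - (\<integral>t. indicator {0..1::real} t * c x \<partial>lborel)"
    using elim(1) by simp
  also have "\<dots> = (\<integral>t. indicator {0..1::real} t * (H (x + t *\<^sub>R z) \<bullet> z - c x) \<partial>lborel)"
    by (subst Bochner_Integration.integral_diff[symmetric, OF elim(2) i]) (simp add: right_diff_distrib)
  finally have "ennreal \<bar>w (x + z) - w x - c x\<bar> = ennreal (norm (\<integral>t. indicator {0..1::real} t * (H (x + t *\<^sub>R z) \<bullet> z - c x) \<partial>lborel))"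
    by simp
  also have "\<dots> \<le> (\<integral>\<^sup>+t. ennreal (norm (indicator {0..1::real} t * (H (x + t *\<^sub>R z) \<bullet> z - c x))) \<partial>lborel)"
    using Bochner_Integration.integrable_diff[OF elim(2) i]
    by (intro integral_norm_bound_ennreal) (simp add: right_diff_distrib)
  also have "\<dots> = (\<integral>\<^sup>+t. indicator {0..1::real} t * ennreal \<bar>H (x + t *\<^sub>R z) \<bullet> z - c x\<bar> \<partial>lborel)"
    by (intro nn_integral_cong) (auto simp: indicator_def)
  finally show ?case .
qed

text \<open>The function \<open>c\<close> lets one estimate serve two purposes: it is the linear
  increment h (H \<bullet> v) for the convergence of difference quotients, and 0 for bounding mean
  oscillations over the set A.\<close>

lemma weak_grad_shift_L1:
  assumes W: "weak_grad w H" and [measurable]: "c \<in> borel_measurable borel" "A \<in> sets borel"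
  shows "(\<integral>\<^sup>+x. indicator A x * ennreal \<bar>w (x + z) - w x - c x\<bar> \<partial>lborel) \<le>
    (\<integral>\<^sup>+t. indicator {0..1::real} t * (\<integral>\<^sup>+x. indicator A x * ennreal \<bar>H (x + t *\<^sub>R z) \<bullet> z - c x\<bar> \<partial>lborel) \<partial>lborel)"
proof -
  note [measurable] = weak_gradD(3,4)[OF W]
  have "(\<integral>\<^sup>+x. indicator A x * ennreal \<bar>w (x + z) - w x - c x\<bar> \<partial>lborel) \<le>
     (\<integral>\<^sup>+x. indicator A x * (\<integral>\<^sup>+t. indicator {0..1::real} t * ennreal \<bar>H (x + t *\<^sub>R z) \<bullet> z - c x\<bar> \<partial>lborel) \<partial>lborel)"
    using weak_grad_segment_bound[OF W, of z c]
    by (intro nn_integral_mono_AE) (auto elim!: eventually_mono intro: mult_left_mono)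
  also have "\<dots> = (\<integral>\<^sup>+x. (\<integral>\<^sup>+t. indicator A x * (indicator {0..1::real} t * ennreal \<bar>H (x + t *\<^sub>R z) \<bullet> z - c x\<bar>) \<partial>lborel) \<partial>lborel)"
    by (simp add: nn_integral_cmult)
  also have "\<dots> = (\<integral>\<^sup>+t. (\<integral>\<^sup>+x. indicator A x * (indicator {0..1::real} t * ennreal \<bar>H (x + t *\<^sub>R z) \<bullet> z - c x\<bar>) \<partial>lborel) \<partial>lborel)"
    by (rule lborel_pair.Fubini'[symmetric]) measurable
  also have "\<dots> = (\<integral>\<^sup>+t. indicator {0..1::real} t * (\<integral>\<^sup>+x. indicator A x * ennreal \<bar>H (x + t *\<^sub>R z) \<bullet> z - c x\<bar> \<partial>lborel) \<partial>lborel)"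
    by (simp add: nn_integral_cmult[symmetric] mult.left_commute)
  finally show ?thesis .
qed

text \<open>The error of the difference quotient is the average over t in [0,1] of H(x + t h v)
  \<bullet> v - H(x) \<bullet> v, which is small in L1 because translations act continuously. The
  estimate is done after multiplication by h, and h is cancelled at the end.\<close>

lemma weak_grad_difference_quotient:
  assumes W: "weak_grad w H" and h: "h \<longlonglongrightarrow> 0" "\<And>n. h n > 0"
  shows "(\<lambda>n. \<integral>x. \<bar>(w (x + h n *\<^sub>R v) - w x) / h n - H x \<bullet> v\<bar> \<partial>lborel) \<longlonglongrightarrow> 0"
proof (rule LIMSEQ_I)
  fix e :: real assume e: "e > 0"
  note [measurable] = weak_gradD(3,4)[OF W]
  have e2: "e/2 > 0" using e by simp
  have g: "integrable lborel (\<lambda>x. H x \<bullet> v)" using weak_gradD(2)[OF W] by auto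
  obtain d where d: "d > 0" "\<And>z. norm z < d \<Longrightarrow> (\<integral>\<^sup>+x. \<bar>H (x + z) \<bullet> v - H x \<bullet> v\<bar> \<partial>lborel) \<le> ennreal (e/2)"
    using continuous_translate_L1[OF g e2] by blast
  have "(\<lambda>n. h n * norm v) \<longlonglongrightarrow> 0 * norm v" by (intro tendsto_intros h)
  then have "eventually (\<lambda>n. h n * norm v < d) sequentially" using d(1) by (auto intro: order_tendstoD)
  then obtain n0 where n0: "\<And>n. n \<ge> n0 \<Longrightarrow> h n * norm v < d" by (auto simp: eventually_sequentially)
  have "norm ((\<integral>x. \<bar>(w (x + h n *\<^sub>R v) - w x) / h n - H x \<bullet> v\<bar> \<partial>lborel) - 0) < e" if n: "n \<ge> n0" for n
  proof -
    have hp: "h n > 0" by (rule h)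
    have i: "integrable lborel (\<lambda>x. (w (x + h n *\<^sub>R v) - w x) / h n - H x \<bullet> v)"
      using integrable_translate[OF weak_gradD(1)[OF W]] weak_gradD(1)[OF W] g by auto
    have "ennreal (h n) * (\<integral>\<^sup>+x. ennreal \<bar>(w (x + h n *\<^sub>R v) - w x) / h n - H x \<bullet> v\<bar> \<partial>lborel)
       = (\<integral>\<^sup>+x. indicator UNIV x * ennreal \<bar>w (x + h n *\<^sub>R v) - w x - h n * (H x \<bullet> v)\<bar> \<partial>lborel)"
    proof -
      have "h n * \<bar>a / h n - b\<bar> = \<bar>a - h n * b\<bar>" for a b
      proof -
        have "h n * (a / h n - b) = a - h n * b" using hp by (simp add: right_diff_distrib)
        then show ?thesis using hp by (metis abs_mult abs_of_pos)
      qed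
      then have "ennreal (h n) * ennreal \<bar>a / h n - b\<bar> = ennreal \<bar>a - h n * b\<bar>" for a b
        using hp by (subst ennreal_mult[symmetric]) auto
      then show ?thesis
        by (subst nn_integral_cmult[symmetric]) simp_all
    qed
    also have "\<dots> \<le> (\<integral>\<^sup>+t. indicator {0..1::real} t * (\<integral>\<^sup>+x. indicator UNIV x * ennreal \<bar>H (x + t *\<^sub>R (h n *\<^sub>R v)) \<bullet> (h n *\<^sub>R v) - h n * (H x \<bullet> v)\<bar> \<partial>lborel) \<partial>lborel)"
      by (rule weak_grad_shift_L1[OF W]) auto
    also have "\<dots> \<le> (\<integral>\<^sup>+t. indicator {0..1::real} t * (ennreal (h n) * ennreal (e/2)) \<partial>lborel)"
    proof (rule nn_integral_mono, goal_cases)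
      case (1 t)
      show ?case
      proof (cases "t \<in> {0..1}")
        case True
        have "norm (t *\<^sub>R h n *\<^sub>R v) \<le> h n * norm v" using True hp by (simp add: mult_left_le_one_le)
        then have "norm (t *\<^sub>R h n *\<^sub>R v) < d" using n0[OF n] by linarith
        note * = d(2)[OF this]
        have "(\<integral>\<^sup>+x. ennreal \<bar>H (x + t *\<^sub>R (h n *\<^sub>R v)) \<bullet> (h n *\<^sub>R v) - h n * (H x \<bullet> v)\<bar> \<partial>lborel)
          = (\<integral>\<^sup>+x. ennreal (h n) * ennreal \<bar>H (x + t *\<^sub>R h n *\<^sub>R v) \<bullet> v - H x \<bullet> v\<bar> \<partial>lborel)"
          using hp by (intro nn_integral_cong) (simp add: ennreal_mult'[symmetric] right_diff_distrib[symmetric] abs_mult)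
        also have "\<dots> = ennreal (h n) * (\<integral>\<^sup>+x. ennreal \<bar>H (x + t *\<^sub>R h n *\<^sub>R v) \<bullet> v - H x \<bullet> v\<bar> \<partial>lborel)"
          by (rule nn_integral_cmult) simp
        also have "\<dots> \<le> ennreal (h n) * ennreal (e/2)" by (rule mult_left_mono[OF *]) simp
        finally show ?thesis using True by simp
      qed simp
    qed
    also have "\<dots> = ennreal (h n) * ennreal (e/2)" by (simp add: nn_integral_multc)
    finally have "(\<integral>\<^sup>+x. ennreal \<bar>(w (x + h n *\<^sub>R v) - w x) / h n - H x \<bullet> v\<bar> \<partial>lborel) \<le> ennreal (e/2)"
      using hp by (subst (asm) ennreal_mult_le_mult_iff) auto
    then have "(\<integral>x. \<bar>(w (x + h n *\<^sub>R v) - w x) / h n - H x \<bullet> v\<bar> \<partial>lborel) \<le> e/2"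
      using i e by (subst (asm) nn_integral_eq_integral) auto
    moreover have "(\<integral>x. \<bar>(w (x + h n *\<^sub>R v) - w x) / h n - H x \<bullet> v\<bar> \<partial>lborel) \<ge> 0" by simp
    ultimately show ?thesis using e by simp
  qed
  then show "\<exists>no. \<forall>n\<ge>no. norm ((\<integral>x. \<bar>(w (x + h n *\<^sub>R v) - w x) / h n - H x \<bullet> v\<bar> \<partial>lborel) - 0) < e" by blast
qed

subsection \<open>Chain and product rules\<close>

lemma integrable_mult_bounded:
  fixes f g :: "'a::euclidean_space \<Rightarrow> real"
  assumes f: "integrable lborel f" and [measurable]: "g \<in> borel_measurable borel" and B: "\<And>x. \<bar>g x\<bar> \<le> B"
  shows "integrable lborel (\<lambda>x. f x * g x)"
proof (rule Bochner_Integration.integrable_bound[of _ "\<lambda>x. B * f x"])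
  have [measurable]: "f \<in> borel_measurable borel" using f by auto
  show "(\<lambda>x. f x * g x) \<in> borel_measurable lborel" by simp
  have B0: "B \<ge> 0" using B[of undefined] by linarith
  show "AE x in lborel. norm (f x * g x) \<le> norm (B * f x)"
  proof (rule AE_I2)
    show "norm (f x * g x) \<le> norm (B * f x)" for x
      using mult_left_mono[OF B[of x] abs_ge_zero[of "f x"]] B0 by (simp add: abs_mult mult.commute)
  qed
qed (use f in auto)

text \<open>The difference quotients of T(w) converge in L1 to T'(w) H \<bullet> v, and shifting
  them onto the test function gives the weak identity in the limit. The derivative of T need not be
  continuous; being bounded and measurable suffices. The condition T 0 = 0 keeps T(w) integrable on
  a space of infinite measure.\<close>

lemma weak_grad_compose:
  assumes W: "weak_grad w H" and T: "\<And>t. (T has_real_derivative T' t) (at t)"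
    and L: "\<And>t. \<bar>T' t\<bar> \<le> L" and T0: "T 0 = 0" and [measurable]: "T' \<in> borel_measurable borel"
  shows "weak_grad (\<lambda>x. T (w x)) (\<lambda>x. T' (w x) *\<^sub>R H x)"
proof -
  note [measurable] = weak_gradD(3,4)[OF W]
  have L0: "L \<ge> 0" using L[of 0] by linarith
  have lip: "\<bar>T s - T t\<bar> \<le> L * \<bar>s - t\<bar>" for s t
    using field_differentiable_bound[of UNIV T T' L s t] T L by auto
  have "continuous_on UNIV T" using T by (auto intro!: continuous_at_imp_continuous_on DERIV_isCont)
  then have [measurable]: "T \<in> borel_measurable borel" by (rule borel_measurable_continuous_onI)
  have iT: "integrable lborel (\<lambda>x. T (w x))"
    by (rule Bochner_Integration.integrable_bound[of _ "\<lambda>x. L * w x"])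
       (use weak_gradD(1)[OF W] lip[of _ 0] T0 L0 in \<open>auto simp: abs_mult\<close>)
  have iH: "integrable lborel (\<lambda>x. T' (w x) *\<^sub>R H x)"
    by (rule Bochner_Integration.integrable_bound[of _ "\<lambda>x. L *\<^sub>R H x"])
       (use weak_gradD(2)[OF W] L L0 in \<open>auto intro!: mult_right_mono\<close>)
  have "(\<integral>x. T (w x) * (grad \<psi> x \<bullet> v) \<partial>lborel) = - (\<integral>x. (T' (w x) *\<^sub>R H x \<bullet> v) * \<psi> x \<partial>lborel)"
    if P: "\<psi> \<in> test_functions UNIV" for \<psi> v
  proof -
    have [measurable]: "\<psi> \<in> borel_measurable borel" "grad \<psi> \<in> borel_measurable borel"
      using P test_functions_borel grad_test_borel by blast+
    obtain B where B: "B > 0" "\<And>x. \<bar>\<psi> x\<bar> \<le> B" using test_bounded[OF P] by blast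
    obtain B' where B': "B' > 0" "\<And>x y. \<bar>\<psi> x - \<psi> y\<bar> \<le> B' * norm (x - y)" using test_lipschitz[OF P] by blast
    define h where "h n = inverse (real (Suc n))" for n
    have h: "h \<longlonglongrightarrow> 0" "\<And>n. h n > 0"
      unfolding h_def by (rule LIMSEQ_inverse_real_of_nat) simp
    define D where "D n x = (w (x + h n *\<^sub>R v) - w x) / h n" for n x
    define g where "g x = H x \<bullet> v" for x
    have g: "integrable lborel g" unfolding g_def using weak_gradD(2)[OF W] by auto
    have iD: "integrable lborel (D n)" for n
      unfolding D_def[abs_def] using integrable_translate[OF weak_gradD(1)[OF W]] weak_gradD(1)[OF W] by auto
    have [measurable]: "D n \<in> borel_measurable borel" for n unfolding D_def[abs_def] by measurable
    have [measurable]: "g \<in> borel_measurable borel" unfolding g_def by measurable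
    have D1: "(\<lambda>n. \<integral>x. \<bar>D n x - g x\<bar> \<partial>lborel) \<longlonglongrightarrow> 0"
      unfolding D_def g_def by (rule weak_grad_difference_quotient[OF W h])
    \<comment> \<open>Convergence in L1 gives convergence almost everywhere only along a
      subsequence. This is enough, since both limits compared at the end are taken along the same
      subsequence.\<close>
    then obtain r where r: "strict_mono r" "AE x in lborel. (\<lambda>n. D (r n) x - g x) \<longlonglongrightarrow> 0"
      using tendsto_L1_AE_subseq[of lborel "\<lambda>n x. D n x - g x"] iD g by auto
    have hr: "(\<lambda>n. h (r n)) \<longlonglongrightarrow> 0" using LIMSEQ_subseq_LIMSEQ[OF h(1) r(1)] by (simp add: o_def)
    define Q where "Q n x = (T (w (x + h n *\<^sub>R v)) - T (w x)) / h n" for n x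
    define q where "q x = T' (w x) * g x" for x
    have iQ: "integrable lborel (Q n)" for n
      unfolding Q_def[abs_def] using integrable_translate[OF iT] iT by auto
    have iq: "integrable lborel q"
      using integrable_inner_left[OF iH, of v] by (simp add: q_def[abs_def] g_def)
    have QD: "\<bar>Q n x\<bar> \<le> L * \<bar>D n x\<bar>" for n x
      using lip[of "w (x + h n *\<^sub>R v)" "w x"] h(2)[of n] by (auto simp: Q_def D_def field_simps abs_divide)
    have Qg: "\<bar>q x\<bar> \<le> L * \<bar>g x\<bar>" for x unfolding q_def abs_mult by (intro mult_right_mono L) simp
    have Qlim: "AE x in lborel. (\<lambda>n. Q (r n) x) \<longlonglongrightarrow> q x"
      using r(2)
    proof eventually_elim
      case (elim x)
      then have Dl: "(\<lambda>n. D (r n) x) \<longlonglongrightarrow> g x" by (simp add: LIM_zero_cancel)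
      \<comment> \<open>The Caratheodory form of the derivative avoids dividing by w(x + h v) -
        w(x), which may be zero.\<close>
      obtain k where k: "\<And>z. T z - T (w x) = k z * (z - w x)" "isCont k (w x)" "k (w x) = T' (w x)"
        using T[of "w x"] unfolding CARAT_DERIV by blast
      have wD: "w (x + h n *\<^sub>R v) = w x + h n * D n x" for n using h(2)[of n] by (simp add: D_def)
      have "(\<lambda>n. w x + h (r n) * D (r n) x) \<longlonglongrightarrow> w x + 0 * g x" by (intro tendsto_intros hr Dl)
      then have "(\<lambda>n. k (w x + h (r n) * D (r n) x)) \<longlonglongrightarrow> k (w x)"
        using isCont_tendsto_compose[OF k(2)] by simp
      then have "(\<lambda>n. k (w x + h (r n) * D (r n) x) * D (r n) x) \<longlonglongrightarrow> k (w x) * g x"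
        by (intro tendsto_mult Dl)
      moreover have "Q n x = k (w x + h n * D n x) * D n x" for n
        using h(2)[of n] unfolding Q_def wD k(1) by simp
      ultimately show ?case by (simp add: q_def k(3))
    qed
    (* The quotients Q are dominated only by an L1-convergent sequence; S has a fixed majorant. *)
    define S where "S n x = max 0 (\<bar>Q (r n) x - q x\<bar> - L * \<bar>D (r n) x - g x\<bar>)" for n x
    have [measurable]: "Q n \<in> borel_measurable borel" "q \<in> borel_measurable borel" for n
      unfolding Q_def[abs_def] q_def[abs_def] by measurable
    have [measurable]: "S n \<in> borel_measurable borel" for n unfolding S_def[abs_def] by measurable
    have Sb: "\<bar>S n x\<bar> \<le> 2 * L * \<bar>g x\<bar>" for n x
    proof -
      have "\<bar>D (r n) x\<bar> \<le> \<bar>D (r n) x - g x\<bar> + \<bar>g x\<bar>" by linarith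
      from mult_left_mono[OF this L0] have "L * \<bar>D (r n) x\<bar> \<le> L * \<bar>D (r n) x - g x\<bar> + L * \<bar>g x\<bar>"
        by (simp add: distrib_left)
      moreover have "0 \<le> L * \<bar>g x\<bar>" using L0 by simp
      ultimately show ?thesis using QD[of "r n" x] Qg[of x] unfolding S_def by linarith
    qed
    have "(\<lambda>n. \<integral>x. S n x \<partial>lborel) \<longlonglongrightarrow> (\<integral>x. 0 \<partial>(lborel :: 'a measure))"
    proof (rule integral_dominated_convergence[where w="\<lambda>x. 2 * L * \<bar>g x\<bar>"])
      show "AE x in lborel. (\<lambda>n. S n x) \<longlonglongrightarrow> 0"
        using r(2) Qlim
      proof eventually_elim
        case (elim x)
        have "(\<lambda>n. S n x) \<longlonglongrightarrow> max 0 (\<bar>q x - q x\<bar> - L * \<bar>0\<bar>)"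
          unfolding S_def by (intro tendsto_intros elim)
        then show ?case by simp
      qed
    qed (use g Sb in auto)
    then have S0: "(\<lambda>n. \<integral>x. S n x \<partial>lborel) \<longlonglongrightarrow> 0" by simp
    have iS: "integrable lborel (S n)" for n
      by (rule Bochner_Integration.integrable_bound[of _ "\<lambda>x. 2 * L * g x"]) (use g Sb L0 in \<open>auto simp: abs_mult\<close>)
    have "(\<lambda>n. \<integral>x. \<bar>Q (r n) x - q x\<bar> \<partial>lborel) \<longlonglongrightarrow> 0"
    proof (rule tendsto_sandwich[OF _ _ tendsto_const])
      show "(\<lambda>n. (\<integral>x. S n x \<partial>lborel) + L * (\<integral>x. \<bar>D (r n) x - g x\<bar> \<partial>lborel)) \<longlonglongrightarrow> 0"
        using tendsto_add[OF S0 tendsto_mult[OF tendsto_const[of L] LIMSEQ_subseq_LIMSEQ[OF D1 r(1)]]]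
        by (simp add: o_def)
      show "eventually (\<lambda>n. (\<integral>x. \<bar>Q (r n) x - q x\<bar> \<partial>lborel) \<le> (\<integral>x. S n x \<partial>lborel) + L * (\<integral>x. \<bar>D (r n) x - g x\<bar> \<partial>lborel)) sequentially"
      proof (rule always_eventually, rule allI)
        fix n
        have "(\<integral>x. \<bar>Q (r n) x - q x\<bar> \<partial>lborel) \<le> (\<integral>x. S n x + L * \<bar>D (r n) x - g x\<bar> \<partial>lborel)"
          using iQ iq iS iD g by (intro integral_mono) (auto simp: S_def)
        then show "(\<integral>x. \<bar>Q (r n) x - q x\<bar> \<partial>lborel) \<le> (\<integral>x. S n x \<partial>lborel) + L * (\<integral>x. \<bar>D (r n) x - g x\<bar> \<partial>lborel)"
          using iS iD g by simp
      qed
    qed simp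
    then have "(\<lambda>n. B * (\<integral>x. \<bar>Q (r n) x - q x\<bar> \<partial>lborel)) \<longlonglongrightarrow> B * 0" by (intro tendsto_intros)
    then have B0: "(\<lambda>n. B * (\<integral>x. \<bar>Q (r n) x - q x\<bar> \<partial>lborel)) \<longlonglongrightarrow> 0" by simp
    have iQP: "integrable lborel (\<lambda>x. Q n x * \<psi> x)" for n by (rule integrable_mult_bounded[OF iQ _ B(2)]) simp
    have iqP: "integrable lborel (\<lambda>x. q x * \<psi> x)" by (rule integrable_mult_bounded[OF iq _ B(2)]) simp
    have "(\<lambda>n. (\<integral>x. Q (r n) x * \<psi> x \<partial>lborel) - (\<integral>x. q x * \<psi> x \<partial>lborel)) \<longlonglongrightarrow> 0"
    proof (rule Lim_null_comparison[OF always_eventually B0], rule allI)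
      fix n
      have "norm ((\<integral>x. Q (r n) x * \<psi> x \<partial>lborel) - (\<integral>x. q x * \<psi> x \<partial>lborel)) = norm (\<integral>x. (Q (r n) x - q x) * \<psi> x \<partial>lborel)"
        using iQP iqP by (simp add: left_diff_distrib)
      also have "\<dots> \<le> (\<integral>x. norm ((Q (r n) x - q x) * \<psi> x) \<partial>lborel)" by (rule integral_norm_bound)
      also have "\<dots> \<le> (\<integral>x. B * \<bar>Q (r n) x - q x\<bar> \<partial>lborel)"
      proof (rule integral_mono)
        show "integrable lborel (\<lambda>x. norm ((Q (r n) x - q x) * \<psi> x))"
          using iQP iqP by (simp add: left_diff_distrib)
        show "norm ((Q (r n) x - q x) * \<psi> x) \<le> B * \<bar>Q (r n) x - q x\<bar>" for x
          using B(2)[of x] by (simp add: abs_mult mult.commute mult_right_mono)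
      qed (use iQ iq in auto)
      finally show "norm ((\<integral>x. Q (r n) x * \<psi> x \<partial>lborel) - (\<integral>x. q x * \<psi> x \<partial>lborel)) \<le> B * (\<integral>x. \<bar>Q (r n) x - q x\<bar> \<partial>lborel)"
        by simp
    qed
    then have lim1: "(\<lambda>n. \<integral>x. Q (r n) x * \<psi> x \<partial>lborel) \<longlonglongrightarrow> (\<integral>x. q x * \<psi> x \<partial>lborel)"
      by (rule LIM_zero_cancel)
    \<comment> \<open>Integration by parts for difference quotients: a change of variables moves the
      shift to the test function, with the opposite sign.\<close>
    have eq: "(\<integral>x. Q n x * \<psi> x \<partial>lborel) = (\<integral>x. T (w x) * ((\<psi> (x - h n *\<^sub>R v) - \<psi> x) / h n) \<partial>lborel)" for n
    proof -
      have i1: "integrable lborel (\<lambda>x. T (w x) * \<psi> x)" by (rule integrable_mult_bounded[OF iT _ B(2)]) simp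
      have i2: "integrable lborel (\<lambda>x. T (w (x + h n *\<^sub>R v)) * \<psi> x)"
        by (rule integrable_mult_bounded[OF integrable_translate[OF iT] _ B(2)]) simp
      have i3: "integrable lborel (\<lambda>x. T (w x) * \<psi> (x - h n *\<^sub>R v))"
        using integrable_translate[OF i2, of "- (h n *\<^sub>R v)"] by simp
      have "(\<integral>x. T (w (x + h n *\<^sub>R v)) * \<psi> x \<partial>lborel) = (\<integral>x. T (w x) * \<psi> (x - h n *\<^sub>R v) \<partial>lborel)"
        using integral_translate[of "\<lambda>x. T (w x) * \<psi> (x - h n *\<^sub>R v)" "h n *\<^sub>R v"] by simp
      then show ?thesis
        using i1 i2 i3 by (simp add: Q_def left_diff_distrib right_diff_distrib diff_divide_distrib)
    qed
    have "(\<lambda>n. \<integral>x. T (w x) * ((\<psi> (x - h n *\<^sub>R v) - \<psi> x) / h n) \<partial>lborel) \<longlonglongrightarrow> (\<integral>x. T (w x) * (- (grad \<psi> x \<bullet> v)) \<partial>lborel)"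
    proof (rule integral_dominated_convergence[where w="\<lambda>x. \<bar>T (w x)\<bar> * (B' * norm v)"])
      have "(\<lambda>n. (\<psi> (x - h n *\<^sub>R v) - \<psi> x) / h n) \<longlonglongrightarrow> - (grad \<psi> x \<bullet> v)" for x
      proof -
        have d: "((\<lambda>s. x - s *\<^sub>R v) has_derivative (\<lambda>s. - (s *\<^sub>R v))) (at 0)"
          by (auto intro!: derivative_eq_intros)
        have "((\<lambda>s. \<psi> (x - s *\<^sub>R v)) has_derivative (\<lambda>s. s * - (grad \<psi> x \<bullet> v))) (at 0)"
          using has_derivative_compose[OF d test_functions_has_derivative[OF P]] by simp
        then have "((\<lambda>s. \<psi> (x - s *\<^sub>R v)) has_real_derivative - (grad \<psi> x \<bullet> v)) (at 0)"
          unfolding has_field_derivative_def by (rule has_derivative_eq_rhs) (simp add: fun_eq_iff)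
        then have "((\<lambda>s. (\<psi> (x - s *\<^sub>R v) - \<psi> x) / s) \<longlongrightarrow> - (grad \<psi> x \<bullet> v)) (at 0)"
          by (simp add: DERIV_def)
        then show ?thesis
          by (rule filterlim_compose) (use h in \<open>auto simp: filterlim_at intro!: always_eventually less_imp_neq[THEN not_sym]\<close>)
      qed
      then show "AE x in lborel. (\<lambda>n. T (w x) * ((\<psi> (x - h n *\<^sub>R v) - \<psi> x) / h n)) \<longlonglongrightarrow> T (w x) * (- (grad \<psi> x \<bullet> v))"
        by (intro AE_I2 tendsto_mult tendsto_const)
      have "\<bar>(\<psi> (x - h n *\<^sub>R v) - \<psi> x) / h n\<bar> \<le> B' * norm v" for n x
        using B'(2)[of "x - h n *\<^sub>R v" x] h(2)[of n] by (simp add: abs_divide field_simps)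
      then show "AE x in lborel. norm (T (w x) * ((\<psi> (x - h n *\<^sub>R v) - \<psi> x) / h n)) \<le> \<bar>T (w x)\<bar> * (B' * norm v)" for n
        unfolding real_norm_def abs_mult by (intro AE_I2 mult_left_mono) auto
    qed (use iT in auto)
    from LIMSEQ_subseq_LIMSEQ[OF this r(1)]
    have lim2: "(\<lambda>n. \<integral>x. Q (r n) x * \<psi> x \<partial>lborel) \<longlonglongrightarrow> - (\<integral>x. T (w x) * (grad \<psi> x \<bullet> v) \<partial>lborel)"
      by (simp add: o_def eq)
    have "(\<integral>x. q x * \<psi> x \<partial>lborel) = - (\<integral>x. T (w x) * (grad \<psi> x \<bullet> v) \<partial>lborel)"
      by (rule LIMSEQ_unique[OF lim1 lim2])
    then show ?thesis by (simp add: q_def g_def)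
  qed
  with iT iH show ?thesis by (simp add: weak_grad_def)
qed

lemma weak_grad_diff:
  assumes "weak_grad w H" "weak_grad w' H'"
  shows "weak_grad (\<lambda>x. w x - w' x) (\<lambda>x. H x - H' x)"
proof -
  note [measurable] = weak_gradD(3,4)[OF assms(1)] weak_gradD(3,4)[OF assms(2)]
  have "(\<integral>x. (w x - w' x) * (grad \<psi> x \<bullet> v) \<partial>lborel) = - (\<integral>x. ((H x - H' x) \<bullet> v) * \<psi> x \<partial>lborel)"
    if P: "\<psi> \<in> test_functions UNIV" for \<psi> v
  proof -
    have [measurable]: "\<psi> \<in> borel_measurable borel" "grad \<psi> \<in> borel_measurable borel"
      using P test_functions_borel grad_test_borel by blast+
    obtain B where B: "\<And>x. \<bar>\<psi> x\<bar> \<le> B" using test_bounded[OF P] by blast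
    obtain B' where B': "\<And>x. norm (grad \<psi> x) \<le> B'" using grad_test_bounded[OF P] by blast
    have B'': "\<bar>grad \<psi> x \<bullet> v\<bar> \<le> B' * norm v" for x
      using order_trans[OF Cauchy_Schwarz_ineq2 mult_right_mono[OF B' norm_ge_zero]] .
    have i: "integrable lborel (\<lambda>x. f x * (grad \<psi> x \<bullet> v))" "integrable lborel (\<lambda>x. f x * \<psi> x)"
      if "integrable lborel f" for f :: "'a \<Rightarrow> real"
      by (rule integrable_mult_bounded[OF that _ B''], simp, rule integrable_mult_bounded[OF that _ B], simp)
    show ?thesis
      using weak_gradD(5)[OF assms(1) P, of v] weak_gradD(5)[OF assms(2) P, of v]
        i[OF weak_gradD(1)[OF assms(1)]] i[OF weak_gradD(1)[OF assms(2)]]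
        i[OF integrable_inner_left[of v, OF weak_gradD(2)[OF assms(1)]]]
        i[OF integrable_inner_left[of v, OF weak_gradD(2)[OF assms(2)]]]
      by (simp add: left_diff_distrib inner_diff_left)
  qed
  then show ?thesis using assms by (simp add: weak_grad_def)
qed

text \<open>The kink at k is rounded off so that the chain rule applies, and dominated convergence
  removes the rounding. The condition k \<ge> 0 makes the positive part vanish at 0 and hence
  integrable.\<close>

lemma weak_grad_pos_part:
  assumes W: "weak_grad w H" and k: "k \<ge> 0"
  shows "weak_grad (\<lambda>x. max (w x - k) 0) (\<lambda>x. indicator {x. w x > k} x *\<^sub>R H x)"
proof -
  note [measurable] = weak_gradD(3,4)[OF W]
  define e where "e n = inverse (real (Suc n))" for n
  have e: "e \<longlonglongrightarrow> 0" "\<And>n. e n > 0"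
    unfolding e_def by (rule LIMSEQ_inverse_real_of_nat) simp
  \<comment> \<open>Squaring the positive part makes it differentiable at k, and adding e^2 makes
    the root so. All derivatives vanish at t = k, so their limit is the indicator of the strict
    inequality and the gradient is 0 on the level set {w = k}.\<close>
  define T where "T n t = sqrt ((max (t - k) 0)^2 + (e n)^2) - e n" for n t
  define T' where "T' n t = max (t - k) 0 / sqrt ((max (t - k) 0)^2 + (e n)^2)" for n t
  have pos: "(max (t - k) 0)^2 + (e n)^2 > 0" for n t using e(2)[of n] by (simp add: add_nonneg_pos)
  have sq: "((\<lambda>t. (max (t - k) 0)^2) has_real_derivative 2 * max (t - k) 0) (at t)" for t
  proof -
    consider "t > k" | "t < k" | "t = k" by linarith
    then show ?thesis
    proof cases
      case 1
      have "((\<lambda>t. (t - k)^2) has_real_derivative 2 * max (t - k) 0) (at t)"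
        using 1 by (auto intro!: derivative_eq_intros)
      then show ?thesis by (rule has_field_derivative_transform_within_open[where S="{k<..}"]) (use 1 in auto)
    next
      case 2
      have "((\<lambda>t. 0) has_real_derivative 2 * max (t - k) 0) (at t)" using 2 by simp
      then show ?thesis by (rule has_field_derivative_transform_within_open[where S="{..<k}"]) (use 2 in auto)
    next
      case 3
      have "((\<lambda>h. ((max h 0)^2) / h) \<longlongrightarrow> 0) (at (0::real))"
      proof (rule Lim_null_comparison[of _ "\<lambda>h. \<bar>h\<bar>"])
        show "((\<lambda>h. \<bar>h\<bar>) \<longlongrightarrow> 0) (at (0::real))" by (intro tendsto_rabs_zero tendsto_ident_at)
        show "eventually (\<lambda>h. norm ((max h 0)^2 / h) \<le> \<bar>h\<bar>) (at (0::real))"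
          by (intro always_eventually) (auto simp: max_def power2_eq_square)
      qed
      then show ?thesis using 3 by (simp add: DERIV_def)
    qed
  qed
  have dT: "(T n has_real_derivative T' n t) (at t)" for n t
  proof -
    have "((\<lambda>t. (max (t - k) 0)^2 + (e n)^2) has_real_derivative 2 * max (t - k) 0 + 0) (at t)"
      by (intro DERIV_add sq DERIV_const)
    from DERIV_diff[OF DERIV_chain2[OF DERIV_real_sqrt[OF pos] this] DERIV_const[of "e n"]]
    show ?thesis unfolding T_def[abs_def] T'_def
      by (rule DERIV_cong) (simp add: field_simps)
  qed
  have T'1: "\<bar>T' n t\<bar> \<le> 1" for n t
  proof -
    have "max (t - k) 0 \<le> sqrt ((max (t - k) 0)^2 + (e n)^2)" by (rule real_le_rsqrt) simp
    then show ?thesis using pos[of t n] unfolding T'_def by (simp add: abs_divide)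
  qed
  have T'm [measurable]: "T' n \<in> borel_measurable borel" for n unfolding T'_def[abs_def] by measurable
  have T0: "T n 0 = 0" for n using k e(2)[of n] by (simp add: T_def)
  note Wn = weak_grad_compose[OF W dT T'1 T0 T'm]
  have [measurable]: "T n \<in> borel_measurable borel" for n unfolding T_def[abs_def] by measurable
  have Tb: "\<bar>T n t\<bar> \<le> \<bar>t\<bar>" for n t
    using field_differentiable_bound[of UNIV "T n" "T' n" 1 t 0] dT T'1 T0 by auto
  have Tl: "(\<lambda>n. T n t) \<longlonglongrightarrow> max (t - k) 0" for t
  proof -
    have "(\<lambda>n. T n t) \<longlonglongrightarrow> sqrt ((max (t - k) 0)^2 + 0^2) - 0"
      unfolding T_def by (intro tendsto_intros e)
    then show ?thesis by simp
  qed
  have T'l: "(\<lambda>n. T' n t) \<longlonglongrightarrow> indicator {k<..} t" for t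
  proof (cases "t > k")
    case True
    then have "(\<lambda>n. T' n t) \<longlonglongrightarrow> max (t - k) 0 / sqrt ((max (t - k) 0)^2 + 0^2)"
      unfolding T'_def by (intro tendsto_intros e) auto
    then show ?thesis using True by simp
  qed (simp add: T'_def)
  have i0: "integrable lborel (\<lambda>x. max (w x - k) 0)"
    by (rule Bochner_Integration.integrable_bound[OF weak_gradD(1)[OF W]]) (use k in auto)
  have i1: "integrable lborel (\<lambda>x. indicator {x. w x > k} x *\<^sub>R H x)"
    by (rule Bochner_Integration.integrable_bound[OF weak_gradD(2)[OF W]]) (auto simp: indicator_def)
  have "(\<integral>x. max (w x - k) 0 * (grad \<psi> x \<bullet> v) \<partial>lborel) = - (\<integral>x. (indicator {x. w x > k} x *\<^sub>R H x \<bullet> v) * \<psi> x \<partial>lborel)"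
    if P: "\<psi> \<in> test_functions UNIV" for \<psi> v
  proof -
    have [measurable]: "\<psi> \<in> borel_measurable borel" "grad \<psi> \<in> borel_measurable borel"
      using P test_functions_borel grad_test_borel by blast+
    obtain B where B: "\<And>x. \<bar>\<psi> x\<bar> \<le> B" using test_bounded[OF P] by blast
    obtain B' where B': "\<And>x. norm (grad \<psi> x) \<le> B'" using grad_test_bounded[OF P] by blast
    have B'': "\<bar>grad \<psi> x \<bullet> v\<bar> \<le> B' * norm v" for x
      using order_trans[OF Cauchy_Schwarz_ineq2 mult_right_mono[OF B' norm_ge_zero]] .
    have "(\<lambda>n. \<integral>x. T n (w x) * (grad \<psi> x \<bullet> v) \<partial>lborel) \<longlonglongrightarrow> (\<integral>x. max (w x - k) 0 * (grad \<psi> x \<bullet> v) \<partial>lborel)"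
    proof (rule integral_dominated_convergence[where w="\<lambda>x. \<bar>w x\<bar> * (B' * norm v)"])
      show "AE x in lborel. norm (T n (w x) * (grad \<psi> x \<bullet> v)) \<le> \<bar>w x\<bar> * (B' * norm v)" for n
        unfolding real_norm_def abs_mult by (intro AE_I2 mult_mono Tb B'') auto
    qed (use weak_gradD(1)[OF W] Tl in \<open>auto intro!: tendsto_mult\<close>)
    moreover have "(\<lambda>n. \<integral>x. (T' n (w x) *\<^sub>R H x \<bullet> v) * \<psi> x \<partial>lborel) \<longlonglongrightarrow> (\<integral>x. (indicator {x. w x > k} x *\<^sub>R H x \<bullet> v) * \<psi> x \<partial>lborel)"
    proof (rule integral_dominated_convergence[where w="\<lambda>x. \<bar>H x \<bullet> v\<bar> * B"])
      show "AE x in lborel. norm ((T' n (w x) *\<^sub>R H x \<bullet> v) * \<psi> x) \<le> \<bar>H x \<bullet> v\<bar> * B" for n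
        unfolding real_norm_def abs_mult inner_scaleR_left
        by (intro AE_I2 mult_mono B mult_left_le_one_le T'1) auto
      have "(\<lambda>n. (T' n (w x) *\<^sub>R H x \<bullet> v) * \<psi> x) \<longlonglongrightarrow> (indicator {k<..} (w x) *\<^sub>R H x \<bullet> v) * \<psi> x" for x
        by (intro tendsto_intros T'l)
      then show "AE x in lborel. (\<lambda>n. (T' n (w x) *\<^sub>R H x \<bullet> v) * \<psi> x) \<longlonglongrightarrow> (indicator {x. w x > k} x *\<^sub>R H x \<bullet> v) * \<psi> x"
        by (simp add: indicator_def)
    qed (use weak_gradD(2)[OF W] in auto)
    then have "(\<lambda>n. - (\<integral>x. (T' n (w x) *\<^sub>R H x \<bullet> v) * \<psi> x \<partial>lborel)) \<longlonglongrightarrow> - (\<integral>x. (indicator {x. w x > k} x *\<^sub>R H x \<bullet> v) * \<psi> x \<partial>lborel)"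
      by (rule tendsto_minus)
    ultimately show ?thesis
      using weak_gradD(5)[OF Wn P, of _ v] by (simp add: LIMSEQ_unique)
  qed
  with i0 i1 show ?thesis by (simp add: weak_grad_def)
qed

section \<open>Weak gradients on an open set and their extension by cutoffs\<close>

lemma compact_borel: "compact (K :: 'a::euclidean_space set) \<Longrightarrow> K \<in> sets borel"
  by (simp add: compact_imp_closed borel_closed)

text \<open>The counterpart of \<open>has_distr_gradient\<close> for Borel representatives. The
  integrals run over the whole space because test functions and their gradients vanish off \<Omega>,
  so the values of u and G there do not matter.\<close>

definition local_grad :: "'a::euclidean_space set \<Rightarrow> ('a \<Rightarrow> real) \<Rightarrow> ('a \<Rightarrow> 'a) \<Rightarrow> bool" where
  "local_grad \<Omega> u G \<longleftrightarrow> u \<in> borel_measurable borel \<and> G \<in> borel_measurable borel \<and>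
     (\<forall>K. compact K \<and> K \<subseteq> \<Omega> \<longrightarrow> integrable lborel (\<lambda>x. indicator K x * u x) \<and> integrable lborel (\<lambda>x. indicator K x *\<^sub>R G x)) \<and>
     (\<forall>\<psi>\<in>test_functions \<Omega>. \<forall>v. (\<integral>x. u x * (grad \<psi> x \<bullet> v) \<partial>lborel) = - (\<integral>x. (G x \<bullet> v) * \<psi> x \<partial>lborel))"

lemma integrable_mult_supported:
  fixes f g :: "'a::euclidean_space \<Rightarrow> real"
  assumes "integrable lborel (\<lambda>x. indicator K x * f x)" "g \<in> borel_measurable borel" "\<And>x. \<bar>g x\<bar> \<le> B" "\<And>x. x \<notin> K \<Longrightarrow> g x = 0"
  shows "integrable lborel (\<lambda>x. f x * g x)"
proof -
  have "(indicator K x * f x) * g x = f x * g x" for x using assms(4)[of x] by (cases "x \<in> K") auto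
  with integrable_mult_bounded[OF assms(1-3)] show ?thesis by simp
qed

lemma local_grad_integrable:
  assumes G: "local_grad \<Omega> u G" and P: "\<psi> \<in> test_functions \<Omega>"
  shows "integrable lborel (\<lambda>x. u x * \<psi> x)" "integrable lborel (\<lambda>x. u x * (grad \<psi> x \<bullet> v))" "integrable lborel (\<lambda>x. (G x \<bullet> v) * \<psi> x)"
proof -
  let ?K = "closure {x. \<psi> x \<noteq> 0}"
  note S = test_functions_support[OF P]
  note [measurable] = test_functions_borel[OF P] grad_test_borel[OF P]
  obtain B where B: "\<And>x. \<bar>\<psi> x\<bar> \<le> B" using test_bounded[OF P] by blast
  obtain B' where B': "\<And>x. norm (grad \<psi> x) \<le> B'" using grad_test_bounded[OF P] by blast
  have B'': "\<bar>grad \<psi> x \<bullet> v\<bar> \<le> B' * norm v" for x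
    using order_trans[OF Cauchy_Schwarz_ineq2 mult_right_mono[OF B' norm_ge_zero]] .
  have i: "integrable lborel (\<lambda>x. indicator ?K x * u x)" "integrable lborel (\<lambda>x. indicator ?K x *\<^sub>R G x)"
    using G S by (auto simp: local_grad_def)
  show "integrable lborel (\<lambda>x. u x * \<psi> x)"
    by (rule integrable_mult_supported[OF i(1) _ B grad_test_0(1)[OF S(1)]]) simp
  show "integrable lborel (\<lambda>x. u x * (grad \<psi> x \<bullet> v))"
  proof (rule integrable_mult_supported[OF i(1) _ B''])
    show "grad \<psi> x \<bullet> v = 0" if "x \<notin> ?K" for x by (simp only: grad_test_0(2)[OF S(1) that] inner_zero_left)
  qed simp
  have "integrable lborel (\<lambda>x. indicator ?K x * (G x \<bullet> v))"
    using integrable_inner_left[OF i(2), of v] by simp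
  then show "integrable lborel (\<lambda>x. (G x \<bullet> v) * \<psi> x)"
    by (rule integrable_mult_supported[OF _ _ B grad_test_0(1)[OF S(1)]]) simp
qed

text \<open>If \<psi> is any test function on the whole space, then \<psi> \<zeta> is one on
  \<Omega>; expanding its gradient gives the product rule. In this way every local question is
  reduced to functions with a weak gradient on the whole space.\<close>

lemma local_grad_weak_grad:
  assumes G: "local_grad \<Omega> u G" and C: "\<zeta> \<in> test_functions \<Omega>"
  shows "weak_grad (\<lambda>x. \<zeta> x * u x) (\<lambda>x. \<zeta> x *\<^sub>R G x + u x *\<^sub>R grad \<zeta> x)"
proof -
  note [measurable] = test_functions_borel[OF C] grad_test_borel[OF C]
  have [measurable]: "u \<in> borel_measurable borel" "G \<in> borel_measurable borel" using G by (auto simp: local_grad_def)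
  note iC = local_grad_integrable[OF G C]
  have i1: "integrable lborel (\<lambda>x. \<zeta> x * u x)" using iC(1) by (simp add: mult.commute)
  \<comment> \<open>Integrability is known for the components of the product field only, so the
    vector field is reassembled from them.\<close>
  have "integrable lborel (\<lambda>x. \<Sum>i\<in>Basis. ((G x \<bullet> i) * \<zeta> x + u x * (grad \<zeta> x \<bullet> i)) *\<^sub>R i)"
    by (intro Bochner_Integration.integrable_sum integrable_scaleR_left Bochner_Integration.integrable_add iC)
  moreover have "(\<Sum>i\<in>Basis. ((G x \<bullet> i) * \<zeta> x + u x * (grad \<zeta> x \<bullet> i)) *\<^sub>R i) = \<zeta> x *\<^sub>R G x + u x *\<^sub>R grad \<zeta> x" for x
  proof -
    have "(\<Sum>i\<in>Basis. ((G x \<bullet> i) * \<zeta> x + u x * (grad \<zeta> x \<bullet> i)) *\<^sub>R i) = (\<Sum>i\<in>Basis. ((\<zeta> x *\<^sub>R G x + u x *\<^sub>R grad \<zeta> x) \<bullet> i) *\<^sub>R i)"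
      by (intro sum.cong) (auto simp: inner_add_left mult.commute)
    then show ?thesis by (simp only: euclidean_representation)
  qed
  ultimately have i2: "integrable lborel (\<lambda>x. \<zeta> x *\<^sub>R G x + u x *\<^sub>R grad \<zeta> x)" by simp
  have "(\<integral>x. \<zeta> x * u x * (grad \<psi> x \<bullet> v) \<partial>lborel) = - (\<integral>x. ((\<zeta> x *\<^sub>R G x + u x *\<^sub>R grad \<zeta> x) \<bullet> v) * \<psi> x \<partial>lborel)"
    if P: "\<psi> \<in> test_functions UNIV" for \<psi> v
  proof -
    note [measurable] = test_functions_borel[OF P] grad_test_borel[OF P]
    obtain B where B: "\<And>x. \<bar>\<psi> x\<bar> \<le> B" using test_bounded[OF P] by blast
    obtain B' where B': "\<And>x. norm (grad \<psi> x) \<le> B'" using grad_test_bounded[OF P] by blast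
    have B'': "\<bar>grad \<psi> x \<bullet> v\<bar> \<le> B' * norm v" for x
      using order_trans[OF Cauchy_Schwarz_ineq2 mult_right_mono[OF B' norm_ge_zero]] .
    have P2: "(\<lambda>x. \<psi> x * \<zeta> x) \<in> test_functions \<Omega>"
      using test_functions_mult[OF C] P by (simp add: test_functions_def)
    have g: "grad (\<lambda>x. \<psi> x * \<zeta> x) x = \<psi> x *\<^sub>R grad \<zeta> x + \<zeta> x *\<^sub>R grad \<psi> x" for x
      by (intro grad_mult test_functions_has_derivative[OF P] test_functions_has_derivative[OF C])
    have j1: "integrable lborel (\<lambda>x. \<zeta> x * u x * (grad \<psi> x \<bullet> v))"
      by (rule integrable_mult_bounded[OF i1 _ B'']) simp
    have j2: "integrable lborel (\<lambda>x. u x * (grad \<zeta> x \<bullet> v) * \<psi> x)"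
      by (rule integrable_mult_bounded[OF iC(2) _ B]) simp
    have j3: "integrable lborel (\<lambda>x. (G x \<bullet> v) * \<zeta> x * \<psi> x)"
      by (rule integrable_mult_bounded[OF iC(3) _ B]) simp
    have "(\<integral>x. \<zeta> x * u x * (grad \<psi> x \<bullet> v) \<partial>lborel) + (\<integral>x. u x * (grad \<zeta> x \<bullet> v) * \<psi> x \<partial>lborel)
      = (\<integral>x. u x * (grad (\<lambda>x. \<psi> x * \<zeta> x) x \<bullet> v) \<partial>lborel)"
      unfolding Bochner_Integration.integral_add[OF j1 j2, symmetric] g
      by (intro Bochner_Integration.integral_cong) (auto simp: inner_simps algebra_simps)
    also have "\<dots> = - (\<integral>x. (G x \<bullet> v) * (\<psi> x * \<zeta> x) \<partial>lborel)" using G P2 by (auto simp: local_grad_def)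
    also have "(\<integral>x. (G x \<bullet> v) * (\<psi> x * \<zeta> x) \<partial>lborel) = (\<integral>x. (G x \<bullet> v) * \<zeta> x * \<psi> x \<partial>lborel)"
      by (intro Bochner_Integration.integral_cong) (auto simp: algebra_simps)
    finally have "(\<integral>x. \<zeta> x * u x * (grad \<psi> x \<bullet> v) \<partial>lborel) =
       - ((\<integral>x. (G x \<bullet> v) * \<zeta> x * \<psi> x \<partial>lborel) + (\<integral>x. u x * (grad \<zeta> x \<bullet> v) * \<psi> x \<partial>lborel))" by linarith
    also have "(\<integral>x. (G x \<bullet> v) * \<zeta> x * \<psi> x \<partial>lborel) + (\<integral>x. u x * (grad \<zeta> x \<bullet> v) * \<psi> x \<partial>lborel) =
       (\<integral>x. ((\<zeta> x *\<^sub>R G x + u x *\<^sub>R grad \<zeta> x) \<bullet> v) * \<psi> x \<partial>lborel)"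
      unfolding Bochner_Integration.integral_add[OF j3 j2, symmetric]
      by (intro Bochner_Integration.integral_cong) (auto simp: inner_simps algebra_simps)
    finally show ?thesis .
  qed
  with i1 i2 show ?thesis by (simp add: weak_grad_def)
qed

lemma weak_grad_local_grad: "weak_grad w H \<Longrightarrow> local_grad UNIV w H"
  unfolding weak_grad_def local_grad_def
  by (auto intro!: integrable_real_mult_indicator integrable_mult_indicator compact_borel
    simp: mult.commute[of "indicator _ _"])

lemma weak_grad_mult_test:
  "weak_grad w H \<Longrightarrow> \<eta> \<in> test_functions UNIV \<Longrightarrow>
    weak_grad (\<lambda>x. \<eta> x * w x) (\<lambda>x. \<eta> x *\<^sub>R H x + w x *\<^sub>R grad \<eta> x)"
  by (rule local_grad_weak_grad[OF weak_grad_local_grad])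

section \<open>Gain of integrability\<close>

text \<open>Beyond the threshold s the ratio t/s exceeds 1, so t = s (t/s) is at most s (t/s)^r.
  With s free, this replaces Hoelder's inequality: a mean value is bounded by s plus a multiple of
  the integral of the r-th power.\<close>

lemma le_add_powr:
  fixes s t r :: real
  assumes "t \<ge> 0" "s > 0" "r \<ge> 1"
  shows "t \<le> s + s powr (1 - r) * t powr r"
proof (cases "t \<le> s")
  case True
  then show ?thesis by (smt (verit) mult_nonneg_nonneg powr_ge_zero)
next
  case False
  then have "t = t powr (1 - r) * t powr r" using assms by (simp flip: powr_add)
  also have "\<dots> \<le> s powr (1 - r) * t powr r"
    using False assms by (intro mult_right_mono powr_mono2') auto
  finally show ?thesis using assms by linarith
qed

text \<open>A substitute for the Sobolev inequality: \<open>w\<close> is compared with its averages over balls of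
  radius \<open>\<epsilon>\<close>. The averages are at most \<open>\<lambda>\<close> when \<open>\<epsilon>\<close> is chosen according to
  \<open>\<integral>w\<^sup>r\<close>, and the mean difference is controlled by \<open>\<epsilon>\<close> times the gradient.\<close>

lemma superlevel_bound:
  fixes w :: "'a::euclidean_space \<Rightarrow> real"
  assumes W: "weak_grad w H" and w0: "\<And>x. w x \<ge> 0" and q: "q \<ge> 1" and r: "r \<ge> 1" and l: "l > 0"
    and D: "(\<integral>\<^sup>+x. ennreal (norm (H x) powr q) \<partial>lborel) \<le> ennreal D" "D \<ge> 0"
    and Y: "(\<integral>\<^sup>+x. ennreal (w x powr r) \<partial>lborel) \<le> ennreal Y" "Y > 0"
    and e: "e > 0" "emeasure lborel (ball (0::'a) e) = ennreal ((l/2) powr (- r) * Y)"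
  shows "emeasure lborel {x. w x > 2 * l} \<le> ennreal (D * (2 * e / l) powr q)"
proof -
  note [measurable] = weak_gradD(3,4)[OF W]
  define A where "A = {x. w x > 2 * l}"
  have A[measurable]: "A \<in> sets borel" unfolding A_def by measurable
  define B where "B = ball (0::'a) e"
  have B[measurable]: "B \<in> sets borel" by (simp add: B_def)
  define b where "b = (l/2) powr (- r) * Y"
  have b: "b > 0" "emeasure lborel B = ennreal b" using e Y l by (auto simp: b_def B_def)
  \<comment> \<open>Chebyshev's inequality shows that the superlevel set has finite measure
    \<open>a\<close>. Otherwise the term l a / 2 could not be subtracted from l a at the
    end.\<close>
  have "ennreal (2 * l) * emeasure lborel A = (\<integral>\<^sup>+x. ennreal (2 * l) * indicator A x \<partial>lborel)"
    by (simp add: nn_integral_cmult_indicator)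
  also have "\<dots> \<le> (\<integral>\<^sup>+x. ennreal (norm (w x)) \<partial>lborel)"
    by (intro nn_integral_mono) (auto simp: A_def indicator_def w0 intro!: ennreal_leI)
  also have "\<dots> < \<infinity>" using weak_gradD(1)[OF W] by (simp add: integrable_iff_bounded)
  finally have "emeasure lborel A < \<infinity>" using l by (auto simp: ennreal_mult_less_top)
  then obtain a where a: "a \<ge> 0" "emeasure lborel A = ennreal a"
    by (cases "emeasure lborel A") auto
  have mean: "ennreal (l * b) \<le> (\<integral>\<^sup>+z. indicator B z * ennreal \<bar>w (x + z) - w x\<bar> \<partial>lborel)" (is "_ \<le> ?I x") if x: "x \<in> A" for x
  proof -
    \<comment> \<open>With |B| = b = s^(-r) Y the two contributions b s and s^(1-r) Y coincide, and
      together they make up l b, half of the total 2 l b. This balance is the origin of the volume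
      prescribed for the ball.\<close>
    define s where "s = l / 2"
    have s: "s > 0" using l by (simp add: s_def)
    have "ennreal (l * b) + ennreal (l * b) = (\<integral>\<^sup>+z. indicator B z * ennreal (2 * l) \<partial>lborel)"
      using l b by (simp add: B_def[symmetric] nn_integral_multc ennreal_mult'[symmetric] ennreal_mult''[symmetric] flip: ennreal_plus)
    also have "\<dots> \<le> (\<integral>\<^sup>+z. indicator B z * ennreal \<bar>w (x + z) - w x\<bar> + (indicator B z * ennreal s + ennreal (s powr (1 - r)) * ennreal (w (x + z) powr r)) \<partial>lborel)"
    proof (rule nn_integral_mono, goal_cases)
      case (1 z)
      show ?case
      proof (cases "z \<in> B")
        case True
        have "2 * l \<le> w x" using x by (simp add: A_def)
        also have "\<dots> \<le> \<bar>w (x + z) - w x\<bar> + w (x + z)" by linarith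
        also have "\<dots> \<le> \<bar>w (x + z) - w x\<bar> + (s + s powr (1 - r) * w (x + z) powr r)"
          using le_add_powr[OF w0 s r, of "x + z"] by linarith
        finally have "ennreal (2 * l) \<le> ennreal (\<bar>w (x + z) - w x\<bar> + (s + s powr (1 - r) * w (x + z) powr r))"
          by (rule ennreal_leI)
        also have "\<dots> = ennreal \<bar>w (x + z) - w x\<bar> + (ennreal s + ennreal (s powr (1 - r)) * ennreal (w (x + z) powr r))"
          using s by (simp add: ennreal_plus ennreal_mult')
        finally show ?thesis using True by simp
      qed simp
    qed
    also have "\<dots> = ?I x + (ennreal b * ennreal s + ennreal (s powr (1 - r)) * (\<integral>\<^sup>+z. ennreal (w (x + z) powr r) \<partial>lborel))"
      by (simp add: nn_integral_add nn_integral_cmult nn_integral_multc b)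
    also have "(\<integral>\<^sup>+z. ennreal (w (x + z) powr r) \<partial>lborel) = (\<integral>\<^sup>+z. ennreal (w z powr r) \<partial>lborel)"
      using nn_integral_translate[of "\<lambda>z. ennreal (w z powr r)" x] by (simp add: add.commute)
    also have "?I x + (ennreal b * ennreal s + ennreal (s powr (1 - r)) * (\<integral>\<^sup>+z. ennreal (w z powr r) \<partial>lborel))
       \<le> ?I x + (ennreal b * ennreal s + ennreal (s powr (1 - r)) * ennreal Y)"
      by (intro add_mono mult_left_mono Y order_refl) auto
    also have "ennreal b * ennreal s + ennreal (s powr (1 - r)) * ennreal Y = ennreal (b * s + s powr (1 - r) * Y)"
      using b s Y by (simp add: ennreal_plus ennreal_mult')
    also have "b * s + s powr (1 - r) * Y = l * b"
    proof -
      have "s powr (1 - r) = s * s powr (- r)" using s by (simp add: powr_diff powr_minus_divide)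
      moreover have "b = s powr (- r) * Y" "l = 2 * s" by (simp_all add: b_def s_def)
      ultimately show ?thesis by simp
    qed
    finally show ?thesis
      by (simp add: add.commute[of "?I x"] ennreal_add_left_cancel_le)
  qed
  \<comment> \<open>This threshold makes the term e s a equal to l a / 2, to be absorbed on the
    left.\<close>
  define s where "s = l / (2 * e)"
  have s: "s > 0" using l e by (simp add: s_def)
  have shift: "(\<integral>\<^sup>+x. indicator A x * ennreal \<bar>w (x + z) - w x\<bar> \<partial>lborel) \<le> ennreal (e * (s * a + s powr (1 - q) * D))"
    if z: "z \<in> B" for z
  proof -
    have "(\<integral>\<^sup>+x. indicator A x * ennreal \<bar>w (x + z) - w x\<bar> \<partial>lborel) =
       (\<integral>\<^sup>+x. indicator A x * ennreal \<bar>w (x + z) - w x - (\<lambda>_. 0) x\<bar> \<partial>lborel)" by simp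
    also have "\<dots> \<le>
      (\<integral>\<^sup>+t. indicator {0..1::real} t * (\<integral>\<^sup>+x. indicator A x * ennreal \<bar>H (x + t *\<^sub>R z) \<bullet> z - (\<lambda>_. 0) x\<bar> \<partial>lborel) \<partial>lborel)"
      by (rule weak_grad_shift_L1[OF W]) auto
    also have "\<dots> \<le> (\<integral>\<^sup>+t. indicator {0..1::real} t * ennreal (e * (s * a + s powr (1 - q) * D)) \<partial>lborel)"
    proof (intro nn_integral_mono mult_left_mono)
      fix t :: real
      have "(\<integral>\<^sup>+x. indicator A x * ennreal \<bar>H (x + t *\<^sub>R z) \<bullet> z - (\<lambda>_. 0) x\<bar> \<partial>lborel) \<le>
        (\<integral>\<^sup>+x. ennreal e * (ennreal s * indicator A x + ennreal (s powr (1 - q)) * ennreal (norm (H (x + t *\<^sub>R z)) powr q)) \<partial>lborel)"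
      proof (rule nn_integral_mono, goal_cases)
        case (1 x)
        show ?case
        proof (cases "x \<in> A")
          case True
          have "\<bar>H (x + t *\<^sub>R z) \<bullet> z\<bar> \<le> norm (H (x + t *\<^sub>R z)) * norm z" by (rule Cauchy_Schwarz_ineq2)
          also have "\<dots> \<le> (s + s powr (1 - q) * norm (H (x + t *\<^sub>R z)) powr q) * e"
            using z e s q by (intro mult_mono le_add_powr) (auto simp: B_def)
          finally have "ennreal \<bar>H (x + t *\<^sub>R z) \<bullet> z\<bar> \<le> ennreal (e * (s + s powr (1 - q) * norm (H (x + t *\<^sub>R z)) powr q))"
            by (intro ennreal_leI) (simp add: mult.commute)
          also have "\<dots> = ennreal e * (ennreal s + ennreal (s powr (1 - q)) * ennreal (norm (H (x + t *\<^sub>R z)) powr q))"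
            using e s by (simp add: ennreal_plus ennreal_mult')
          finally show ?thesis using True by simp
        qed simp
      qed
      also have "\<dots> = ennreal e * (ennreal s * ennreal a + ennreal (s powr (1 - q)) * (\<integral>\<^sup>+x. ennreal (norm (H (x + t *\<^sub>R z)) powr q) \<partial>lborel))"
        by (simp add: nn_integral_cmult nn_integral_add a)
      also have "(\<integral>\<^sup>+x. ennreal (norm (H (x + t *\<^sub>R z)) powr q) \<partial>lborel) = (\<integral>\<^sup>+x. ennreal (norm (H x) powr q) \<partial>lborel)"
        by (rule nn_integral_translate[of "\<lambda>x. ennreal (norm (H x) powr q)"]) measurable
      also have "ennreal e * (ennreal s * ennreal a + ennreal (s powr (1 - q)) * (\<integral>\<^sup>+x. ennreal (norm (H x) powr q) \<partial>lborel))
         \<le> ennreal e * (ennreal s * ennreal a + ennreal (s powr (1 - q)) * ennreal D)"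
        by (intro mult_left_mono add_mono D order_refl) auto
      also have "\<dots> = ennreal (e * (s * a + s powr (1 - q) * D))"
        using e s a D by (simp add: ennreal_plus ennreal_mult' ennreal_mult'')
      finally show "(\<integral>\<^sup>+x. indicator A x * ennreal \<bar>H (x + t *\<^sub>R z) \<bullet> z - (\<lambda>_. 0) x\<bar> \<partial>lborel) \<le> ennreal (e * (s * a + s powr (1 - q) * D))" .
    qed simp
    also have "\<dots> = ennreal (e * (s * a + s powr (1 - q) * D))" by (simp add: nn_integral_multc)
    finally show ?thesis .
  qed
  \<comment> \<open>The lower bound for the oscillation holds pointwise in x, the upper bound for
    each shift z. Integrating over A and B and exchanging the order makes them meet; the factor b
    then cancels.\<close>
  have "ennreal (l * b * a) = (\<integral>\<^sup>+x. indicator A x * ennreal (l * b) \<partial>lborel)"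
    using l b a by (simp add: nn_integral_multc ennreal_mult'[symmetric] mult.commute)
  also have "\<dots> \<le> (\<integral>\<^sup>+x. (\<integral>\<^sup>+z. indicator A x * (indicator B z * ennreal \<bar>w (x + z) - w x\<bar>) \<partial>lborel) \<partial>lborel)"
  proof (rule nn_integral_mono, goal_cases)
    case (1 x)
    then show ?case using mean[of x] by (cases "x \<in> A") (auto simp: nn_integral_cmult)
  qed
  also have "\<dots> = (\<integral>\<^sup>+z. (\<integral>\<^sup>+x. indicator A x * (indicator B z * ennreal \<bar>w (x + z) - w x\<bar>) \<partial>lborel) \<partial>lborel)"
    by (rule lborel_pair.Fubini'[symmetric]) measurable
  also have "\<dots> = (\<integral>\<^sup>+z. indicator B z * (\<integral>\<^sup>+x. indicator A x * ennreal \<bar>w (x + z) - w x\<bar> \<partial>lborel) \<partial>lborel)"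
    by (simp add: nn_integral_cmult[symmetric] mult.left_commute)
  also have "\<dots> \<le> (\<integral>\<^sup>+z. indicator B z * ennreal (e * (s * a + s powr (1 - q) * D)) \<partial>lborel)"
    using shift by (intro nn_integral_mono) (auto simp: indicator_def)
  also have "\<dots> = ennreal (b * (e * (s * a + s powr (1 - q) * D)))"
    using b by (simp add: nn_integral_multc ennreal_mult')
  finally have "l * b * a \<le> b * (e * (s * a + s powr (1 - q) * D))"
    using b e s a D by (subst (asm) ennreal_le_iff) auto
  then have "b * (l * a) \<le> b * (e * (s * a + s powr (1 - q) * D))" by (simp add: ac_simps)
  then have "l * a \<le> e * (s * a + s powr (1 - q) * D)" using b by simp
  also have "\<dots> = l * a / 2 + e * (s powr (1 - q) * D)" using e by (simp add: s_def distrib_left)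
  finally have "a \<le> 2 * e / l * (s powr (1 - q) * D)" using l by (simp add: field_simps)
  also have "\<dots> = D * (2 * e / l) powr q"
  proof -
    have e1: "s powr (1 - q) = s * s powr (- q)" using s by (simp add: powr_diff powr_minus_divide)
    have e2: "s powr (- q) = (2 * e / l) powr q" using s l e by (simp add: s_def powr_minus powr_divide powr_mult field_simps)
    have e3: "2 * e / l * s = 1" using l e by (simp add: s_def)
    have "2 * e / l * (s * s powr (- q) * D) = (2 * e / l * s) * (s powr (- q) * D)" by (simp only: mult.assoc)
    then show ?thesis unfolding e1 e3 by (simp only: e2 mult_1 mult.commute)
  qed
  finally show ?thesis using a by (simp add: A_def ennreal_leI)
qed

text \<open>This is a weak-type Gagliardo-Nirenberg inequality with exponent q + r q / n. The radius
  e of the ball of averages is eliminated: its volume is a multiple of Y m^(-r), so e^q supplies (Y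
  m^(-r))^(q/n), and the gradient estimate supplies a further m^(-q).\<close>

lemma superlevel_bound_powr:
  fixes q r :: real
  assumes q: "q \<ge> 1" and r: "r \<ge> 1"
  defines "n \<equiv> real DIM('a::euclidean_space)"
  shows "\<exists>C>0. \<forall>(w::'a \<Rightarrow> real) H D Y m. weak_grad w H \<longrightarrow> (\<forall>x. w x \<ge> 0) \<longrightarrow> m > 0 \<longrightarrow> D \<ge> 0 \<longrightarrow> Y > 0 \<longrightarrow>
     (\<integral>\<^sup>+x. ennreal (norm (H x) powr q) \<partial>lborel) \<le> ennreal D \<longrightarrow>
     (\<integral>\<^sup>+x. ennreal (w x powr r) \<partial>lborel) \<le> ennreal Y \<longrightarrow>
     emeasure lborel {x. w x > m} \<le> ennreal (C * D * Y powr (q / n) * m powr (- (q + r * q / n)))"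
proof -
  define V where "V = unit_ball_vol n"
  have V: "V > 0" by (simp add: V_def n_def)
  have n: "n > 0" by (simp add: n_def)
  show ?thesis
  proof (intro exI[of _ "4 powr q * (4 powr r / V) powr (q / n)"] conjI allI impI)
    fix w :: "'a \<Rightarrow> real" and H D Y m
    assume a: "weak_grad w H" "\<forall>x. w x \<ge> 0" "(m::real) > 0" "D \<ge> 0" "Y > 0"
      "(\<integral>\<^sup>+x. ennreal (norm (H x) powr q) \<partial>lborel) \<le> ennreal D"
      "(\<integral>\<^sup>+x. ennreal (w x powr r) \<partial>lborel) \<le> ennreal Y"
    define l where "l = m / 2"
    have l: "l > 0" using a by (simp add: l_def)
    define e where "e = ((l/2) powr (- r) * Y / V) powr (1 / n)"
    have e: "e > 0" using l a V by (simp add: e_def)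
    have "e ^ DIM('a) = (l/2) powr (- r) * Y / V"
      using l a V n by (simp add: e_def powr_powr n_def flip: powr_realpow)
    then have "emeasure lborel (ball (0::'a) e) = ennreal ((l/2) powr (- r) * Y)"
      using e V less_imp_neq[OF V] by (simp add: emeasure_ball V_def n_def)
    from superlevel_bound[OF a(1) _ q r l a(6) a(4) a(7) a(5) e this]
    have "emeasure lborel {x. w x > 2 * l} \<le> ennreal (D * (2 * e / l) powr q)" using a by auto
    also have "D * (2 * e / l) powr q = 4 powr q * (4 powr r / V) powr (q / n) * D * Y powr (q / n) * m powr (- (q + r * q / n))"
    proof -
      have l2: "(l/2) powr (- r) = 4 powr r * m powr (- r)"
        using a by (simp add: l_def powr_divide powr_minus field_simps)
      have "e powr q = (4 powr r / V * (Y * m powr (- r))) powr (q / n)"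
        unfolding e_def powr_powr l2 by (simp add: field_simps)
      also have "\<dots> = (4 powr r / V) powr (q / n) * (Y powr (q / n) * m powr (- (r * q / n)))"
        using a V by (simp only: powr_mult[of "4 powr r / V" "Y * m powr (- r)"] powr_mult[of Y "m powr (- r)"] powr_powr) simp
      finally have eq: "e powr q = (4 powr r / V) powr (q / n) * (Y powr (q / n) * m powr (- (r * q / n)))" .
      have "(2 * e / l) powr q = (4 / m * e) powr q" by (simp add: l_def)
      also have "\<dots> = 4 powr q * m powr (- q) * e powr q"
        using a e by (simp add: powr_mult powr_divide powr_minus field_simps)
      finally have eq2: "(2 * e / l) powr q = 4 powr q * m powr (- q) * e powr q" .
      have eq3: "m powr (- (q + r * q / n)) = m powr (- q) * m powr (- (r * q / n))"
        by (simp flip: powr_add)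
      show ?thesis unfolding eq2 eq eq3 by (simp only: ac_simps)
    qed
    finally show "emeasure lborel {x. w x > m} \<le> ennreal (4 powr q * (4 powr r / V) powr (q / n) * D * Y powr (q / n) * m powr (- (q + r * q / n)))"
      by (simp add: l_def)
  qed (use V in simp)
qed

lemma dyadic_level_exists:
  fixes t m :: real
  assumes "t > m" "m > 0"
  shows "\<exists>j::nat. 2 ^ j * m < t \<and> t \<le> 2 ^ Suc j * m"
proof -
  define P where "P j \<longleftrightarrow> t \<le> 2 ^ j * m" for j :: nat
  obtain k :: nat where "t / m < 2 ^ k" using real_arch_pow[of 2 "t/m"] by auto
  then have "P k" using assms by (simp add: P_def field_simps)
  define j where "j = (LEAST j. P j)"
  have j: "P j" using \<open>P k\<close> unfolding j_def by (rule LeastI)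
  have "j \<noteq> 0" using j assms by (cases j) (auto simp: P_def)
  then obtain i where i: "j = Suc i" by (cases j) auto
  have "\<not> P i" using not_less_Least[of i P] i by (simp add: j_def)
  then show ?thesis using j i by (intro exI[of _ i]) (auto simp: P_def)
qed

text \<open>On the layer between 2^j m0 and 2^(j+1) m0 the integrand is at most the t-th power of
  the upper end, and the measure is bounded at the lower end. The layers sum to a geometric series
  of ratio 2^(t - s), which converges because t < s.\<close>

lemma weak_type_imp_strong_type:
  fixes w :: "'a::euclidean_space \<Rightarrow> real"
  assumes [measurable]: "w \<in> borel_measurable borel" and t: "0 \<le> t" "t < s" and m0: "m0 > 0" and M: "M \<ge> 0"
    and w: "\<And>m. m \<ge> m0 \<Longrightarrow> emeasure lborel {x. w x > m} \<le> ennreal (M * m powr (- s))"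
  shows "(\<integral>\<^sup>+x. indicator {x. w x > m0} x * ennreal (w x powr t) \<partial>lborel) \<le>
    ennreal (2 powr t / (1 - 2 powr (t - s)) * M * m0 powr (t - s))"
proof -
  define c where "c = 2 powr (t - s)"
  have "c < 2 powr 0" unfolding c_def using t by (subst powr_less_cancel_iff) auto
  then have c: "0 < c" "c < 1" by (simp_all add: c_def)
  have "(\<integral>\<^sup>+x. indicator {x. w x > m0} x * ennreal (w x powr t) \<partial>lborel) \<le>
    (\<integral>\<^sup>+x. (\<Sum>j. ennreal ((2 ^ Suc j * m0) powr t) * indicator {x. w x > 2 ^ j * m0} x) \<partial>lborel)"
  proof (rule nn_integral_mono)
    fix x
    show "indicator {x. w x > m0} x * ennreal (w x powr t) \<le>
      (\<Sum>j. ennreal ((2 ^ Suc j * m0) powr t) * indicator {x. w x > 2 ^ j * m0} x)"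
    proof (cases "w x > m0")
      case True
      obtain j where j: "2 ^ j * m0 < w x" "w x \<le> 2 ^ Suc j * m0" using dyadic_level_exists[OF True m0] by blast
      have "ennreal (w x powr t) \<le> ennreal ((2 ^ Suc j * m0) powr t) * indicator {x. w x > 2 ^ j * m0} x"
        using j True m0 t by (auto intro!: ennreal_leI powr_mono2)
      also have "\<dots> \<le> (\<Sum>j. ennreal ((2 ^ Suc j * m0) powr t) * indicator {x. w x > 2 ^ j * m0} x)"
      proof -
        let ?f = "\<lambda>j. ennreal ((2 ^ Suc j * m0) powr t) * indicator {x. w x > 2 ^ j * m0} x"
        have "sum ?f {j} \<le> suminf ?f" by (rule sum_le_suminf) auto
        moreover have "sum g {j} = g j" for g :: "nat \<Rightarrow> ennreal" by simp
        note this[of ?f]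
        ultimately show ?thesis by (simp only:)
      qed
      finally show ?thesis using True by simp
    qed simp
  qed
  also have "\<dots> = (\<Sum>j. ennreal ((2 ^ Suc j * m0) powr t) * emeasure lborel {x. w x > 2 ^ j * m0})"
    by (subst nn_integral_suminf) (auto simp: nn_integral_cmult_indicator)
  also have "\<dots> \<le> (\<Sum>j. ennreal (2 powr t * M * m0 powr (t - s) * c ^ j))"
  proof (intro suminf_le summableI)
    fix j :: nat
    have p: "(2 ^ j * m0) \<ge> m0" using m0 by (simp add: mult_le_cancel_right1)
    have "ennreal ((2 ^ Suc j * m0) powr t) * emeasure lborel {x. w x > 2 ^ j * m0} \<le>
      ennreal ((2 ^ Suc j * m0) powr t) * ennreal (M * (2 ^ j * m0) powr (- s))"
      by (intro mult_left_mono w p) simp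
    also have "\<dots> = ennreal ((2 ^ Suc j * m0) powr t * (M * (2 ^ j * m0) powr (- s)))"
      using M by (simp add: ennreal_mult')
    also have "(2 ^ Suc j * m0) powr t * (M * (2 ^ j * m0) powr (- s)) = 2 powr t * M * m0 powr (t - s) * c ^ j"
    proof -
      have "(2 ^ Suc j * m0) powr t = 2 powr t * (2 ^ j * m0) powr t"
        using m0 by (simp add: powr_mult mult.assoc)
      moreover have "(2 ^ j * m0) powr t * (2 ^ j * m0) powr (- s) = (2 ^ j * m0) powr (t - s)"
        by (simp flip: powr_add)
      moreover have "(2 ^ j * m0) powr (t - s) = c ^ j * m0 powr (t - s)"
        using m0 by (simp add: powr_mult c_def powr_power powr_powr mult.commute flip: powr_realpow)
      ultimately show ?thesis by (simp add: algebra_simps)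
    qed
    finally show "ennreal ((2 ^ Suc j * m0) powr t) * emeasure lborel {x. w x > 2 ^ j * m0} \<le>
      ennreal (2 powr t * M * m0 powr (t - s) * c ^ j)" .
  qed
  also have "\<dots> = ennreal (\<Sum>j. 2 powr t * M * m0 powr (t - s) * c ^ j)"
    using c M by (intro suminf_ennreal2) (auto intro!: summable_mult summable_geometric)
  also have "(\<Sum>j. 2 powr t * M * m0 powr (t - s) * c ^ j) = 2 powr t * M * m0 powr (t - s) * (1 / (1 - c))"
    using c by (subst suminf_mult) (auto simp: suminf_geometric summable_geometric)
  finally show ?thesis by (simp add: c_def mult_ac)
qed

text \<open>The passage to a strong-type bound costs the endpoint exponent. The truncation at m is
  kept because the right-hand side carries a negative power of m; in the iteration m is the distance
  between two levels.\<close>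

lemma integrability_gain:
  fixes q r t :: real
  defines "n \<equiv> real DIM('a::euclidean_space)"
  assumes q: "q \<ge> 1" and r: "r \<ge> 1" and t: "0 \<le> t" "t < q + r * q / n"
  shows "\<exists>C>0. \<forall>(w::'a \<Rightarrow> real) H D Y m. weak_grad w H \<longrightarrow> (\<forall>x. w x \<ge> 0) \<longrightarrow> m > 0 \<longrightarrow> D \<ge> 0 \<longrightarrow> Y > 0 \<longrightarrow>
     (\<integral>\<^sup>+x. ennreal (norm (H x) powr q) \<partial>lborel) \<le> ennreal D \<longrightarrow>
     (\<integral>\<^sup>+x. ennreal (w x powr r) \<partial>lborel) \<le> ennreal Y \<longrightarrow>
     (\<integral>\<^sup>+x. indicator {x. w x > m} x * ennreal (w x powr t) \<partial>lborel) \<le> ennreal (C * D * Y powr (q / n) * m powr (t - (q + r * q / n)))"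
proof -
  define s where "s = q + r * q / n"
  obtain C where C: "C > 0" "\<And>(w::'a \<Rightarrow> real) H D Y m. weak_grad w H \<Longrightarrow> (\<forall>x. w x \<ge> 0) \<Longrightarrow> m > 0 \<Longrightarrow> D \<ge> 0 \<Longrightarrow> Y > 0 \<Longrightarrow>
     (\<integral>\<^sup>+x. ennreal (norm (H x) powr q) \<partial>lborel) \<le> ennreal D \<Longrightarrow>
     (\<integral>\<^sup>+x. ennreal (w x powr r) \<partial>lborel) \<le> ennreal Y \<Longrightarrow>
     emeasure lborel {x. w x > m} \<le> ennreal (C * D * Y powr (q / n) * m powr (- s))"
    using superlevel_bound_powr[OF q r, where 'a='a] unfolding n_def[symmetric] s_def[symmetric] by blast
  have "2 powr (t - s) < 2 powr 0" using t by (subst powr_less_cancel_iff) (auto simp: s_def)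
  then have c: "1 - 2 powr (t - s) > 0" by simp
  show ?thesis
  proof (intro exI[of _ "2 powr t / (1 - 2 powr (t - s)) * C"] conjI allI impI)
    fix w :: "'a \<Rightarrow> real" and H D Y m
    assume a: "weak_grad w H" "\<forall>x. w x \<ge> 0" "(m::real) > 0" "D \<ge> 0" "Y > 0"
      "(\<integral>\<^sup>+x. ennreal (norm (H x) powr q) \<partial>lborel) \<le> ennreal D"
      "(\<integral>\<^sup>+x. ennreal (w x powr r) \<partial>lborel) \<le> ennreal Y"
    have "(\<integral>\<^sup>+x. indicator {x. w x > m} x * ennreal (w x powr t) \<partial>lborel) \<le>
      ennreal (2 powr t / (1 - 2 powr (t - s)) * (C * D * Y powr (q / n)) * m powr (t - s))"
    proof (rule weak_type_imp_strong_type)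
      show "emeasure lborel {x. w x > l} \<le> ennreal (C * D * Y powr (q / n) * l powr (- s))" if "l \<ge> m" for l
        using C(2)[OF a(1,2) _ a(4-7), of l] that a(3) by simp
    qed (use weak_gradD(3)[OF a(1)] t a C(1) in \<open>auto simp: s_def\<close>)
    then show "(\<integral>\<^sup>+x. indicator {x. w x > m} x * ennreal (w x powr t) \<partial>lborel) \<le>
      ennreal (2 powr t / (1 - 2 powr (t - s)) * C * D * Y powr (q / n) * m powr (t - (q + r * q / n)))"
      by (simp add: s_def mult.assoc)
  qed (use c C in simp)
qed

text \<open>Integrability with exponent r gives integrability with every exponent below q + r q / n.
  The hypothesis on t says t < q + t q / n, so the gain stays bounded below for r between q and t,
  and finitely many steps reach t.\<close>

lemma integrability_bootstrap:
  fixes w :: "'a::euclidean_space \<Rightarrow> real"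
  defines "n \<equiv> real DIM('a)"
  assumes W: "weak_grad w H" and w0: "\<And>x. w x \<ge> 0" and q: "q \<ge> 1" "q \<le> t" "t * (1 - q / n) < q"
    and D: "(\<integral>\<^sup>+x. ennreal (norm (H x) powr q) \<partial>lborel) < \<infinity>"
    and Y: "(\<integral>\<^sup>+x. ennreal (w x powr q) \<partial>lborel) < \<infinity>"
  shows "(\<integral>\<^sup>+x. ennreal (w x powr t) \<partial>lborel) < \<infinity>"
proof -
  note [measurable] = weak_gradD(3,4)[OF W]
  have n: "n > 0" by (simp add: n_def)
  have step: "(\<integral>\<^sup>+x. ennreal (w x powr r') \<partial>lborel) < \<infinity>"
    if r: "r \<ge> 1" "r \<le> r'" "r' < q + r * q / n" and f: "(\<integral>\<^sup>+x. ennreal (w x powr r) \<partial>lborel) < \<infinity>" for r r'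
  proof -
    obtain D' where D': "D' \<ge> 0" "(\<integral>\<^sup>+x. ennreal (norm (H x) powr q) \<partial>lborel) \<le> ennreal D'"
      using D by (cases "\<integral>\<^sup>+x. ennreal (norm (H x) powr q) \<partial>lborel") auto
    obtain Y0 where Y0: "Y0 \<ge> 0" "(\<integral>\<^sup>+x. ennreal (w x powr r) \<partial>lborel) \<le> ennreal Y0"
      using f by (cases "\<integral>\<^sup>+x. ennreal (w x powr r) \<partial>lborel") auto
    have Y': "(\<integral>\<^sup>+x. ennreal (w x powr r) \<partial>lborel) \<le> ennreal (Y0 + 1)"
      using Y0(2) by (rule order_trans) (auto intro: ennreal_leI)
    obtain C where C: "\<And>(w::'a \<Rightarrow> real) H D Y m. weak_grad w H \<Longrightarrow> (\<forall>x. w x \<ge> 0) \<Longrightarrow> m > 0 \<Longrightarrow> D \<ge> 0 \<Longrightarrow> Y > 0 \<Longrightarrow>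
     (\<integral>\<^sup>+x. ennreal (norm (H x) powr q) \<partial>lborel) \<le> ennreal D \<Longrightarrow>
     (\<integral>\<^sup>+x. ennreal (w x powr r) \<partial>lborel) \<le> ennreal Y \<Longrightarrow>
     (\<integral>\<^sup>+x. indicator {x. w x > m} x * ennreal (w x powr r') \<partial>lborel) \<le> ennreal (C * D * Y powr (q / n) * m powr (r' - (q + r * q / n)))"
      using integrability_gain[where 'a='a, OF q(1) r(1) order_trans[OF order_trans[OF zero_le_one r(1)] r(2)] r(3)[unfolded n_def]]
      unfolding n_def by blast
    have "(\<integral>\<^sup>+x. ennreal (w x powr r') \<partial>lborel) \<le>
      (\<integral>\<^sup>+x. ennreal (w x powr r) + indicator {x. w x > 1} x * ennreal (w x powr r') \<partial>lborel)"
    proof (rule nn_integral_mono)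
      fix x
      show "ennreal (w x powr r') \<le> ennreal (w x powr r) + indicator {x. w x > 1} x * ennreal (w x powr r')"
      \<comment> \<open>Where w \<le> 1 the larger exponent gives the smaller power; where w > 1 the
        gain of integrability applies at level 1.\<close>
      proof (cases "w x > 1")
        case False
        have "w x powr r' \<le> w x powr r"
          using False w0[of x] r by (cases "w x = 0") (auto intro!: powr_mono')
        then show ?thesis using False by (simp add: ennreal_leI)
      qed simp
    qed
    also have "\<dots> = (\<integral>\<^sup>+x. ennreal (w x powr r) \<partial>lborel) + (\<integral>\<^sup>+x. indicator {x. w x > 1} x * ennreal (w x powr r') \<partial>lborel)"
      by (rule nn_integral_add) measurable
    also have "\<dots> < \<infinity>"
    proof -
      have "(\<integral>\<^sup>+x. indicator {x. w x > 1} x * ennreal (w x powr r') \<partial>lborel) < \<infinity>"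
        using C[OF W _ _ D'(1) _ D'(2) Y', of 1] w0 Y0(1) by (auto intro: le_less_trans)
      with f show ?thesis by simp
    qed
    finally show ?thesis .
  qed
  \<comment> \<open>The available gain at r is q - r (1 - q/n), affine in r. For a nonnegative slope
    factor 1 - q/n it is smallest at r = t, otherwise it is at least q. Half of the minimum of these
    bounds is a step length with strict inequality.\<close>
  define c where "c = min q (q - t * (1 - q / n)) / 2"
  have c: "c > 0" using q by (simp add: c_def)
  have gap: "r + c < q + r * q / n" if "q \<le> r" "r \<le> t" for r
  proof -
    have "r * (1 - q / n) \<le> max 0 (t * (1 - q / n))"
    proof (cases "1 - q / n \<ge> 0")
      case True
      then have "r * (1 - q / n) \<le> t * (1 - q / n)" using that by (intro mult_right_mono)
      then show ?thesis by linarith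
    next
      case False
      then have "r * (1 - q / n) \<le> 0" using that q by (intro mult_nonneg_nonpos) auto
      then show ?thesis by linarith
    qed
    moreover have "max 0 (t * (1 - q / n)) + 2 * c = max (2 * c) (t * (1 - q / n) + 2 * c)" by linarith
    moreover have "2 * c \<le> q" "2 * c \<le> q - t * (1 - q / n)" by (auto simp: c_def)
    ultimately have "r * (1 - q / n) + c < q" using c by linarith
    moreover have "r * (1 - q / n) = r - r * q / n" by (simp add: right_diff_distrib)
    ultimately show ?thesis by linarith
  qed
  have "(\<integral>\<^sup>+x. ennreal (w x powr (min t (q + real j * c))) \<partial>lborel) < \<infinity>" for j
  proof (induction j)
    case 0
    then show ?case using Y q by (simp add: min_absorb2)
  next
    case (Suc j)
    have a: "q \<le> min t (q + real j * c)" "min t (q + real j * c) \<le> t" using q c by auto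
    show ?case
    proof (rule step[OF _ _ _ Suc])
      show "min t (q + real (Suc j) * c) < q + min t (q + real j * c) * q / n"
        using gap[OF a] c by (simp add: distrib_right)
      show "min t (q + real j * c) \<le> min t (q + real (Suc j) * c)" using c by (simp add: distrib_right min_def)
    qed (use a q in linarith)
  qed
  moreover obtain j :: nat where "t < real j * c" using reals_Archimedean3[OF c] by blast
  then have "min t (q + real j * c) = t" using q by simp
  ultimately show ?thesis by metis
qed

section \<open>Local upper bounds\<close>

lemma nn_integral_bound_cmult:
  fixes f g :: "'a::euclidean_space \<Rightarrow> real"
  assumes "\<And>x. f x \<le> c * g x" "c \<ge> 0" "(\<integral>\<^sup>+x. ennreal (g x) \<partial>lborel) \<le> ennreal b" "g \<in> borel_measurable borel"
  shows "(\<integral>\<^sup>+x. ennreal (f x) \<partial>lborel) \<le> ennreal (c * b)"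
proof -
  have "(\<integral>\<^sup>+x. ennreal (f x) \<partial>lborel) \<le> (\<integral>\<^sup>+x. ennreal c * ennreal (g x) \<partial>lborel)"
    using assms by (intro nn_integral_mono) (simp add: ennreal_mult'[symmetric] ennreal_leI)
  also have "\<dots> = ennreal c * (\<integral>\<^sup>+x. ennreal (g x) \<partial>lborel)"
    using assms(4) by (simp add: nn_integral_cmult)
  also have "\<dots> \<le> ennreal c * ennreal b" by (intro mult_left_mono assms) simp
  finally show ?thesis using assms(2) by (simp add: ennreal_mult')
qed

lemma nn_integral_bound_add:
  fixes f g h :: "'a::euclidean_space \<Rightarrow> real"
  assumes "\<And>x. f x \<le> g x + h x" "\<And>x. g x \<ge> 0" "\<And>x. h x \<ge> 0"
    "(\<integral>\<^sup>+x. ennreal (g x) \<partial>lborel) \<le> ennreal b" "(\<integral>\<^sup>+x. ennreal (h x) \<partial>lborel) \<le> ennreal c"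
    "b \<ge> 0" "c \<ge> 0" "g \<in> borel_measurable borel" "h \<in> borel_measurable borel"
  shows "(\<integral>\<^sup>+x. ennreal (f x) \<partial>lborel) \<le> ennreal (b + c)"
proof -
  have "(\<integral>\<^sup>+x. ennreal (f x) \<partial>lborel) \<le> (\<integral>\<^sup>+x. ennreal (g x) + ennreal (h x) \<partial>lborel)"
    using assms by (intro nn_integral_mono) (simp add: ennreal_leI flip: ennreal_plus)
  also have "\<dots> = (\<integral>\<^sup>+x. ennreal (g x) \<partial>lborel) + (\<integral>\<^sup>+x. ennreal (h x) \<partial>lborel)"
    using assms(8,9) by (simp add: nn_integral_add)
  also have "\<dots> \<le> ennreal b + ennreal c" by (intro add_mono assms)
  finally show ?thesis using assms by (simp add: ennreal_plus)
qed

text \<open>The device for comparing variable exponents with constant ones: the smaller power is at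
  most 1 where a < 1. On sets of finite measure the additional 1 does no harm.\<close>

lemma powr_mono_le_add:
  fixes a :: real
  assumes "a \<ge> 0" "0 \<le> q" "q \<le> p"
  shows "a powr q \<le> 1 + a powr p"
proof (cases "a \<ge> 1")
  case True
  then show ?thesis using powr_mono[OF assms(3) True] by linarith
next
  case False
  then have "a powr q \<le> 1" using assms powr_mono2[of q a 1] by simp
  then show ?thesis using powr_ge_zero[of a p] by linarith
qed

lemma powr_add_le:
  fixes a b q :: real
  assumes "a \<ge> 0" "b \<ge> 0" "q \<ge> 0"
  shows "(a + b) powr q \<le> 2 powr q * (a powr q + b powr q)"
proof -
  have "(a + b) powr q \<le> (2 * max a b) powr q" using assms by (intro powr_mono2) auto
  also have "\<dots> = 2 powr q * max a b powr q" using assms by (simp add: powr_mult)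
  also have "\<dots> \<le> 2 powr q * (a powr q + b powr q)"
    by (intro mult_left_mono) (auto simp: max_def)
  finally show ?thesis .
qed

text \<open>Either b is at most a^(q-1) and the product is below a^q, or a is at most b^(1/(q-1))
  and it is below the conjugate power of b. Sharp constants are irrelevant, since the weights are
  put in by rescaling both factors.\<close>

lemma young_le:
  fixes a b q :: real
  assumes "a \<ge> 0" "b \<ge> 0" "q > 1"
  shows "a * b \<le> a powr q + b powr (q / (q - 1))"
proof (cases "a = 0 \<or> b = 0")
  case False
  then have ab: "a > 0" "b > 0" using assms by auto
  show ?thesis
  proof (cases "b \<le> a powr (q - 1)")
    case True
    have "a * b \<le> a * a powr (q - 1)" using True ab by (intro mult_left_mono) auto
    also have "\<dots> = a powr q" using ab by (simp add: powr_diff)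
    finally show ?thesis using powr_ge_zero[of b "q / (q-1)"] by linarith
  next
    case False
    have "a = (a powr (q - 1)) powr (1 / (q - 1))" using ab assms by (simp add: powr_powr)
    also have "\<dots> \<le> b powr (1 / (q - 1))" using False assms by (intro powr_mono2) auto
    finally have "a * b \<le> b powr (1 / (q - 1)) * b" using ab by (intro mult_right_mono) auto
    also have "\<dots> = b powr (1 / (q - 1) + 1)" using ab by (simp add: powr_add)
    also have "1 / (q - 1) + 1 = q / (q - 1)" using assms by (simp add: field_simps)
    finally show ?thesis using powr_ge_zero[of a q] by linarith
  qed
qed auto

text \<open>Absorption of the cross term: either \<open>2sLv \<le> eh\<close>, and half of the energy density
  dominates, or \<open>eh < 2sLv\<close> and \<open>h\<close> can be eliminated since \<open>e\<^bsup>s-1\<^esup> \<le> e\<^bsup>p-1\<^esup>\<close>.\<close>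

lemma cross_term_le:
  fixes h e v L p :: real and s :: nat
  assumes "h \<ge> 0" "0 \<le> e" "e \<le> 1" "v \<ge> 0" "L \<ge> 0" "1 \<le> p" "p \<le> real s" "2 \<le> s"
  shows "real s * e ^ (s - 1) * L * v * h powr (p - 1) \<le> 1/2 * (e ^ s * h powr p) + (2 * real s * L * v) powr p"
proof -
  define b where "b = 2 * real s * L * v"
  have b: "b \<ge> 0" using assms by (simp add: b_def)
  have lhs: "real s * e ^ (s - 1) * L * v * h powr (p - 1) = b / 2 * (e ^ (s - 1) * h powr (p - 1))"
    by (simp add: b_def)
  show ?thesis
  proof (cases "b \<le> e * h")
    case True
    have "b / 2 * (e ^ (s - 1) * h powr (p - 1)) \<le> (e * h) / 2 * (e ^ (s - 1) * h powr (p - 1))"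
      using True assms by (intro mult_right_mono) auto
    also have "\<dots> = 1/2 * ((e * e ^ (s - 1)) * (h * h powr (p - 1)))" by simp
    also have "h * h powr (p - 1) = h powr p" using assms by (cases "h = 0") (auto simp: powr_diff)
    also have "e * e ^ (s - 1) = e ^ s" using assms by (cases s) auto
    finally show ?thesis unfolding lhs b_def[symmetric] using powr_ge_zero[of b p] by linarith
  next
    case False
    have "e ^ (s - 1) * h powr (p - 1) \<le> b powr (p - 1)"
    proof (cases "e = 0")
      \<comment> \<open>Here s \<ge> 2 matters: for s = 1 the factor would be
        \<open>0 ^ 0 = 1\<close> instead of 0.\<close>
      case True
      then show ?thesis using assms by (simp add: power_0_left)
    next
      case e: False
      have "e ^ (s - 1) = e powr real (s - 1)"
        by (rule powr_realpow[symmetric]) (use e assms in simp)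
      also have "\<dots> \<le> e powr (p - 1)" using e assms by (intro powr_mono') auto
      finally have "e ^ (s - 1) * h powr (p - 1) \<le> e powr (p - 1) * h powr (p - 1)"
        by (intro mult_right_mono) auto
      also have "\<dots> = (e * h) powr (p - 1)" using assms by (simp add: powr_mult)
      also have "\<dots> \<le> b powr (p - 1)" using False assms by (intro powr_mono2) auto
      finally show ?thesis .
    qed
    then have "b / 2 * (e ^ (s - 1) * h powr (p - 1)) \<le> b / 2 * b powr (p - 1)"
      using b by (intro mult_left_mono) auto
    also have "\<dots> = 1/2 * b powr p" using b by (cases "b = 0") (auto simp: powr_diff)
    also have "\<dots> \<le> b powr p" by simp
    finally show ?thesis unfolding lhs using assms by (simp add: b_def add_increasing)
  qed
qed

section \<open>The Caccioppoli inequality on superlevel sets\<close>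

lemma test_functions_power:
  assumes E: "\<eta> \<in> test_functions K" and s: "s \<noteq> 0"
  shows "(\<lambda>x. \<eta> x ^ s) \<in> test_functions K"
proof -
  have "(\<lambda>x. \<eta> x ^ (s - 1) * \<eta> x) \<in> test_functions K"
    using test_functions_mult[OF E, of "\<lambda>x. \<eta> x ^ (s - 1)"] E by (auto simp: test_functions_def intro: Ck_power)
  moreover have "\<eta> x ^ (s - 1) * \<eta> x = \<eta> x ^ s" for x using s by (simp add: power_eq_if mult.commute)
  ultimately show ?thesis by simp
qed

lemma grad_test_power:
  assumes E: "\<eta> \<in> test_functions K"
  shows "grad (\<lambda>x. \<eta> x ^ s) x = (real s * \<eta> x ^ (s - 1)) *\<^sub>R grad \<eta> x"
  by (rule grad_eqI, rule has_derivative_eq_rhs[OF has_derivative_power[OF test_functions_has_derivative[OF E]]])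
     (simp add: fun_eq_iff mult_ac)

text \<open>The lower cut at k selects the superlevel set, while the cap m makes the test function
  bounded, as the weak formulation demands. The cap is sent to infinity after the estimate.\<close>

definition trunc :: "real \<Rightarrow> real \<Rightarrow> real \<Rightarrow> real" where
  "trunc k m t = min (max (t - k) 0) m"

text \<open>The assumption \<open>eqn\<close> is the equation tested with \<open>\<eta>\<close> times a truncation of \<open>U\<close>.\<close>

locale local_solution =
  fixes U p f :: "'a::euclidean_space \<Rightarrow> real" and H :: "'a \<Rightarrow> 'a" and x0 :: 'a and R q P qf F :: real
  assumes U: "weak_grad U H" and R: "R > 0"
    and pm [measurable]: "p \<in> borel_measurable borel" and fm [measurable]: "f \<in> borel_measurable borel"
    and q: "1 \<le> q" and p: "\<And>x. x \<in> ball x0 R \<Longrightarrow> q \<le> p x \<and> p x \<le> P"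
    and qf: "1 < qf" "real DIM('a) / q < qf"
    and P: "P * (1 - q / real DIM('a)) < q"
    and intU: "(\<integral>\<^sup>+x. ennreal (indicator (ball x0 R) x * \<bar>U x\<bar> powr p x) \<partial>lborel) < \<infinity>"
    and intH: "(\<integral>\<^sup>+x. ennreal (indicator (ball x0 R) x * norm (H x) powr p x) \<partial>lborel) < \<infinity>"
    and intf: "(\<integral>\<^sup>+x. ennreal (indicator (ball x0 R) x * \<bar>f x\<bar> powr qf) \<partial>lborel) \<le> ennreal F" and F: "F \<ge> 0"
    and eqn: "\<And>\<eta> k m. \<eta> \<in> test_functions (ball x0 R) \<Longrightarrow> k \<ge> 0 \<Longrightarrow> m \<ge> 0 \<Longrightarrow>
      - (\<integral>x. (norm (H x) powr (p x - 2)) *\<^sub>R H x \<bullet>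
            (\<eta> x *\<^sub>R (indicator {x. k < U x \<and> U x \<le> k + m} x *\<^sub>R H x) + trunc k m (U x) *\<^sub>R grad \<eta> x) \<partial>lborel)
        = (\<integral>x. f x * (\<eta> x * trunc k m (U x)) \<partial>lborel)"
begin

lemma Um [measurable]: "U \<in> borel_measurable borel" "H \<in> borel_measurable borel"
  using weak_gradD(3,4)[OF U] by auto

lemma ball_borel [measurable]: "ball x0 R \<in> sets borel" by simp

lemma q_le_P: "q \<le> P" using p[of x0] R by auto

text \<open>The equation is tested with \<eta>^s times the truncation. The power s \<ge> P ensures
  that the factor \<eta>^(s-1) from the cutoff gradient suffices to absorb the cross term for every
  p(x) \<le> P. The right-hand side is kept extended-valued, so no integrability of f (U - k)^+ has
  to be known in advance.\<close>

lemma caccioppoli: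
  fixes s :: nat
  assumes E: "\<eta> \<in> test_functions K" and K: "K \<subseteq> ball x0 R" "K \<in> sets borel"
    and e: "\<And>x. 0 \<le> \<eta> x \<and> \<eta> x \<le> 1" and L: "\<And>x. norm (grad \<eta> x) \<le> L" and s: "P \<le> real s" "2 \<le> s" and k: "k \<ge> 0"
  shows "(\<integral>\<^sup>+x. ennreal (\<eta> x ^ s * (indicator {x. U x > k} x * norm (H x) powr p x)) \<partial>lborel) \<le>
     2 * ((\<integral>\<^sup>+x. ennreal (indicator K x * (2 * real s * L * max (U x - k) 0) powr p x) \<partial>lborel) +
      (\<integral>\<^sup>+x. ennreal (indicator K x * (\<bar>f x\<bar> * max (U x - k) 0)) \<partial>lborel))"
proof -
  note [measurable] = K(2)
  have [measurable]: "\<eta> \<in> borel_measurable borel" "grad \<eta> \<in> borel_measurable borel"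
    using E test_functions_borel grad_test_borel by blast+
  have L0: "L \<ge> 0" using L[of 0] norm_ge_zero[of "grad \<eta> 0"] by linarith
  have s0: "s \<noteq> 0" using s by simp
  have Ks: "(\<lambda>x. \<eta> x ^ s) \<in> test_functions K" by (rule test_functions_power[OF E s0])
  note gs = grad_test_power[OF E, of s]
  define X where "X = (\<integral>\<^sup>+x. ennreal (indicator K x * (2 * real s * L * max (U x - k) 0) powr p x) \<partial>lborel)"
  define Z where "Z = (\<integral>\<^sup>+x. ennreal (indicator K x * (\<bar>f x\<bar> * max (U x - k) 0)) \<partial>lborel)"
  define h where "h x = \<eta> x ^ s * (indicator {x. U x > k} x * norm (H x) powr p x)" for x
  have h0: "h x \<ge> 0" for x using e[of x] by (simp add: h_def)
  have [measurable]: "h \<in> borel_measurable borel" unfolding h_def[abs_def] by measurable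
  define N where "N = (\<integral>\<^sup>+x. ennreal (h x) \<partial>lborel)"
  have e1: "\<eta> x ^ s \<le> 1" "0 \<le> \<eta> x ^ s" for x using e[of x] by (simp_all add: power_le_one)
  have hK: "h x \<le> indicator (ball x0 R) x * norm (H x) powr p x" for x
  proof (cases "x \<in> K")
    case True
    then have "x \<in> ball x0 R" using K by auto
    then show ?thesis using e1[of x] unfolding h_def
      by (cases "U x > k") (simp_all add: mult_left_le_one_le)
  next
    case False
    then show ?thesis using grad_test_0(1)[OF E False] s0 by (simp add: h_def power_0_left)
  qed
  have Nfin: "N < \<infinity>"
    unfolding N_def by (rule le_less_trans[OF nn_integral_mono intH]) (intro ennreal_leI hK)
  have trunc_le: "0 \<le> trunc k m t" "trunc k m t \<le> max (t - k) 0" "trunc k m t \<le> m" if "m \<ge> 0" for m t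
    using that by (auto simp: trunc_def)
  \<comment> \<open>The cross term is also present above the level k + m, where the truncation is
    constant and its energy is zero. It can therefore be compared only with the full energy
    \<open>N\<close>, and absorption has to wait until m has gone to infinity.\<close>
  have main: "(\<integral>\<^sup>+x. ennreal (h x * indicator {x. U x \<le> k + m} x) \<partial>lborel) \<le> ennreal (1/2) * N + (X + Z)" if m: "m \<ge> 0" for m
  proof -
    define a where "a x = h x * indicator {x. U x \<le> k + m} x" for x
    define b where "b x = norm (H x) powr (p x - 2) * trunc k m (U x) * (H x \<bullet> grad (\<lambda>x. \<eta> x ^ s) x)" for x
    define c where "c x = f x * (\<eta> x ^ s * trunc k m (U x))" for x
    have tm [measurable]: "trunc k m \<in> borel_measurable borel" unfolding trunc_def[abs_def] by measurable
    have [measurable]: "a \<in> borel_measurable borel" "c \<in> borel_measurable borel"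
      unfolding a_def[abs_def] c_def[abs_def] by measurable
    have bm [measurable]: "b \<in> borel_measurable borel" unfolding b_def[abs_def] gs by measurable
    have iH: "integrable lborel (\<lambda>x. indicator (ball x0 R) x * norm (H x) powr p x)"
      using intH by (intro integrableI_bounded) (auto simp: abs_mult)
    have ia: "integrable lborel a"
    proof (rule Bochner_Integration.integrable_bound[OF iH])
      have "norm (a x) \<le> norm (indicator (ball x0 R) x * norm (H x) powr p x)" for x
        using hK[of x] h0[of x] by (cases "U x \<le> k + m") (simp_all add: a_def)
      then show "AE x in lborel. norm (a x) \<le> norm (indicator (ball x0 R) x * norm (H x) powr p x)" by simp
    qed simp
    \<comment> \<open>Where the gradient vanishes both sides are 0, because
      \<open>0 powr a = 0\<close> for every a, negative exponents included. This agrees with the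
      convention for the field |H|^(p-2) H.\<close>
    have hp1: "norm (H x) powr (p x - 2) * \<bar>H x \<bullet> grad \<eta> x\<bar> \<le> L * norm (H x) powr (p x - 1)" for x
    proof (cases "H x = 0")
      case False
      have "\<bar>H x \<bullet> grad \<eta> x\<bar> \<le> norm (H x) * norm (grad \<eta> x)" by (rule Cauchy_Schwarz_ineq2)
      also have "\<dots> \<le> norm (H x) * L" by (intro mult_left_mono L) simp
      finally have "norm (H x) powr (p x - 2) * \<bar>H x \<bullet> grad \<eta> x\<bar> \<le> norm (H x) powr (p x - 2) * (norm (H x) * L)"
        by (intro mult_left_mono) auto
      also have "norm (H x) powr (p x - 2) * (norm (H x) * L) = L * (norm (H x) powr (p x - 2) * norm (H x) powr 1)"
        using False by simp
      also have "norm (H x) powr (p x - 2) * norm (H x) powr 1 = norm (H x) powr (p x - 1)"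
        using powr_add[of "norm (H x)" "p x - 2" 1] by simp
      finally show ?thesis .
    qed simp
    have bb: "\<bar>b x\<bar> \<le> (real s * \<eta> x ^ (s - 1) * L * trunc k m (U x)) * norm (H x) powr (p x - 1)" for x
    proof -
      have "\<bar>b x\<bar> = (real s * \<eta> x ^ (s - 1) * trunc k m (U x)) * (norm (H x) powr (p x - 2) * \<bar>H x \<bullet> grad \<eta> x\<bar>)"
        using e[of x] trunc_le(1)[OF m] unfolding b_def gs by (simp add: abs_mult)
      also have "\<dots> \<le> (real s * \<eta> x ^ (s - 1) * trunc k m (U x)) * (L * norm (H x) powr (p x - 1))"
        using e[of x] trunc_le(1)[OF m] by (intro mult_left_mono hp1) auto
      finally show ?thesis by (simp add: mult_ac)
    qed
    have b0: "b x = 0" if "x \<notin> K" for x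
      using grad_test_0(2)[OF Ks that] by (simp add: b_def)
    have ib: "integrable lborel b"
    \<comment> \<open>The cap m bounds the truncation, and |H|^(p-1) \<le> 1 + |H|^p is integrable
      on the ball. Without the cap the cross term would not be known to be integrable at this
      point.\<close>
    proof (rule Bochner_Integration.integrable_bound[where f="\<lambda>x. (real s * L * m) * (indicator (ball x0 R) x + indicator (ball x0 R) x * norm (H x) powr p x)"])
      show "AE x in lborel. norm (b x) \<le> norm ((real s * L * m) * (indicator (ball x0 R) x + indicator (ball x0 R) x * norm (H x) powr p x))"
      proof (rule AE_I2)
        fix x
        show "norm (b x) \<le> norm ((real s * L * m) * (indicator (ball x0 R) x + indicator (ball x0 R) x * norm (H x) powr p x))"
        proof (cases "x \<in> K")
          case True
          then have x: "x \<in> ball x0 R" using K by auto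
          have "norm (b x) \<le> (real s * \<eta> x ^ (s - 1) * L * trunc k m (U x)) * norm (H x) powr (p x - 1)"
            using bb[of x] by simp
          also have "\<dots> \<le> (real s * 1 * L * m) * (1 + norm (H x) powr p x)"
            using e[of x] L0 m p[OF x] q trunc_le[OF m]
            by (intro mult_mono powr_mono_le_add) (auto simp: power_le_one)
          finally show ?thesis using x L0 m by (simp add: abs_mult)
        next
          case False then show ?thesis by (simp add: b0)
        qed
      qed
      have "integrable lborel (indicator (ball x0 R) :: 'a \<Rightarrow> real)"
        using emeasure_bounded_finite[OF bounded_ball, of x0 R] by (intro integrable_real_indicator) auto
      then show "integrable lborel (\<lambda>x. (real s * L * m) * (indicator (ball x0 R) x + indicator (ball x0 R) x * norm (H x) powr p x))"
        using iH by auto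
    qed simp
    have "(\<integral>x. a x + b x \<partial>lborel) = - (\<integral>x. c x \<partial>lborel)"
    proof -
      have hh: "norm (H x) powr (p x - 2) * (H x \<bullet> H x) = norm (H x) powr p x" for x
      proof (cases "H x = 0")
        case False
        have "H x \<bullet> H x = norm (H x) powr 2" using False by (simp add: dot_square_norm powr_numeral)
        then show ?thesis using powr_add[of "norm (H x)" "p x - 2" 2] by simp
      qed simp
      have "(norm (H x) powr (p x - 2)) *\<^sub>R H x \<bullet>
            (\<eta> x ^ s *\<^sub>R (indicator {x. k < U x \<and> U x \<le> k + m} x *\<^sub>R H x) + trunc k m (U x) *\<^sub>R grad (\<lambda>x. \<eta> x ^ s) x)
          = a x + b x" for x
      proof -
        have "(norm (H x) powr (p x - 2)) *\<^sub>R H x \<bullet> (\<eta> x ^ s *\<^sub>R (indicator {x. k < U x \<and> U x \<le> k + m} x *\<^sub>R H x)) =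
           \<eta> x ^ s * indicator {x. k < U x \<and> U x \<le> k + m} x * (norm (H x) powr (p x - 2) * (H x \<bullet> H x))" by simp
        also have "\<dots> = a x" unfolding hh a_def h_def by (auto simp: indicator_def)
        finally show ?thesis by (simp add: inner_add_right b_def)
      qed
      then show ?thesis
        using eqn[OF test_functions_mono[OF Ks K(1)] k m] unfolding c_def by simp
    qed
    then have ea: "(\<integral>x. a x \<partial>lborel) = - (\<integral>x. b x \<partial>lborel) - (\<integral>x. c x \<partial>lborel)"
      using ia ib by simp
    have "(\<integral>\<^sup>+x. ennreal (a x) \<partial>lborel) = ennreal (\<integral>x. a x \<partial>lborel)"
    proof (rule nn_integral_eq_integral[OF ia])
      show "AE x in lborel. 0 \<le> a x" using h0 by (simp add: a_def)
    qed
    also have "\<dots> \<le> ennreal (norm (\<integral>x. b x \<partial>lborel)) + ennreal (norm (\<integral>x. c x \<partial>lborel))"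
      unfolding ea by (simp flip: ennreal_plus)
    also have "\<dots> \<le> (\<integral>\<^sup>+x. ennreal (norm (b x)) \<partial>lborel) + (\<integral>\<^sup>+x. ennreal (norm (c x)) \<partial>lborel)"
    proof (intro add_mono integral_norm_bound_ennreal[OF ib])
      show "ennreal (norm (\<integral>x. c x \<partial>lborel)) \<le> (\<integral>\<^sup>+x. ennreal (norm (c x)) \<partial>lborel)"
      \<comment> \<open>If \<open>c\<close> is not integrable, its Bochner integral is 0 by
        convention and the bound is trivial.\<close>
      proof (cases "integrable lborel c")
        case True
        then show ?thesis by (rule integral_norm_bound_ennreal)
      qed (simp add: not_integrable_integral_eq)
    qed
    also have "(\<integral>\<^sup>+x. ennreal (norm (c x)) \<partial>lborel) \<le> Z"
      unfolding Z_def
    proof (intro nn_integral_mono ennreal_leI)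
      fix x
      show "norm (c x) \<le> indicator K x * (\<bar>f x\<bar> * max (U x - k) 0)"
      proof (cases "x \<in> K")
        case True
        have "\<eta> x ^ s * trunc k m (U x) \<le> 1 * max (U x - k) 0"
          using e1[of x] trunc_le[OF m] by (intro mult_mono) auto
        then show ?thesis using True e1[of x] trunc_le(1)[OF m]
          by (auto simp: c_def abs_mult intro!: mult_left_mono)
      next
        case False
        then show ?thesis using grad_test_0(1)[OF Ks False] by (simp add: c_def)
      qed
    qed
    also have "(\<integral>\<^sup>+x. ennreal (norm (b x)) \<partial>lborel) \<le> (\<integral>\<^sup>+x. ennreal (1/2) * ennreal (h x) + ennreal (indicator K x * (2 * real s * L * max (U x - k) 0) powr p x) \<partial>lborel)"
    proof (rule nn_integral_mono)
      fix x
      have "norm (b x) \<le> 1/2 * h x + indicator K x * (2 * real s * L * max (U x - k) 0) powr p x"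
      proof (cases "x \<in> K \<and> U x > k")
        case True
        then have x: "x \<in> ball x0 R" using K by auto
        have "norm (b x) \<le> (real s * \<eta> x ^ (s - 1) * L * max (U x - k) 0) * norm (H x) powr (p x - 1)"
        proof -
          have "(real s * \<eta> x ^ (s - 1) * L) * trunc k m (U x) \<le> (real s * \<eta> x ^ (s - 1) * L) * max (U x - k) 0"
            using e[of x] L0 trunc_le[OF m] by (intro mult_left_mono) auto
          from mult_right_mono[OF this, of "norm (H x) powr (p x - 1)"] show ?thesis
            using bb[of x] by simp
        qed
        also have "\<dots> \<le> 1/2 * (\<eta> x ^ s * norm (H x) powr p x) + (2 * real s * L * max (U x - k) 0) powr p x"
          using e[of x] L0 p[OF x] q s by (intro cross_term_le) auto
        finally show ?thesis using True by (simp add: h_def)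
      next
        case False
        then have "b x = 0" using b0[of x] m by (auto simp: b_def trunc_def)
        then show ?thesis using h0[of x] by simp
      qed
      then have "ennreal (norm (b x)) \<le> ennreal (1/2 * h x + indicator K x * (2 * real s * L * max (U x - k) 0) powr p x)"
        by (rule ennreal_leI)
      also have "\<dots> = ennreal (1/2 * h x) + ennreal (indicator K x * (2 * real s * L * max (U x - k) 0) powr p x)"
        by (rule ennreal_plus) (use h0[of x] in auto)
      also have "ennreal (1/2 * h x) = ennreal (1/2) * ennreal (h x)" by (rule ennreal_mult') simp
      finally show "ennreal (norm (b x)) \<le> ennreal (1/2) * ennreal (h x) + ennreal (indicator K x * (2 * real s * L * max (U x - k) 0) powr p x)" .
    qed
    also have "\<dots> = ennreal (1/2) * N + X"
      unfolding N_def X_def by (subst nn_integral_add) (auto simp: nn_integral_cmult)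
    finally show ?thesis by (simp add: a_def add.assoc)
  qed
  have "(\<lambda>j. \<integral>\<^sup>+x. ennreal (h x * indicator {x. U x \<le> k + real j} x) \<partial>lborel) \<longlonglongrightarrow> (\<integral>\<^sup>+x. ennreal (h x) \<partial>lborel)"
  proof (rule nn_integral_LIMSEQ)
    show "incseq (\<lambda>j x. ennreal (h x * indicator {x. U x \<le> k + real j} x))"
      using h0 by (auto simp: incseq_def le_fun_def indicator_def intro!: ennreal_leI)
    show "(\<lambda>j. ennreal (h x * indicator {x. U x \<le> k + real j} x)) \<longlonglongrightarrow> ennreal (h x)" for x
    proof (rule tendsto_eventually)
      obtain j :: nat where j: "U x - k < real j" using reals_Archimedean2 by blast
      have "ennreal (h x * indicator {x. U x \<le> k + real i} x) = ennreal (h x)" if "i \<ge> j" for i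
      proof -
        have "real j \<le> real i" using that by simp
        with j have "U x \<le> k + real i" by linarith
        then show ?thesis by simp
      qed
      then show "eventually (\<lambda>j. ennreal (h x * indicator {x. U x \<le> k + real j} x) = ennreal (h x)) sequentially"
        unfolding eventually_sequentially by blast
    qed
  qed measurable
  then have NN: "N \<le> ennreal (1/2) * N + (X + Z)"
    unfolding N_def[symmetric] by (rule LIMSEQ_le_const2) (use main in auto)
  \<comment> \<open>Since \<open>N\<close> is finite, by the integrability of |H|^p on the ball,
    half of it can be moved to the left. An infinite right-hand side leaves nothing to
    prove.\<close>
  obtain n where n: "N = ennreal n" "n \<ge> 0" using Nfin by (cases N) auto
  have "N \<le> 2 * (X + Z)"
  proof (cases "X + Z")
    case (real y)
    have "ennreal (1/2 * n + y) = ennreal (1/2 * n) + ennreal y" by (rule ennreal_plus) (use n real in auto)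
    moreover have "ennreal (1/2 * n) = ennreal (1/2) * ennreal n" by (rule ennreal_mult') simp
    ultimately have "ennreal n \<le> ennreal (1/2 * n + y)" using NN n(1) real(2) by (simp only:)
    then have "n \<le> 1/2 * n + y" using n real by (subst (asm) ennreal_le_iff) auto
    then have "ennreal n \<le> ennreal (2 * y)" by (intro ennreal_leI) linarith
    then show ?thesis using n real by (simp add: ennreal_mult')
  next
    case top
    show ?thesis unfolding top by (simp add: ennreal_mult_top)
  qed
  then show ?thesis by (simp add: N_def h_def X_def Z_def)
qed

end

section \<open>De Giorgi iteration\<close>

context local_solution
begin

lemma cball_borel [measurable]: "cball x0 r \<in> sets borel" by simp

text \<open>A single exponent for both terms on the right of the Caccioppoli inequality: P covers
  the powers p(x), and qf / (qf - 1), conjugate to qf, is what Young's inequality leaves of the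
  product with f. Both alternatives lie below the threshold of the gain, the first by the assumption
  on P, the second because qf > n/q.\<close>

definition tau :: real where "tau = max P (qf / (qf - 1))"

text \<open>The weak-type exponent of \<open>superlevel_bound_powr\<close> for r =
  \<open>tau\<close>. The strict inequality tau < sigma is what lets the iteration return to the
  exponent it started from.\<close>

definition sigma :: real where "sigma = q + tau * q / real DIM('a)"

definition excess :: "real \<Rightarrow> real \<Rightarrow> ennreal" where
  "excess \<rho> k = (\<integral>\<^sup>+x. ennreal (indicator (cball x0 \<rho>) x * max (U x - k) 0 powr tau) \<partial>lborel)"

lemma tau_bounds: "P \<le> tau" "qf / (qf - 1) \<le> tau" "1 \<le> tau" "q \<le> tau" "tau * (1 - q / real DIM('a)) < q" "tau < sigma"
proof -
  let ?n = "real DIM('a)"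
  show 1: "P \<le> tau" "qf / (qf - 1) \<le> tau" by (simp_all add: tau_def)
  show "1 \<le> tau" "q \<le> tau" using 1 q_le_P q by linarith+
  have q': "qf / (qf - 1) > 0" using qf by simp
  have "1 / qf < q / ?n" using qf q by (simp add: field_simps)
  then have "qf / (qf - 1) * (1 - q / ?n) < qf / (qf - 1) * (1 - 1 / qf)"
    using q' by (intro mult_strict_left_mono) auto
  also have "\<dots> = 1" using qf by (simp add: field_simps)
  finally have "qf / (qf - 1) * (1 - q / ?n) < q" using q by linarith
  then show 2: "tau * (1 - q / ?n) < q" using P by (auto simp: tau_def max_def)
  have "tau * (1 - q / ?n) = tau - tau * q / ?n" by (simp add: right_diff_distrib)
  with 2 show "tau < sigma" by (simp add: sigma_def)
qed

text \<open>The level is raised twice by d: the energy estimate is applied at k + d, and the gain at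
  threshold d to the cut-off function of (U - k - d)^+. The powers of 1/d add up as P from the
  cutoff gradient, \<open>tau\<close> from Chebyshev's inequality and \<open>sigma - tau\<close>
  from the gain. The powers of y are 1 - 1/qf from the energy, where the f term is the worst, and
  q/n from the gain. Tying the radii to d leaves one small parameter.\<close>

lemma excess_step:
  "\<exists>C>0. \<forall>k d \<rho> \<rho>' y. 0 \<le> k \<longrightarrow> 0 < d \<longrightarrow> d \<le> 1 \<longrightarrow> 0 < \<rho>' \<longrightarrow> \<rho> < R \<longrightarrow> \<rho> - \<rho>' = R * d / 2 \<longrightarrow> 0 < y \<longrightarrow> y \<le> 1 \<longrightarrow>
     excess \<rho> k \<le> ennreal y \<longrightarrow>
     excess \<rho>' (k + 2 * d) \<le> ennreal (C * d powr (- (P + sigma)) * y powr (1 - 1 / qf + q / real DIM('a)))"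
proof -
  let ?n = "real DIM('a)"
  define \<alpha> where "\<alpha> = 1 - 1 / qf"
  have \<alpha>: "0 < \<alpha>" "\<alpha> \<le> 1" using qf by (simp_all add: \<alpha>_def)
  obtain L0 where L0: "L0 > 0" "\<And>(x0::'a) r R. 0 < r \<Longrightarrow> r < R \<Longrightarrow>
     (\<exists>\<eta>. \<eta> \<in> test_functions (cball x0 R) \<and> (\<forall>x. 0 \<le> \<eta> x \<and> \<eta> x \<le> 1) \<and>
        (\<forall>x\<in>cball x0 r. \<eta> x = 1) \<and> (\<forall>x. norm (grad \<eta> x) \<le> L0 / (R - r)))"
    using ball_cutoff[where 'a='a] by blast
  obtain s :: nat where "max P 2 < real s" using reals_Archimedean2 by blast
  then have s: "P \<le> real s" "2 \<le> s" by auto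
  then have s0: "s \<noteq> 0" by simp
  \<comment> \<open>The cutoff gradient is bounded by L0 / (R d / 2), so 2 s L is (4 s L0 / R) / d.
    The maximum with 1 gives c1 / d \<ge> 1, hence every power of it with exponent at most P is
    dominated by the power P.\<close>
  define c1 where "c1 = max 1 (4 * real s * L0 / R)"
  have c1: "c1 \<ge> 1" "4 * real s * L0 / R \<le> c1" by (simp_all add: c1_def)
  obtain C where C: "C > 0" "\<And>(w::'a \<Rightarrow> real) H D Y m. weak_grad w H \<Longrightarrow> (\<forall>x. w x \<ge> 0) \<Longrightarrow> m > 0 \<Longrightarrow> D \<ge> 0 \<Longrightarrow> Y > 0 \<Longrightarrow>
     (\<integral>\<^sup>+x. ennreal (norm (H x) powr q) \<partial>lborel) \<le> ennreal D \<Longrightarrow>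
     (\<integral>\<^sup>+x. ennreal (w x powr tau) \<partial>lborel) \<le> ennreal Y \<Longrightarrow>
     (\<integral>\<^sup>+x. indicator {x. w x > m} x * ennreal (w x powr tau) \<partial>lborel) \<le> ennreal (C * D * Y powr (q / ?n) * m powr (tau - sigma))"
    using integrability_gain[where 'a='a, OF q tau_bounds(3) order_trans[OF zero_le_one tau_bounds(3)] tau_bounds(6)[unfolded sigma_def]]
    unfolding sigma_def by blast
  \<comment> \<open>The summands come from the energy, from the measure of the superlevel set (the
    single 1) and from the cutoff gradient (the last c1^P). The factor 2^q comes from splitting the
    gradient of the product.\<close>
  define C2 where "C2 = 2 powr q * (2 * (c1 powr P + F + 1) + 1 + c1 powr P)"
  have C2: "C2 > 0" using F by (simp add: C2_def add_pos_nonneg add_nonneg_pos)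
  show ?thesis
  proof (intro exI[of _ "C * C2"] conjI allI impI)
    show "0 < C * C2" using C(1) C2 by simp
    fix k d \<rho> \<rho>' y :: real
    assume k: "0 \<le> k" and d: "0 < d" "d \<le> 1" and \<rho>: "0 < \<rho>'" "\<rho> < R" "\<rho> - \<rho>' = R * d / 2"
      and y: "0 < y" "y \<le> 1" and ex: "excess \<rho> k \<le> ennreal y"
    have rr: "\<rho>' < \<rho>" using \<rho>(3) R d by (smt (verit) divide_pos_pos mult_pos_pos)
    define K where "K = cball x0 \<rho>"
    have K: "K \<subseteq> ball x0 R" "K \<in> sets borel" using \<rho> by (auto simp: K_def)
    note [measurable] = K(2)
    define L where "L = L0 / (\<rho> - \<rho>')"
    obtain \<eta> where \<eta>: "\<eta> \<in> test_functions K" "\<And>x. 0 \<le> \<eta> x \<and> \<eta> x \<le> 1" "\<And>x. x \<in> cball x0 \<rho>' \<Longrightarrow> \<eta> x = 1"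
      "\<And>x. norm (grad \<eta> x) \<le> L"
      using L0(2)[OF \<rho>(1) rr, of x0] unfolding K_def L_def by blast
    have [measurable]: "\<eta> \<in> borel_measurable borel" "grad \<eta> \<in> borel_measurable borel"
      using \<eta>(1) test_functions_borel grad_test_borel by blast+
    have L: "L \<ge> 0" "2 * real s * L \<le> c1 / d" "real s * L \<le> c1 / d"
    proof -
      show l: "L \<ge> 0" using L0(1) rr by (simp add: L_def)
      have "2 * real s * L = (4 * real s * L0 / R) / d" using R d unfolding L_def \<rho>(3) by simp
      also have "\<dots> \<le> c1 / d" using c1(2) d by (intro divide_right_mono) auto
      finally show l2: "2 * real s * L \<le> c1 / d" .
      have "real s * L \<ge> 0" using l by simp
      with l2 show "real s * L \<le> c1 / d" by linarith
    qed
    define v where "v x = max (U x - (k + d)) 0" for x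
    define g where "g x = max (U x - k) 0" for x
    have [measurable]: "v \<in> borel_measurable borel" "g \<in> borel_measurable borel"
      unfolding v_def[abs_def] g_def[abs_def] by measurable
    have vg: "0 \<le> v x" "v x \<le> g x" for x using d by (auto simp: v_def g_def)
    \<comment> \<open>Where U > k + d one has g > d, so g/d \<ge> 1. As d \<le> 1, this single
      constant turns every power of v up to \<open>tau\<close>, and also the indicator of the
      superlevel set, into the \<open>tau\<close>-th power of g.\<close>
    define B where "B = d powr (- tau)"
    have B: "B > 0" using d by (simp add: B_def)
    have vB: "v x powr a \<le> B * g x powr tau" if a: "0 < a" "a \<le> tau" for x a
    proof (cases "v x = 0")
      case False
      then have gd: "g x \<ge> d" using vg(1)[of x] k by (auto simp: v_def g_def max_def split: if_splits)
      have "v x powr a \<le> g x powr a" using vg a by (intro powr_mono2) auto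
      also have "\<dots> = g x powr (a - tau) * g x powr tau" by (simp flip: powr_add)
      also have "\<dots> \<le> d powr (a - tau) * g x powr tau"
        using gd d a by (intro mult_right_mono powr_mono2') auto
      also have "\<dots> \<le> B * g x powr tau"
        unfolding B_def using d a by (intro mult_right_mono powr_mono') auto
      finally show ?thesis .
    qed (use B in simp)
    have iB: "indicator {x. U x > k + d} x \<le> B * g x powr tau" for x
    proof (cases "U x > k + d")
      case True
      then have "d powr tau \<le> g x powr tau" using d tau_bounds(3) by (intro powr_mono2) (auto simp: g_def)
      then have "B * d powr tau \<le> B * g x powr tau" using B by (intro mult_left_mono) auto
      moreover have "B * d powr tau = 1" using d by (simp add: B_def flip: powr_add)
      ultimately show ?thesis using True by simp
    qed (use B in simp)
    have G: "(\<integral>\<^sup>+x. ennreal (indicator K x * g x powr tau) \<partial>lborel) \<le> ennreal y"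
      using ex by (simp add: excess_def K_def g_def)
    have gm: "(\<lambda>x. indicator K x * g x powr tau) \<in> borel_measurable borel" by measurable
    define M where "M = d powr (- (P + tau))"
    have P1: "P \<ge> 1" using q_le_P q by linarith
    have M: "M \<ge> 1" "(c1 / d) powr P * B = c1 powr P * M" "B \<le> M"
    proof -
      have "d powr 0 \<le> M" unfolding M_def using d P1 tau_bounds(3) by (intro powr_mono') auto
      then show "M \<ge> 1" using d by simp
      show "(c1 / d) powr P * B = c1 powr P * M"
      proof -
        have "(c1 / d) powr P = c1 powr P * d powr (- P)" using c1 d by (simp add: powr_divide powr_minus_divide)
        moreover have "d powr (- P) * B = M" by (simp add: B_def M_def flip: powr_add)
        ultimately show ?thesis by (simp add: mult.assoc)
      qed
      show "B \<le> M" unfolding B_def M_def using d P1 by (intro powr_mono') auto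
    qed
    \<comment> \<open>As y \<le> 1, terms linear in y are dominated by the power \<alpha>, which the
      f term forces anyway. All bounds below are brought to this common power.\<close>
    have ya: "y \<le> y powr \<alpha>" using powr_mono'[of \<alpha> 1 y] \<alpha> y by simp
    have ya0: "y powr \<alpha> > 0" using y by simp
    have cP: "(a * v x) powr e \<le> (c1 / d) powr P * (B * g x powr tau)"
      if a: "0 \<le> a" "a \<le> c1 / d" and e: "0 < e" "e \<le> P" for a e x
    proof -
      have "c1 / d \<ge> 1" using c1 d by (simp add: field_simps)
      have "(a * v x) powr e = a powr e * v x powr e" using a vg by (simp add: powr_mult)
      also have "\<dots> \<le> (c1 / d) powr e * (B * g x powr tau)"
        using a e tau_bounds(1) by (intro mult_mono vB powr_mono2) auto
      also have "\<dots> \<le> (c1 / d) powr P * (B * g x powr tau)"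
        using \<open>c1 / d \<ge> 1\<close> e B by (intro mult_right_mono powr_mono) auto
      finally show ?thesis .
    qed
    have X1: "(\<integral>\<^sup>+x. ennreal (indicator K x * (2 * real s * L * v x) powr p x) \<partial>lborel) \<le> ennreal (c1 powr P * M * y)"
    proof -
      have "(\<integral>\<^sup>+x. ennreal (indicator K x * (2 * real s * L * v x) powr p x) \<partial>lborel) \<le> ennreal ((c1 / d) powr P * B * y)"
      proof (rule nn_integral_bound_cmult[OF _ _ G gm])
        fix x
        show "indicator K x * (2 * real s * L * v x) powr p x \<le> (c1 / d) powr P * B * (indicator K x * g x powr tau)"
        proof (cases "x \<in> K")
          case True
          then have "q \<le> p x" "p x \<le> P" using p K by auto
          then show ?thesis using True cP[of "2 * real s * L" "p x" x] L q by (simp add: mult.assoc)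
        qed simp
      qed (use B in simp)
      then show ?thesis by (simp add: M(2))
    qed
    \<comment> \<open>This weight balances Young's inequality: \<theta>^qf multiplies the fixed
      quantity F, and \<theta> to minus the conjugate exponent multiplies y. For this choice both
      become y^\<alpha>.\<close>
    define \<theta> where "\<theta> = y powr (\<alpha> / qf)"
    have \<theta>: "\<theta> > 0" "\<theta> powr qf = y powr \<alpha>" "\<theta> powr (- (qf / (qf - 1))) * y = y powr \<alpha>"
    proof -
      show "\<theta> > 0" "\<theta> powr qf = y powr \<alpha>" using y qf by (simp_all add: \<theta>_def powr_powr)
      have "\<alpha> / qf * (- (qf / (qf - 1))) + 1 = \<alpha>" using qf by (simp add: \<alpha>_def field_simps)
      then have "y powr \<alpha> = y powr (\<alpha> / qf * (- (qf / (qf - 1)))) * y powr 1" by (metis powr_add)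
      then show "\<theta> powr (- (qf / (qf - 1))) * y = y powr \<alpha>" using y by (simp add: \<theta>_def powr_powr)
    qed
    have X2: "(\<integral>\<^sup>+x. ennreal (indicator K x * (\<bar>f x\<bar> * v x)) \<partial>lborel) \<le> ennreal (y powr \<alpha> * F + y powr \<alpha> * B)"
    proof (rule nn_integral_bound_add)
      show "indicator K x * (\<bar>f x\<bar> * v x) \<le>
        y powr \<alpha> * (indicator K x * \<bar>f x\<bar> powr qf) + (\<theta> powr (- (qf / (qf - 1))) * B) * (indicator K x * g x powr tau)" for x
      proof (cases "x \<in> K")
        case True
        have "\<bar>f x\<bar> * v x = (\<theta> * \<bar>f x\<bar>) * (v x / \<theta>)" using \<theta> by simp
        also have "\<dots> \<le> (\<theta> * \<bar>f x\<bar>) powr qf + (v x / \<theta>) powr (qf / (qf - 1))"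
          using \<theta> vg qf by (intro young_le) auto
        also have "(\<theta> * \<bar>f x\<bar>) powr qf = y powr \<alpha> * \<bar>f x\<bar> powr qf" using \<theta> by (simp add: powr_mult)
        also have "(v x / \<theta>) powr (qf / (qf - 1)) = \<theta> powr (- (qf / (qf - 1))) * v x powr (qf / (qf - 1))"
          using \<theta>(1) vg(1)[of x] by (simp add: powr_divide powr_minus_divide)
        also have "\<dots> \<le> \<theta> powr (- (qf / (qf - 1))) * (B * g x powr tau)"
          using qf tau_bounds(2) by (intro mult_left_mono vB) auto
        finally show ?thesis using True by (simp add: mult.assoc)
      qed simp
      show "(\<integral>\<^sup>+x. ennreal (y powr \<alpha> * (indicator K x * \<bar>f x\<bar> powr qf)) \<partial>lborel) \<le> ennreal (y powr \<alpha> * F)"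
      proof (rule nn_integral_bound_cmult[OF _ _ intf])
        show "y powr \<alpha> * (indicator K x * \<bar>f x\<bar> powr qf) \<le> y powr \<alpha> * (indicator (ball x0 R) x * \<bar>f x\<bar> powr qf)" for x
          using K(1) by (intro mult_left_mono mult_right_mono) (auto simp: indicator_def)
      qed simp_all
      have "(\<integral>\<^sup>+x. ennreal (\<theta> powr (- (qf / (qf - 1))) * B * (indicator K x * g x powr tau)) \<partial>lborel)
         \<le> ennreal (\<theta> powr (- (qf / (qf - 1))) * B * y)"
        by (rule nn_integral_bound_cmult[OF _ _ G gm]) (use B in auto)
      also have "\<theta> powr (- (qf / (qf - 1))) * B * y = y powr \<alpha> * B" using \<theta>(3) by (simp add: mult_ac)
      finally show "(\<integral>\<^sup>+x. ennreal (\<theta> powr (- (qf / (qf - 1))) * B * (indicator K x * g x powr tau)) \<partial>lborel)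
         \<le> ennreal (y powr \<alpha> * B)" .
    qed (use F B in auto)
    define h where "h x = \<eta> x ^ s * (indicator {x. U x > k + d} x * norm (H x) powr p x)" for x
    have hm: "h \<in> borel_measurable borel" unfolding h_def[abs_def] by measurable
    define e0 where "e0 = 2 * (c1 powr P + F + 1) * M * y powr \<alpha>"
    have hb: "(\<integral>\<^sup>+x. ennreal (h x) \<partial>lborel) \<le> ennreal e0"
    proof -
      have "(\<integral>\<^sup>+x. ennreal (h x) \<partial>lborel) \<le>
        2 * ((\<integral>\<^sup>+x. ennreal (indicator K x * (2 * real s * L * v x) powr p x) \<partial>lborel) +
          (\<integral>\<^sup>+x. ennreal (indicator K x * (\<bar>f x\<bar> * v x)) \<partial>lborel))"
        unfolding h_def v_def by (rule caccioppoli[OF \<eta>(1) K \<eta>(2) \<eta>(4) s]) (use k d in simp)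
      also have "\<dots> \<le> 2 * (ennreal (c1 powr P * M * y) + ennreal (y powr \<alpha> * F + y powr \<alpha> * B))"
        by (intro mult_left_mono add_mono X1 X2) simp
      also have "\<dots> = ennreal (2 * (c1 powr P * M * y + (y powr \<alpha> * F + y powr \<alpha> * B)))"
      proof -
        have two: "ennreal (2 * (a + b)) = 2 * (ennreal a + ennreal b)" if "a \<ge> 0" "b \<ge> 0" for a b
        proof -
          have "ennreal (2 * (a + b)) = ennreal 2 * ennreal (a + b)" by (rule ennreal_mult') simp
          then show ?thesis using that by (simp only: ennreal_plus ennreal_numeral)
        qed
        show ?thesis by (rule two[symmetric]) (use M y F B in auto)
      qed
      also have "\<dots> \<le> ennreal e0"
      proof (rule ennreal_leI)
        have "c1 powr P * M * y \<le> c1 powr P * M * y powr \<alpha>" using ya M by (intro mult_left_mono) auto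
        moreover have "y powr \<alpha> * F * 1 \<le> y powr \<alpha> * F * M" using M F by (intro mult_left_mono) auto
        moreover have "y powr \<alpha> * B \<le> y powr \<alpha> * M" using M by (intro mult_left_mono) auto
        ultimately show "2 * (c1 powr P * M * y + (y powr \<alpha> * F + y powr \<alpha> * B)) \<le> e0"
          unfolding e0_def by (simp add: algebra_simps)
      qed
      finally show ?thesis .
    qed
    define w where "w x = \<eta> x ^ s * v x" for x
    define W where "W x = \<eta> x ^ s *\<^sub>R (indicator {x. U x > k + d} x *\<^sub>R H x) + v x *\<^sub>R grad (\<lambda>x. \<eta> x ^ s) x" for x
    have Ks: "(\<lambda>x. \<eta> x ^ s) \<in> test_functions K" by (rule test_functions_power[OF \<eta>(1) s0])
    have wW: "weak_grad w W"
      unfolding w_def[abs_def] W_def[abs_def] v_def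
      using k d by (intro weak_grad_mult_test weak_grad_pos_part U test_functions_mono[OF Ks]) auto
    have e1: "0 \<le> \<eta> x ^ s" "\<eta> x ^ s \<le> 1" for x using \<eta>(2)[of x] by (simp_all add: power_le_one)
    have w0: "0 \<le> w x" for x using e1 vg by (simp add: w_def)
    define DD where "DD = C2 * M * y powr \<alpha>"
    have WD: "(\<integral>\<^sup>+x. ennreal (norm (W x) powr q) \<partial>lborel) \<le> ennreal DD"
    proof -
      define b where "b = (1 + (c1 / d) powr P) * B"
      have b: "b \<ge> 0" using B by (simp add: b_def)
      have "(\<integral>\<^sup>+x. ennreal (h x + b * (indicator K x * g x powr tau)) \<partial>lborel) \<le> ennreal (e0 + b * y)"
      proof (rule nn_integral_bound_add[OF order_refl _ _ hb])
        show "(\<integral>\<^sup>+x. ennreal (b * (indicator K x * g x powr tau)) \<partial>lborel) \<le> ennreal (b * y)"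
          by (rule nn_integral_bound_cmult[OF _ _ G gm]) (use b in auto)
        show "0 \<le> e0" using F M by (simp add: e0_def)
      qed (use b y e1 hm in \<open>auto simp: h_def\<close>)
      then have "(\<integral>\<^sup>+x. ennreal (norm (W x) powr q) \<partial>lborel) \<le> ennreal (2 powr q * (e0 + b * y))"
      proof (rule nn_integral_bound_cmult[rotated 2])
        fix x
        show "norm (W x) powr q \<le> 2 powr q * (h x + b * (indicator K x * g x powr tau))"
        proof (cases "x \<in> K")
          case False
          then have "W x = 0" using grad_test_0[OF Ks False] by (simp add: W_def)
          then show ?thesis using False e1 by (simp add: h_def)
        next
          case True
          then have px: "q \<le> p x" "p x \<le> P" using p K by auto
          define a1 where "a1 = \<eta> x ^ s * (indicator {x. U x > k + d} x * norm (H x))"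
          have "norm (v x *\<^sub>R grad (\<lambda>x. \<eta> x ^ s) x) = v x * (real s * \<eta> x ^ (s - 1) * norm (grad \<eta> x))"
            unfolding grad_test_power[OF \<eta>(1)] using vg \<eta>(2)[of x] by (simp add: abs_mult)
          also have "\<dots> \<le> v x * (real s * 1 * L)"
            using vg \<eta>(2)[of x] \<eta>(4)[of x] by (intro mult_left_mono mult_mono) (auto simp: power_le_one)
          finally have "norm (v x *\<^sub>R grad (\<lambda>x. \<eta> x ^ s) x) \<le> real s * L * v x" by (simp add: mult_ac)
          moreover have "norm (\<eta> x ^ s *\<^sub>R (indicator {x. U x > k + d} x *\<^sub>R H x)) = a1"
            using e1[of x] by (simp add: a1_def)
          ultimately have "norm (W x) \<le> a1 + real s * L * v x"
            unfolding W_def using norm_triangle_ineq[of "\<eta> x ^ s *\<^sub>R (indicator {x. U x > k + d} x *\<^sub>R H x)"] by (smt (verit))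
          then have "norm (W x) powr q \<le> (a1 + real s * L * v x) powr q" using q by (intro powr_mono2) auto
          also have "\<dots> \<le> 2 powr q * (a1 powr q + (real s * L * v x) powr q)"
            using e1[of x] L vg q by (intro powr_add_le) (auto simp: a1_def)
          also have "\<dots> \<le> 2 powr q * (h x + b * (indicator K x * g x powr tau))"
          proof (intro mult_left_mono)
            \<comment> \<open>As \<eta>^s \<le> 1 and q \<ge> 1, the q-th power of \<eta>^s is at
              most \<eta>^s, the weight in the energy. The 1 from lowering the exponent p(x) to q
              occurs only where U > k + d and is paid by Chebyshev's inequality.\<close>
            have "a1 powr q \<le> h x + B * g x powr tau"
            proof (cases "U x > k + d")
              case U: True
              have "(\<eta> x ^ s) powr q \<le> \<eta> x ^ s"
                using powr_mono'[OF q, of "\<eta> x ^ s"] e1[of x] by simp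
              have "a1 powr q = (\<eta> x ^ s) powr q * norm (H x) powr q"
                using U e1[of x] by (simp add: a1_def powr_mult)
              also have "\<dots> \<le> \<eta> x ^ s * (1 + norm (H x) powr p x)"
                using \<open>(\<eta> x ^ s) powr q \<le> \<eta> x ^ s\<close> px q e1[of x] by (intro mult_mono powr_mono_le_add) auto
              also have "\<dots> \<le> h x + 1" using U e1[of x] by (simp add: h_def distrib_left)
              also have "1 \<le> B * g x powr tau" using iB[of x] U by simp
              finally show ?thesis by simp
            next
              case False
              then show ?thesis using B by (simp add: a1_def h_def)
            qed
            moreover have "(real s * L * v x) powr q \<le> (c1 / d) powr P * (B * g x powr tau)"
              using L q q_le_P by (intro cP) auto
            ultimately show "a1 powr q + (real s * L * v x) powr q \<le> h x + b * (indicator K x * g x powr tau)"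
              using True by (simp add: b_def algebra_simps)
          qed simp
          finally show ?thesis .
        qed
      qed (use hm in auto)
      also have "2 powr q * (e0 + b * y) \<le> DD"
      proof -
        have "b = B + c1 powr P * M" using M(2) by (simp add: b_def distrib_right)
        then have "b \<le> (1 + c1 powr P) * M" using M(3) by (simp add: distrib_right)
        then have "b * y \<le> (1 + c1 powr P) * M * y powr \<alpha>" using ya b y M by (intro mult_mono) auto
        then have "e0 + b * y \<le> (2 * (c1 powr P + F + 1) + 1 + c1 powr P) * M * y powr \<alpha>"
          unfolding e0_def by (simp add: algebra_simps)
        then have "2 powr q * (e0 + b * y) \<le> 2 powr q * ((2 * (c1 powr P + F + 1) + 1 + c1 powr P) * M * y powr \<alpha>)"
          by (intro mult_left_mono) auto
        then show ?thesis by (simp add: DD_def C2_def mult.assoc)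
      qed
      finally show ?thesis by (simp add: ennreal_leI)
    qed
    have wY: "(\<integral>\<^sup>+x. ennreal (w x powr tau) \<partial>lborel) \<le> ennreal y"
    proof -
      have "w x powr tau \<le> 1 * (indicator K x * g x powr tau)" for x
      proof (cases "x \<in> K")
        case True
        have "w x \<le> 1 * g x" unfolding w_def using e1[of x] vg[of x] by (intro mult_mono) auto
        then show ?thesis using True w0[of x] tau_bounds(3) by (auto intro!: powr_mono2)
      next
        case False
        then show ?thesis using grad_test_0(1)[OF Ks False] by (simp add: w_def)
      qed
      from nn_integral_bound_cmult[OF this _ G gm] show ?thesis by simp
    qed
    have "excess \<rho>' (k + 2 * d) \<le> (\<integral>\<^sup>+x. indicator {x. w x > d} x * ennreal (w x powr tau) \<partial>lborel)"
      unfolding excess_def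
    proof (rule nn_integral_mono)
      fix x
      show "ennreal (indicator (cball x0 \<rho>') x * max (U x - (k + 2 * d)) 0 powr tau) \<le> indicator {x. w x > d} x * ennreal (w x powr tau)"
      \<comment> \<open>On the inner ball the cutoff is 1, so U > k + 2 d says exactly that w = U -
        (k + d) exceeds d, and w also dominates U - (k + 2 d).\<close>
      proof (cases "x \<in> cball x0 \<rho>' \<and> U x > k + 2 * d")
        case True
        then have w: "w x = U x - (k + d)" using d \<eta>(3)[of x] by (simp add: w_def v_def)
        then have "max (U x - (k + 2 * d)) 0 powr tau \<le> w x powr tau" using True d tau_bounds(3) by (intro powr_mono2) auto
        then show ?thesis using True w d by (simp add: ennreal_leI)
      next
        case False
        then show ?thesis by (cases "x \<in> cball x0 \<rho>'") auto
      qed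
    qed
    also have "\<dots> \<le> ennreal (C * DD * y powr (q / ?n) * d powr (tau - sigma))"
      using w0 d y C2 M by (intro C(2)[OF wW] WD wY) (auto simp: DD_def)
    also have "C * DD * y powr (q / ?n) * d powr (tau - sigma) = C * C2 * d powr (- (P + sigma)) * y powr (1 - 1 / qf + q / ?n)"
    proof -
      have "M * d powr (tau - sigma) = d powr (- (P + sigma))" by (simp add: M_def flip: powr_add)
      moreover have "y powr \<alpha> * y powr (q / ?n) = y powr (1 - 1 / qf + q / ?n)" by (simp add: \<alpha>_def flip: powr_add)
      moreover have "C * DD * y powr (q / ?n) * d powr (tau - sigma) = C * C2 * (M * d powr (tau - sigma)) * (y powr \<alpha> * y powr (q / ?n))"
        by (simp only: DD_def mult_ac)
      ultimately show ?thesis by simp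
    qed
    finally show "excess \<rho>' (k + 2 * d) \<le> ennreal (C * C2 * d powr (- (P + sigma)) * y powr (1 - 1 / qf + q / ?n))" .
  qed
qed

text \<open>Initially only the integrability of |U|^p(x) and |H|^p(x) is known. Lowering p(x) to q
  puts the cut-off positive part and its gradient into L^q, from where the bootstrap climbs to
  \<open>tau\<close>.\<close>

lemma excess_finite: "excess (R / 2) 0 < \<infinity>"
proof -
  have "R / 2 > 0" "R / 2 < 3 * R / 4" using R by auto
  then obtain \<eta> L where \<eta>: "\<eta> \<in> test_functions (cball x0 (3 * R / 4))" "\<And>x. 0 \<le> \<eta> x \<and> \<eta> x \<le> 1"
    "\<And>x. x \<in> cball x0 (R / 2) \<Longrightarrow> \<eta> x = 1" "\<And>x. norm (grad \<eta> x) \<le> L"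
    using ball_cutoff[where 'a='a] by metis
  have L: "L \<ge> 0" using \<eta>(4)[of 0] norm_ge_zero[of "grad \<eta> 0"] by linarith
  define K where "K = cball x0 (3 * R / 4)"
  have K: "K \<subseteq> ball x0 R" using R by (auto simp: K_def)
  have [measurable]: "\<eta> \<in> borel_measurable borel" "grad \<eta> \<in> borel_measurable borel"
    using \<eta>(1) test_functions_borel grad_test_borel by blast+
  \<comment> \<open>The term \<open>- 0\<close> keeps w in the form produced by
    \<open>weak_grad_pos_part\<close> and occurring in \<open>excess\<close> at k = 0.\<close>
  define w where "w x = \<eta> x * max (U x - 0) 0" for x
  define W where "W x = \<eta> x *\<^sub>R (indicator {x. U x > 0} x *\<^sub>R H x) + max (U x - 0) 0 *\<^sub>R grad \<eta> x" for x
  have wW: "weak_grad w W"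
    unfolding w_def[abs_def] W_def[abs_def]
    by (intro weak_grad_mult_test weak_grad_pos_part U test_functions_mono[OF \<eta>(1)]) auto
  obtain V where V: "V \<ge> 0" "(\<integral>\<^sup>+x. ennreal (indicator (ball x0 R) x) \<partial>lborel) \<le> ennreal V"
  proof -
    have "emeasure lborel (ball x0 R) < \<infinity>" by (rule emeasure_bounded_finite[OF bounded_ball])
    moreover have "(\<integral>\<^sup>+x. ennreal (indicator (ball x0 R) x) \<partial>lborel) = emeasure lborel (ball x0 R)"
      by (simp add: ennreal_indicator)
    ultimately show ?thesis using that by (cases "emeasure lborel (ball x0 R)") auto
  qed
  obtain a where a: "a \<ge> 0" "(\<integral>\<^sup>+x. ennreal (indicator (ball x0 R) x * \<bar>U x\<bar> powr p x) \<partial>lborel) \<le> ennreal a"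
    using intU by (cases "\<integral>\<^sup>+x. ennreal (indicator (ball x0 R) x * \<bar>U x\<bar> powr p x) \<partial>lborel") auto
  obtain b where b: "b \<ge> 0" "(\<integral>\<^sup>+x. ennreal (indicator (ball x0 R) x * norm (H x) powr p x) \<partial>lborel) \<le> ennreal b"
    using intH by (cases "\<integral>\<^sup>+x. ennreal (indicator (ball x0 R) x * norm (H x) powr p x) \<partial>lborel") auto
  have Ub: "(\<integral>\<^sup>+x. ennreal (indicator (ball x0 R) x * (1 + \<bar>U x\<bar> powr p x)) \<partial>lborel) \<le> ennreal (V + a)"
    by (rule nn_integral_bound_add[OF _ _ _ V(2) a(2) V(1) a(1)]) (auto simp: distrib_left)
  have Hb: "(\<integral>\<^sup>+x. ennreal (indicator (ball x0 R) x * (1 + norm (H x) powr p x)) \<partial>lborel) \<le> ennreal (V + b)"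
    by (rule nn_integral_bound_add[OF _ _ _ V(2) b(2) V(1) b(1)]) (auto simp: distrib_left)
  have Uq: "max (U x - 0) 0 powr q \<le> 1 + \<bar>U x\<bar> powr p x" if "x \<in> ball x0 R" for x
  proof -
    have "max (U x - 0) 0 powr q \<le> \<bar>U x\<bar> powr q" using q by (intro powr_mono2) auto
    also have "\<dots> \<le> 1 + \<bar>U x\<bar> powr p x" using p[OF that] q by (intro powr_mono_le_add) auto
    finally show ?thesis .
  qed
  have w1: "w x powr q \<le> 1 * (indicator (ball x0 R) x * (1 + \<bar>U x\<bar> powr p x))" for x
  proof (cases "x \<in> K")
    case True
    then have x: "x \<in> ball x0 R" using K by auto
    have "w x \<le> 1 * max (U x - 0) 0" unfolding w_def using \<eta>(2)[of x] by (intro mult_right_mono) auto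
    moreover have "w x \<ge> 0" using \<eta>(2)[of x] by (simp add: w_def)
    ultimately have "w x powr q \<le> max (U x - 0) 0 powr q" using q by (intro powr_mono2) auto
    then show ?thesis using Uq[OF x] x by simp
  next
    case False
    then have "w x = 0" using grad_test_0(1)[OF \<eta>(1)] by (simp add: w_def K_def)
    then show ?thesis by simp
  qed
  have W1: "norm (W x) powr q \<le> 2 powr q * (indicator (ball x0 R) x * (1 + norm (H x) powr p x) + L powr q * (indicator (ball x0 R) x * (1 + \<bar>U x\<bar> powr p x)))" for x
  proof (cases "x \<in> K")
    case True
    then have x: "x \<in> ball x0 R" using K by auto
    have "norm (W x) \<le> norm (\<eta> x *\<^sub>R (indicator {x. U x > 0} x *\<^sub>R H x)) + norm (max (U x - 0) 0 *\<^sub>R grad \<eta> x)"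
      unfolding W_def by (rule norm_triangle_ineq)
    also have "\<dots> \<le> norm (H x) + L * max (U x - 0) 0"
    proof (rule add_mono)
      have "norm (\<eta> x *\<^sub>R (indicator {x. U x > 0} x *\<^sub>R H x)) = (\<eta> x * indicator {x. U x > 0} x) * norm (H x)"
        using \<eta>(2)[of x] by simp
      also have "\<dots> \<le> 1 * norm (H x)"
        using \<eta>(2)[of x] by (intro mult_right_mono) (auto simp: indicator_def)
      finally show "norm (\<eta> x *\<^sub>R (indicator {x. U x > 0} x *\<^sub>R H x)) \<le> norm (H x)" by simp
      show "norm (max (U x - 0) 0 *\<^sub>R grad \<eta> x) \<le> L * max (U x - 0) 0"
        using mult_left_mono[OF \<eta>(4)[of x], of "max (U x - 0) 0"] by (simp add: mult.commute)
    qed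
    finally have "norm (W x) powr q \<le> (norm (H x) + L * max (U x - 0) 0) powr q" using q by (intro powr_mono2) auto
    also have "\<dots> \<le> 2 powr q * (norm (H x) powr q + (L * max (U x - 0) 0) powr q)"
      using L q by (intro powr_add_le) auto
    also have "(L * max (U x - 0) 0) powr q = L powr q * max (U x - 0) 0 powr q" using L by (simp add: powr_mult)
    also have "2 powr q * (norm (H x) powr q + L powr q * max (U x - 0) 0 powr q) \<le>
      2 powr q * ((1 + norm (H x) powr p x) + L powr q * (1 + \<bar>U x\<bar> powr p x))"
      using p[OF x] q by (intro mult_left_mono add_mono Uq[OF x] powr_mono_le_add) auto
    finally show ?thesis using x by simp
  next
    case False
    then have "W x = 0" using grad_test_0[OF \<eta>(1)] by (simp add: W_def K_def)
    then show ?thesis by simp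
  qed
  have wfin: "(\<integral>\<^sup>+x. ennreal (w x powr q) \<partial>lborel) < \<infinity>"
    by (rule le_less_trans[OF nn_integral_bound_cmult[OF w1 _ Ub]]) auto
  have "(\<integral>\<^sup>+x. ennreal (indicator (ball x0 R) x * (1 + norm (H x) powr p x) + L powr q * (indicator (ball x0 R) x * (1 + \<bar>U x\<bar> powr p x))) \<partial>lborel)
     \<le> ennreal ((V + b) + L powr q * (V + a))"
    by (rule nn_integral_bound_add[OF order_refl _ _ Hb nn_integral_bound_cmult[OF order_refl _ Ub]]) (use V a b in auto)
  then have Wfin: "(\<integral>\<^sup>+x. ennreal (norm (W x) powr q) \<partial>lborel) < \<infinity>"
    by (rule le_less_trans[OF nn_integral_bound_cmult[OF W1, rotated]]) auto
  have "excess (R / 2) 0 \<le> (\<integral>\<^sup>+x. ennreal (w x powr tau) \<partial>lborel)"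
    unfolding excess_def
  proof (intro nn_integral_mono ennreal_leI)
    show "indicator (cball x0 (R / 2)) x * max (U x - 0) 0 powr tau \<le> w x powr tau" for x
      using \<eta>(3)[of x] by (cases "x \<in> cball x0 (R / 2)") (simp_all add: w_def)
  qed
  also have "\<dots> < \<infinity>"
    by (rule integrability_bootstrap[OF wW _ q tau_bounds(4) tau_bounds(5) Wfin wfin]) (use \<eta>(2) in \<open>simp add: w_def\<close>)
  finally show ?thesis .
qed

lemma excess_mono: "\<rho> \<le> \<rho>' \<Longrightarrow> k' \<le> k \<Longrightarrow> excess \<rho> k \<le> excess \<rho>' k'"
  unfolding excess_def
  by (intro nn_integral_mono ennreal_leI mult_mono powr_mono2) (use tau_bounds(3) in \<open>auto simp: indicator_def\<close>)

text \<open>The iteration contracts only from a small start. Smallness is obtained by raising the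
  level on a fixed ball, through dominated convergence from the finite excess at level 0.\<close>

lemma excess_small:
  assumes "\<epsilon> > 0"
  shows "\<exists>k\<ge>0. excess (R / 2) k \<le> ennreal \<epsilon>"
proof -
  have "(\<lambda>j. excess (R / 2) (real j)) \<longlonglongrightarrow> (\<integral>\<^sup>+x. 0 \<partial>(lborel :: 'a measure))"
    unfolding excess_def
  proof (rule nn_integral_dominated_convergence)
    show "(\<integral>\<^sup>+x. ennreal (indicator (cball x0 (R / 2)) x * max (U x - 0) 0 powr tau) \<partial>lborel) < \<infinity>"
      using excess_finite by (simp add: excess_def)
    show "AE x in lborel. ennreal (indicator (cball x0 (R / 2)) x * max (U x - real j) 0 powr tau) \<le>
      ennreal (indicator (cball x0 (R / 2)) x * max (U x - 0) 0 powr tau)" for j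
      by (intro AE_I2 ennreal_leI mult_left_mono powr_mono2) (use tau_bounds(3) in auto)
    have "(\<lambda>j. ennreal (indicator (cball x0 (R / 2)) x * max (U x - real j) 0 powr tau)) \<longlonglongrightarrow> 0" for x
    proof (rule tendsto_eventually)
      obtain j :: nat where j: "U x < real j" using reals_Archimedean2 by blast
      have "ennreal (indicator (cball x0 (R / 2)) x * max (U x - real i) 0 powr tau) = 0" if "i \<ge> j" for i
      proof -
        have "real j \<le> real i" using that by simp
        with j have "max (U x - real i) 0 = 0" by simp
        then show ?thesis by simp
      qed
      then show "eventually (\<lambda>j. ennreal (indicator (cball x0 (R / 2)) x * max (U x - real j) 0 powr tau) = 0) sequentially"
        unfolding eventually_sequentially by blast
    qed
    then show "AE x in lborel. (\<lambda>j. ennreal (indicator (cball x0 (R / 2)) x * max (U x - real j) 0 powr tau)) \<longlonglongrightarrow> 0" by simp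
  qed auto
  then have "eventually (\<lambda>j. excess (R / 2) (real j) < ennreal \<epsilon>) sequentially"
    using assms by (intro order_tendstoD(2)) auto
  then obtain j where "excess (R / 2) (real j) < ennreal \<epsilon>" by (auto simp: eventually_sequentially)
  then show ?thesis by (intro exI[of _ "real j"]) auto
qed

text \<open>Each step loses a factor growing geometrically in j, but the exponent 1 + \<beta> > 1 of
  y gains more once y is small enough. The excess at level K + 1 on the limiting ball is then below
  every term of a geometric sequence, hence zero.\<close>

lemma locally_bounded_above: "\<exists>M. AE x in lborel. x \<in> cball x0 (R / 4) \<longrightarrow> U x \<le> M"
proof -
  let ?n = "real DIM('a)"
  define \<beta> where "\<beta> = q / ?n - 1 / qf"
  have \<beta>: "\<beta> > 0" unfolding \<beta>_def using qf q by (simp add: field_simps)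
  define \<kappa> where "\<kappa> = P + sigma"
  have \<kappa>: "\<kappa> > 0" unfolding \<kappa>_def using q_le_P q tau_bounds by linarith
  obtain C where C: "C > 0" "\<And>k d \<rho> \<rho>' y. 0 \<le> k \<Longrightarrow> 0 < d \<Longrightarrow> d \<le> 1 \<Longrightarrow> 0 < \<rho>' \<Longrightarrow> \<rho> < R \<Longrightarrow> \<rho> - \<rho>' = R * d / 2 \<Longrightarrow> 0 < y \<Longrightarrow> y \<le> 1 \<Longrightarrow>
     excess \<rho> k \<le> ennreal y \<Longrightarrow> excess \<rho>' (k + 2 * d) \<le> ennreal (C * d powr (- \<kappa>) * y powr (1 + \<beta>))"
    using excess_step unfolding \<kappa>_def \<beta>_def by (auto simp: algebra_simps)
  \<comment> \<open>The decay rate is chosen with \<gamma>^\<beta> = 2^(-\<kappa>), which cancels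
    the growth 2^(j \<kappa>) of the loss.\<close>
  define \<gamma> where "\<gamma> = 2 powr (- (\<kappa> / \<beta>))"
  have "\<gamma> < 2 powr 0" unfolding \<gamma>_def using \<kappa> \<beta> by (subst powr_less_cancel_iff) auto
  then have \<gamma>: "0 < \<gamma>" "\<gamma> < 1" by (simp_all add: \<gamma>_def)
  have \<gamma>\<beta>: "\<gamma> powr \<beta> = 2 powr (- \<kappa>)" using \<beta> by (simp add: \<gamma>_def powr_powr)
  \<comment> \<open>The starting value leaves C 4^\<kappa> y0^\<beta> \<le> \<gamma>, so that one
    step multiplies the bound by \<gamma>. The factor 4^\<kappa> stems from the shift by 2 in the
    exponent of d.\<close>
  define y0 where "y0 = min 1 ((\<gamma> / (C * 4 powr \<kappa>)) powr (1 / \<beta>))"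
  have y0: "0 < y0" "y0 \<le> 1" using \<gamma> C(1) by (auto simp: y0_def)
  have "y0 powr \<beta> \<le> ((\<gamma> / (C * 4 powr \<kappa>)) powr (1 / \<beta>)) powr \<beta>"
    using y0 \<beta> by (intro powr_mono2) (auto simp: y0_def)
  also have "\<dots> = \<gamma> / (C * 4 powr \<kappa>)" using \<beta> \<gamma> C(1) by (simp add: powr_powr)
  finally have y0b: "C * 4 powr \<kappa> * y0 powr \<beta> \<le> \<gamma>" using C(1) by (simp add: field_simps)
  obtain K where K: "K \<ge> 0" "excess (R / 2) K \<le> ennreal y0" using excess_small[OF y0(1)] by blast
  have it: "excess (R / 4 * (1 + (1/2) ^ j)) (K + 1 - (1/2) ^ j) \<le> ennreal (y0 * \<gamma> ^ j)" for j :: nat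
  proof (induction j)
    case 0
    then show ?case using K by simp
  next
    case (Suc j)
    \<comment> \<open>The exponent j + 2 fits both sequences: 2 d is the increment (1/2)^j -
      (1/2)^(j+1) of the levels, and R d / 2 is the decrease (R/4) (1/2)^(j+1) of the radii.\<close>
    define d :: real where "d = (1/2) ^ (j + 2)"
    have d: "0 < d" "d \<le> 1" unfolding d_def by (simp, rule power_le_one, simp_all)
    have yj: "0 < y0 * \<gamma> ^ j" "y0 * \<gamma> ^ j \<le> 1" using y0 \<gamma> by (auto intro!: mult_le_one power_le_one)
    have half: "(1/2) ^ j \<le> (1::real)" "(1/2) ^ j \<ge> (0::real)" by (simp_all add: power_le_one)
    have "excess (R / 4 * (1 + (1/2) ^ Suc j)) (K + 1 - (1/2) ^ j + 2 * d) \<le>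
      ennreal (C * d powr (- \<kappa>) * (y0 * \<gamma> ^ j) powr (1 + \<beta>))"
    proof (rule C(2)[OF _ d _ _ _ yj Suc])
      show "0 \<le> K + 1 - (1/2) ^ j" using K half by linarith
      show "0 < R / 4 * (1 + (1/2) ^ Suc j)" using R by (intro mult_pos_pos add_pos_pos) auto
      have "R / 4 * (1 + (1/2) ^ j) \<le> R / 4 * 2" using R half by (intro mult_left_mono) auto
      then show "R / 4 * (1 + (1/2) ^ j) < R" using R by linarith
      show "R / 4 * (1 + (1/2) ^ j) - R / 4 * (1 + (1/2) ^ Suc j) = R * d / 2" by (simp add: d_def algebra_simps)
    qed
    also have "K + 1 - (1/2) ^ j + 2 * d = K + 1 - (1/2) ^ Suc j" by (simp add: d_def)
    also have "C * d powr (- \<kappa>) * (y0 * \<gamma> ^ j) powr (1 + \<beta>) \<le> y0 * \<gamma> ^ Suc j"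
    proof -
      have "d = 1 / 2 ^ (j + 2)" by (simp add: d_def power_one_over)
      also have "(2::real) ^ (j + 2) = 2 powr real (j + 2)" by (rule powr_realpow[symmetric]) simp
      also have "1 / 2 powr real (j + 2) = 2 powr (- (real j + 2))" using powr_minus_divide[of 2 "real j + 2"] by (simp add: add.commute)
      finally have "d = 2 powr (- (real j + 2))" .
      then have "d powr (- \<kappa>) = 2 powr (2 * \<kappa> + real j * \<kappa>)" by (simp add: powr_powr algebra_simps)
      also have "\<dots> = (2 powr 2) powr \<kappa> * 2 powr (real j * \<kappa>)" by (simp only: powr_add powr_powr)
      finally have e1: "d powr (- \<kappa>) = 4 powr \<kappa> * 2 powr (real j * \<kappa>)" by simp
      have "(\<gamma> ^ j) powr \<beta> = (\<gamma> powr \<beta>) powr real j"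
        using \<gamma> by (simp add: powr_powr mult.commute flip: powr_realpow)
      then have "(\<gamma> ^ j) powr \<beta> = 2 powr (- (real j * \<kappa>))" by (simp add: \<gamma>\<beta> powr_powr mult.commute)
      then have e2: "(y0 * \<gamma> ^ j) powr (1 + \<beta>) = (y0 * \<gamma> ^ j) * (y0 powr \<beta> * 2 powr (- (real j * \<kappa>)))"
        using y0 \<gamma> by (simp add: powr_add powr_mult)
      have e3: "2 powr (real j * \<kappa>) * 2 powr (- (real j * \<kappa>)) = (1::real)" by (simp flip: powr_add)
      have "C * d powr (- \<kappa>) * (y0 * \<gamma> ^ j) powr (1 + \<beta>) =
        (C * 4 powr \<kappa> * y0 powr \<beta>) * (y0 * \<gamma> ^ j) * (2 powr (real j * \<kappa>) * 2 powr (- (real j * \<kappa>)))"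
        unfolding e1 e2 by (simp only: mult_ac)
      also have "\<dots> \<le> \<gamma> * (y0 * \<gamma> ^ j)" unfolding e3 using y0b yj by (simp add: mult_right_mono)
      finally show ?thesis by (simp add: mult_ac)
    qed
    finally show ?case by (simp add: ennreal_leI)
  qed
  have "excess (R / 4) (K + 1) \<le> ennreal (y0 * \<gamma> ^ j)" for j :: nat
    by (rule order_trans[OF excess_mono it]) (use R in auto)
  moreover have "(\<lambda>j. ennreal (y0 * \<gamma> ^ j)) \<longlonglongrightarrow> ennreal (y0 * 0)"
    using \<gamma> by (intro tendsto_ennrealI tendsto_mult tendsto_const LIMSEQ_power_zero) auto
  ultimately have "excess (R / 4) (K + 1) \<le> ennreal (y0 * 0)"
    by (intro LIMSEQ_le_const) auto
  then have "(\<integral>\<^sup>+x. ennreal (indicator (cball x0 (R / 4)) x * max (U x - (K + 1)) 0 powr tau) \<partial>lborel) = 0"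
    by (simp add: excess_def)
  then have "AE x in lborel. ennreal (indicator (cball x0 (R / 4)) x * max (U x - (K + 1)) 0 powr tau) = 0"
    by (subst (asm) nn_integral_0_iff_AE) auto
  then have "AE x in lborel. x \<in> cball x0 (R / 4) \<longrightarrow> U x \<le> K + 1"
  proof eventually_elim
    case (elim x)
    show ?case
    proof (intro impI, rule ccontr)
      assume "x \<in> cball x0 (R / 4)" "\<not> U x \<le> K + 1"
      then show False using elim by (simp add: ennreal_eq_0_iff not_le)
    qed
  qed
  then show ?thesis by blast
qed

end

section \<open>Distributional gradients on an open set\<close>

text \<open>Translations and exchange of integrals are carried out with Borel functions on
  \<open>lborel\<close>, whereas the given functions are only measurable for the completed measure
  restricted to \<Omega>. They are replaced by Borel functions equal almost everywhere, found
  component by component.\<close>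

lemma borel_representative:
  fixes F :: "'a::euclidean_space \<Rightarrow> 'b::euclidean_space"
  assumes S: "S \<in> sets borel" and F: "F \<in> borel_measurable (lebesgue_on S)"
  shows "\<exists>F'\<in>borel_measurable borel. AE x in lborel. x \<in> S \<longrightarrow> F x = F' x"
proof -
  have S': "S \<in> sets lebesgue" using S by (simp add: lborelD sets_completionI_sets)
  have m: "(\<lambda>x. if x \<in> S then F x else 0) \<in> borel_measurable lebesgue"
    by (rule borel_measurable_if_I[OF F S'])
  have "\<exists>g. g \<in> borel_measurable borel \<and> (AE x in lborel. (if x \<in> S then F x else 0) \<bullet> i = g x)" for i
  proof -
    have "(\<lambda>x. (if x \<in> S then F x else 0) \<bullet> i) \<in> borel_measurable (completion lborel)" using m by measurable
    from completion_ex_borel_measurable_real[OF this] show ?thesis by auto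
  qed
  then obtain g where g: "\<And>i. g i \<in> borel_measurable borel" "\<And>i. AE x in lborel. (if x \<in> S then F x else 0) \<bullet> i = g i x"
    by metis
  define F' where "F' x = (\<Sum>i\<in>Basis. g i x *\<^sub>R i)" for x
  have "AE x in lborel. \<forall>i\<in>Basis. (if x \<in> S then F x else 0) \<bullet> i = g i x"
    by (intro AE_finite_allI finite_Basis g(2))
  then have "AE x in lborel. x \<in> S \<longrightarrow> F x = F' x"
  proof eventually_elim
    case (elim x)
    show ?case
    proof
      assume x: "x \<in> S"
      have "F x = (\<Sum>i\<in>Basis. (F x \<bullet> i) *\<^sub>R i)" by (simp add: euclidean_representation)
      also have "\<dots> = F' x" unfolding F'_def using elim x by (intro sum.cong) auto
      finally show "F x = F' x" .
    qed
  qed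
  moreover have "F' \<in> borel_measurable borel" unfolding F'_def[abs_def] using g(1) by measurable
  ultimately show ?thesis by blast
qed

lemma AE_lebesgue_on:
  assumes "S \<in> sets borel"
  shows "(AE x in lebesgue_on S. Q x) \<longleftrightarrow> (AE x in lborel. x \<in> S \<longrightarrow> Q x)"
proof -
  have "S \<inter> space lebesgue \<in> sets lebesgue" using assms by (simp add: lborelD sets_completionI_sets)
  then show ?thesis by (subst AE_restrict_space_iff) (simp_all add: AE_completion_iff)
qed

lemma lebesgue_on_to_lborel:
  fixes F :: "'a::euclidean_space \<Rightarrow> 'b::euclidean_space"
  assumes S: "S \<in> sets borel" and F: "F \<in> borel_measurable (lebesgue_on S)"
    and F' [measurable]: "F' \<in> borel_measurable borel" and ae: "AE x in lborel. x \<in> S \<longrightarrow> F x = F' x"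
  shows "integral\<^sup>L (lebesgue_on S) F = (\<integral>x. indicator S x *\<^sub>R F' x \<partial>lborel)"
    and "integrable (lebesgue_on S) F \<longleftrightarrow> integrable lborel (\<lambda>x. indicator S x *\<^sub>R F' x)"
proof -
  note [measurable] = S
  have S': "S \<inter> space lebesgue \<in> sets lebesgue" using S by (simp add: lborelD sets_completionI_sets)
  have m: "(\<lambda>x. indicator S x *\<^sub>R F x) \<in> borel_measurable lebesgue"
    using F borel_measurable_restrict_space_iff[OF S', of F] by simp
  have m': "(\<lambda>x. indicator S x *\<^sub>R F' x) \<in> borel_measurable lborel" by measurable
  have m'': "(\<lambda>x. indicator S x *\<^sub>R F' x) \<in> borel_measurable lebesgue"
    using m' by (rule measurable_completion)
  have "AE x in lebesgue. indicator S x *\<^sub>R F x = indicator S x *\<^sub>R F' x"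
    unfolding AE_completion_iff using ae by eventually_elim (auto simp: indicator_def)
  note eq = integral_cong_AE[OF m m'' this] integrable_cong_AE[OF m m'' this]
  show "integral\<^sup>L (lebesgue_on S) F = (\<integral>x. indicator S x *\<^sub>R F' x \<partial>lborel)"
    unfolding integral_restrict_space[OF S'] eq(1) by (rule integral_completion[OF m'])
  show "integrable (lebesgue_on S) F \<longleftrightarrow> integrable lborel (\<lambda>x. indicator S x *\<^sub>R F' x)"
    unfolding integrable_restrict_space[OF S'] eq(2) by (rule integrable_completion[OF m'])
qed

lemma borel_imp_lebesgue_on: "F \<in> borel_measurable borel \<Longrightarrow> F \<in> borel_measurable (lebesgue_on S)"
  by (intro measurable_restrict_space1 measurable_completion) simp

text \<open>A distributional gradient is required to be integrable on compact subsets only. An open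
  set is a countable union of compact boxes, and measurability is glued along it. This also covers
  the gradient picked by \<open>distr_gradient\<close>, of which nothing else is known.\<close>

lemma locally_integrable_imp_measurable:
  fixes F :: "'a::euclidean_space \<Rightarrow> 'b::euclidean_space"
  assumes "open \<Omega>" "\<And>K. compact K \<Longrightarrow> K \<subseteq> \<Omega> \<Longrightarrow> F absolutely_integrable_on K"
  shows "F \<in> borel_measurable (lebesgue_on \<Omega>)"
proof -
  obtain D where D: "countable D" "D \<subseteq> Pow \<Omega>" "\<And>X. X \<in> D \<Longrightarrow> \<exists>a b. X = cbox a b" "\<Union>D = \<Omega>"
    using open_countable_Union_open_cbox[OF assms(1)] by metis
  show ?thesis
  proof (rule measurable_piecewise_restrict[OF D(1)])
    fix X assume X: "X \<in> D"
    then have c: "compact X" "X \<subseteq> \<Omega>" "X \<in> sets lebesgue" using D by fastforce+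
    then have "F absolutely_integrable_on X" using assms(2) by blast
    then have "F \<in> borel_measurable (lebesgue_on X)"
      by (rule absolutely_integrable_measurable[THEN iffD1, THEN conjunct1, rotated]) (use c in auto)
    moreover have "restrict_space (lebesgue_on \<Omega>) X = lebesgue_on X"
      using c assms(1) by (subst restrict_restrict_space) (auto simp: Int_absorb1)
    ultimately show "F \<in> borel_measurable (restrict_space (lebesgue_on \<Omega>) X)" by simp
    show "X \<inter> space (lebesgue_on \<Omega>) \<in> sets (lebesgue_on \<Omega>)"
      using c assms(1) by (auto simp: sets_restrict_space_iff Int_absorb2)
  qed (use D in auto)
qed

lemma weak_grad_unique:
  assumes "weak_grad w H" "weak_grad w H'"
  shows "AE x in lborel. H x = H' x"
proof -
  have d: "weak_grad (\<lambda>x. 0) (\<lambda>x. H x - H' x)" using weak_grad_diff[OF assms] by simp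
  have "AE x in lborel. (H x - H' x) \<bullet> i = 0" for i
  proof (rule fundamental_lemma)
    show "integrable lborel (\<lambda>x. (H x - H' x) \<bullet> i)" using weak_gradD(2)[OF d] by auto
    show "(\<integral>x. ((H x - H' x) \<bullet> i) * \<psi> x \<partial>lborel) = 0" if "\<psi> \<in> test_functions UNIV" for \<psi>
      using weak_gradD(5)[OF d that, of i] by simp
  qed
  then have "AE x in lborel. \<forall>i\<in>Basis. (H x - H' x) \<bullet> i = 0" by (intro AE_finite_allI finite_Basis)
  then show ?thesis
  proof eventually_elim
    case (elim x)
    then have "H x - H' x = 0" by (simp only: euclidean_all_zero_iff)
    then show ?case by simp
  qed
qed

text \<open>Uncountably many exceptional sets could add up to a set of positive measure; the
  Lindelof property reduces the cover to countably many balls.\<close>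

lemma AE_open_cover:
  fixes \<Omega> :: "'a::euclidean_space set"
  assumes "\<And>x. x \<in> \<Omega> \<Longrightarrow> \<exists>r>0. AE y in M. y \<in> ball x r \<longrightarrow> Q y"
  shows "AE y in M. y \<in> \<Omega> \<longrightarrow> Q y"
proof -
  obtain r where r: "\<And>x. x \<in> \<Omega> \<Longrightarrow> r x > 0" "\<And>x. x \<in> \<Omega> \<Longrightarrow> AE y in M. y \<in> ball x (r x) \<longrightarrow> Q y"
    using assms by metis
  obtain F where F: "F \<subseteq> (\<lambda>x. ball x (r x)) ` \<Omega>" "countable F" "\<Union>F = \<Union>((\<lambda>x. ball x (r x)) ` \<Omega>)"
    using Lindelof[of "(\<lambda>x. ball x (r x)) ` \<Omega>"] by (metis (no_types, lifting) imageE open_ball)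
  have "AE y in M. \<forall>B\<in>F. y \<in> B \<longrightarrow> Q y"
    using F(1) r(2) by (subst AE_ball_countable[OF F(2)]) blast
  then show ?thesis
  proof eventually_elim
    case (elim y)
    show ?case
    proof
      assume y: "y \<in> \<Omega>"
      then have "y \<in> ball y (r y)" using r(1)[OF y] by simp
      with y have "y \<in> \<Union>F" unfolding F(3) by blast
      then show "Q y" using elim by auto
    qed
  qed
qed

lemma cutoff_exists:
  assumes "open \<Omega>" "x \<in> \<Omega>"
  shows "\<exists>R>0. \<exists>\<zeta>. \<zeta> \<in> test_functions \<Omega> \<and> (\<forall>y\<in>cball x R. \<zeta> y = 1) \<and> cball x R \<subseteq> \<Omega>"
proof -
  obtain e where e: "e > 0" "cball x e \<subseteq> \<Omega>" using assms open_contains_cball by blast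
  obtain \<eta> where "\<eta> \<in> test_functions (cball x e)" "\<forall>y\<in>cball x (e/2). \<eta> y = 1"
    using ball_cutoff[where 'a='a] e(1) by (metis half_gt_zero_iff field_sum_of_halves less_add_same_cancel1)
  then show ?thesis
    using e by (intro exI[of _ "e/2"] conjI exI[of _ \<eta>]) (auto intro: test_functions_mono)
qed

lemma local_grad_unique:
  assumes o: "open \<Omega>" and G: "local_grad \<Omega> u G" "local_grad \<Omega> u G'"
  shows "AE x in lborel. x \<in> \<Omega> \<longrightarrow> G x = G' x"
proof (rule AE_open_cover)
  fix x assume "x \<in> \<Omega>"
  then obtain R \<zeta> where R: "R > 0" "\<zeta> \<in> test_functions \<Omega>" "\<forall>y\<in>cball x R. \<zeta> y = 1"
    using cutoff_exists[OF o] by blast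
  have "AE y in lborel. y \<in> ball x R \<longrightarrow> G y = G' y"
    using weak_grad_unique[OF local_grad_weak_grad[OF G(1) R(2)] local_grad_weak_grad[OF G(2) R(2)]]
    by eventually_elim (use R(3) in auto)
  with R(1) show "\<exists>r>0. AE y in lborel. y \<in> ball x r \<longrightarrow> G y = G' y" by blast
qed

lemma absolutely_integrable_imp_lborel:
  fixes F F' :: "'a::euclidean_space \<Rightarrow> 'b::euclidean_space"
  assumes K: "compact K" and F: "F absolutely_integrable_on K" "F' \<in> borel_measurable borel"
      "AE x in lborel. x \<in> K \<longrightarrow> F x = F' x"
  shows "integrable lborel (\<lambda>x. indicator K x *\<^sub>R F' x)"
proof -
  have Kl: "K \<inter> space lebesgue \<in> sets lebesgue" using compact_borel[OF K] by (simp add: lborelD sets_completionI_sets)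
  have i: "integrable (lebesgue_on K) F"
    unfolding integrable_restrict_space[OF Kl] using F(1) unfolding set_integrable_def .
  show ?thesis
    using lebesgue_on_to_lborel(2)[OF compact_borel[OF K] borel_measurable_integrable[OF i] F(2,3)] i by simp
qed

lemma integrable_lborel_imp_absolutely_integrable:
  fixes F :: "'a::euclidean_space \<Rightarrow> 'b::euclidean_space"
  assumes F: "integrable lborel F" and K: "compact K"
  shows "F absolutely_integrable_on K"
proof -
  have "F \<in> borel_measurable lborel" using F by auto
  then have "integrable lebesgue F" using F integrable_completion by blast
  then have "set_integrable lebesgue UNIV F" by (simp add: set_integrable_def)
  then show ?thesis
    by (rule set_integrable_subset) (use compact_borel[OF K] in \<open>auto simp: lborelD sets_completionI_sets\<close>)
qed

lemma has_distr_gradient_locally_integrable: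
  "has_distr_gradient \<Omega> u G \<Longrightarrow> compact K \<Longrightarrow> K \<subseteq> \<Omega> \<Longrightarrow> u absolutely_integrable_on K \<and> G absolutely_integrable_on K"
  unfolding has_distr_gradient_def by blast

lemma has_distr_gradient_measurable:
  assumes "open \<Omega>" "has_distr_gradient \<Omega> u G"
  shows "u \<in> borel_measurable (lebesgue_on \<Omega>)" "G \<in> borel_measurable (lebesgue_on \<Omega>)"
  by (rule locally_integrable_imp_measurable[OF assms(1)], use has_distr_gradient_locally_integrable[OF assms(2)] in blast)+

lemma has_distr_gradient_local_grad:
  assumes o: "open \<Omega>" and h: "has_distr_gradient \<Omega> u G"
    and u' [measurable]: "u' \<in> borel_measurable borel" and G' [measurable]: "G' \<in> borel_measurable borel"
    and ae: "AE x in lborel. x \<in> \<Omega> \<longrightarrow> u x = u' x" "AE x in lborel. x \<in> \<Omega> \<longrightarrow> G x = G' x"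
  shows "local_grad \<Omega> u' G'"
proof -
  have ob: "\<Omega> \<in> sets borel" using o by simp
  have um: "u \<in> borel_measurable (lebesgue_on \<Omega>)" and Gm: "G \<in> borel_measurable (lebesgue_on \<Omega>)"
    using has_distr_gradient_measurable[OF o h] by auto
  have eq: "(\<integral>x. u' x * (grad \<psi> x \<bullet> i) \<partial>lborel) = - (\<integral>x. (G' x \<bullet> i) * \<psi> x \<partial>lborel)"
    if P: "\<psi> \<in> test_functions \<Omega>" and i: "i \<in> Basis" for \<psi> i
  proof -
    note pm [measurable] = test_functions_borel[OF P] grad_test_borel[OF P]
    have 1: "(LINT x|lebesgue_on \<Omega>. u x * frechet_derivative \<psi> (at x) i) = (\<integral>x. indicator \<Omega> x *\<^sub>R (u' x * (grad \<psi> x \<bullet> i)) \<partial>lborel)"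
    proof (rule lebesgue_on_to_lborel(1)[OF ob])
      have "(\<lambda>x. u x * (grad \<psi> x \<bullet> i)) \<in> borel_measurable (lebesgue_on \<Omega>)"
        by (intro borel_measurable_times um borel_imp_lebesgue_on) measurable
      then show "(\<lambda>x. u x * frechet_derivative \<psi> (at x) i) \<in> borel_measurable (lebesgue_on \<Omega>)"
        by (simp add: grad_inner_Basis[OF i])
      show "AE x in lborel. x \<in> \<Omega> \<longrightarrow> u x * frechet_derivative \<psi> (at x) i = u' x * (grad \<psi> x \<bullet> i)"
        using ae(1) by eventually_elim (simp add: grad_inner_Basis[OF i])
    qed measurable
    have 2: "(LINT x|lebesgue_on \<Omega>. (G x \<bullet> i) * \<psi> x) = (\<integral>x. indicator \<Omega> x *\<^sub>R ((G' x \<bullet> i) * \<psi> x) \<partial>lborel)"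
    proof (rule lebesgue_on_to_lborel(1)[OF ob])
      show "(\<lambda>x. (G x \<bullet> i) * \<psi> x) \<in> borel_measurable (lebesgue_on \<Omega>)"
        by (intro borel_measurable_times borel_measurable_inner Gm borel_measurable_const borel_imp_lebesgue_on pm(1))
      show "AE x in lborel. x \<in> \<Omega> \<longrightarrow> (G x \<bullet> i) * \<psi> x = (G' x \<bullet> i) * \<psi> x"
        using ae(2) by eventually_elim simp
    qed measurable
    have z: "indicator \<Omega> x *\<^sub>R (u' x * (grad \<psi> x \<bullet> i)) = u' x * (grad \<psi> x \<bullet> i)"
      "indicator \<Omega> x *\<^sub>R ((G' x \<bullet> i) * \<psi> x) = (G' x \<bullet> i) * \<psi> x" for x
      using grad_test_0[OF P, of x] by (cases "x \<in> \<Omega>"; simp)+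
    show ?thesis using h P i 1 2 unfolding z has_distr_gradient_def by simp
  qed
  have K: "integrable lborel (\<lambda>x. indicator K x * u' x)" "integrable lborel (\<lambda>x. indicator K x *\<^sub>R G' x)"
    if "compact K" "K \<subseteq> \<Omega>" for K
  proof -
    have u: "u absolutely_integrable_on K" and G: "G absolutely_integrable_on K"
      using has_distr_gradient_locally_integrable[OF h that] by auto
    have "AE x in lborel. x \<in> K \<longrightarrow> u x = u' x" "AE x in lborel. x \<in> K \<longrightarrow> G x = G' x"
      by (rule eventually_mono[OF ae(1)], use that in blast, rule eventually_mono[OF ae(2)], use that in blast)
    then show "integrable lborel (\<lambda>x. indicator K x * u' x)" "integrable lborel (\<lambda>x. indicator K x *\<^sub>R G' x)"
      using absolutely_integrable_imp_lborel[OF that(1) u u'] absolutely_integrable_imp_lborel[OF that(1) G G'] by auto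
  qed
  have "(\<integral>x. u' x * (grad \<psi> x \<bullet> v) \<partial>lborel) = - (\<integral>x. (G' x \<bullet> v) * \<psi> x \<partial>lborel)"
    if P: "\<psi> \<in> test_functions \<Omega>" for \<psi> v
  proof -
    let ?K = "closure {x. \<psi> x \<noteq> 0}"
    note S = test_functions_support[OF P]
    note [measurable] = test_functions_borel[OF P] grad_test_borel[OF P]
    obtain B where B: "\<And>x. \<bar>\<psi> x\<bar> \<le> B" using test_bounded[OF P] by blast
    obtain B' where B': "\<And>x. norm (grad \<psi> x) \<le> B'" using grad_test_bounded[OF P] by blast
    have B'': "\<bar>grad \<psi> x \<bullet> v\<bar> \<le> B' * norm v" for x v
      using order_trans[OF Cauchy_Schwarz_ineq2 mult_right_mono[OF B' norm_ge_zero]] .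
    have i1: "integrable lborel (\<lambda>x. u' x * (grad \<psi> x \<bullet> v))" for v
    proof (rule integrable_mult_supported[OF K(1)[OF S(2,3)] _ B''])
      show "grad \<psi> x \<bullet> v = 0" if "x \<notin> ?K" for x by (simp only: grad_test_0(2)[OF S(1) that] inner_zero_left)
    qed simp
    have i2: "integrable lborel (\<lambda>x. (G' x \<bullet> v) * \<psi> x)" for v
    proof (rule integrable_mult_supported[OF _ _ B grad_test_0(1)[OF S(1)]])
      show "integrable lborel (\<lambda>x. indicator ?K x * (G' x \<bullet> v))"
        using integrable_inner_left[OF K(2)[OF S(2,3)], of v] by simp
    qed simp
    \<comment> \<open>The definition tests basis directions only, so v is expanded in coordinates.
      Each summand has to be integrable separately, hence the preceding two facts.\<close>
    have "(\<integral>x. u' x * (grad \<psi> x \<bullet> v) \<partial>lborel) = (\<integral>x. (\<Sum>i\<in>Basis. (v \<bullet> i) * (u' x * (grad \<psi> x \<bullet> i))) \<partial>lborel)"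
      by (subst euclidean_inner) (simp add: sum_distrib_left mult_ac)
    also have "\<dots> = (\<Sum>i\<in>Basis. (v \<bullet> i) * (\<integral>x. u' x * (grad \<psi> x \<bullet> i) \<partial>lborel))"
      using i1 by (subst Bochner_Integration.integral_sum) auto
    also have "\<dots> = (\<Sum>i\<in>Basis. (v \<bullet> i) * - (\<integral>x. (G' x \<bullet> i) * \<psi> x \<partial>lborel))"
      using eq[OF P] by simp
    also have "\<dots> = - (\<Sum>i\<in>Basis. (v \<bullet> i) * (\<integral>x. (G' x \<bullet> i) * \<psi> x \<partial>lborel))"
      by (simp add: sum_negf)
    also have "(\<Sum>i\<in>Basis. (v \<bullet> i) * (\<integral>x. (G' x \<bullet> i) * \<psi> x \<partial>lborel)) = (\<integral>x. (\<Sum>i\<in>Basis. (v \<bullet> i) * ((G' x \<bullet> i) * \<psi> x)) \<partial>lborel)"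
      using i2 by (subst Bochner_Integration.integral_sum) auto
    also have "\<dots> = (\<integral>x. (G' x \<bullet> v) * \<psi> x \<partial>lborel)"
    proof -
      have "(\<Sum>i\<in>Basis. (v \<bullet> i) * ((G' x \<bullet> i) * \<psi> x)) = (G' x \<bullet> v) * \<psi> x" for x
        by (subst euclidean_inner[of "G' x" v]) (simp add: sum_distrib_left mult_ac)
      then show ?thesis by (simp only:)
    qed
    finally show ?thesis .
  qed
  with K show ?thesis by (simp add: local_grad_def)
qed

text \<open>The way back: functions constructed on the whole space but vanishing off \<Omega> are
  recognised as admissible on \<Omega>.\<close>

lemma weak_grad_has_distr_gradient:
  assumes o: "open \<Omega>" and W: "weak_grad w W" and z: "\<And>x. x \<notin> \<Omega> \<Longrightarrow> w x = 0 \<and> W x = 0"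
  shows "has_distr_gradient \<Omega> w W"
proof -
  note m [measurable] = weak_gradD(3,4)[OF W]
  have ob: "\<Omega> \<in> sets borel" using o by simp
  have "(LINT x|lebesgue_on \<Omega>. w x * frechet_derivative \<psi> (at x) i) = - (LINT x|lebesgue_on \<Omega>. (W x \<bullet> i) * \<psi> x)"
    if P: "\<psi> \<in> test_functions \<Omega>" and i: "i \<in> Basis" for \<psi> i
  proof -
    note pm [measurable] = test_functions_borel[OF P] grad_test_borel[OF P]
    have m1: "(\<lambda>x. w x * (grad \<psi> x \<bullet> i)) \<in> borel_measurable borel" "(\<lambda>x. (W x \<bullet> i) * \<psi> x) \<in> borel_measurable borel"
      by measurable
    have z': "indicator \<Omega> x *\<^sub>R (w x * (grad \<psi> x \<bullet> i)) = w x * (grad \<psi> x \<bullet> i)"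
      "indicator \<Omega> x *\<^sub>R ((W x \<bullet> i) * \<psi> x) = (W x \<bullet> i) * \<psi> x" for x
      using z[of x] by (cases "x \<in> \<Omega>"; simp)+
    have e1: "(LINT x|lebesgue_on \<Omega>. w x * (grad \<psi> x \<bullet> i)) = (\<integral>x. indicator \<Omega> x *\<^sub>R (w x * (grad \<psi> x \<bullet> i)) \<partial>lborel)"
      by (rule lebesgue_on_to_lborel(1)[OF ob borel_imp_lebesgue_on[OF m1(1)] m1(1)]) simp
    have e2: "(LINT x|lebesgue_on \<Omega>. (W x \<bullet> i) * \<psi> x) = (\<integral>x. indicator \<Omega> x *\<^sub>R ((W x \<bullet> i) * \<psi> x) \<partial>lborel)"
      by (rule lebesgue_on_to_lborel(1)[OF ob borel_imp_lebesgue_on[OF m1(2)] m1(2)]) simp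
    show ?thesis
      using weak_gradD(5)[OF W test_functions_mono[OF P subset_UNIV], of i] e1[unfolded z'(1)] e2[unfolded z'(2)]
      by (simp add: grad_inner_Basis[OF i])
  qed
  then show ?thesis unfolding has_distr_gradient_def
    using integrable_lborel_imp_absolutely_integrable[OF weak_gradD(1)[OF W]]
      integrable_lborel_imp_absolutely_integrable[OF weak_gradD(2)[OF W]] by blast
qed

lemma has_distr_gradient_unique:
  assumes o: "open \<Omega>" and h: "has_distr_gradient \<Omega> u G" "has_distr_gradient \<Omega> u G'"
  shows "AE x in lborel. x \<in> \<Omega> \<longrightarrow> G x = G' x"
proof -
  have ob: "\<Omega> \<in> sets borel" using o by simp
  have "u \<in> borel_measurable (lebesgue_on \<Omega>)" "G \<in> borel_measurable (lebesgue_on \<Omega>)" "G' \<in> borel_measurable (lebesgue_on \<Omega>)"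
    using has_distr_gradient_measurable[OF o h(1)] has_distr_gradient_measurable[OF o h(2)] by auto
  note rep = this[THEN borel_representative[OF ob]]
  obtain u1 where u1: "u1 \<in> borel_measurable borel" "AE x in lborel. x \<in> \<Omega> \<longrightarrow> u x = u1 x" using rep(1) by blast
  obtain G1 where G1: "G1 \<in> borel_measurable borel" "AE x in lborel. x \<in> \<Omega> \<longrightarrow> G x = G1 x" using rep(2) by blast
  obtain G2 where G2: "G2 \<in> borel_measurable borel" "AE x in lborel. x \<in> \<Omega> \<longrightarrow> G' x = G2 x" using rep(3) by blast
  have "AE x in lborel. x \<in> \<Omega> \<longrightarrow> G1 x = G2 x"
    by (rule local_grad_unique[OF o has_distr_gradient_local_grad[OF o h(1) u1(1) G1(1) u1(2) G1(2)]
        has_distr_gradient_local_grad[OF o h(2) u1(1) G2(1) u1(2) G2(2)]])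
  with G1(2) G2(2) show ?thesis by eventually_elim auto
qed

text \<open>Once one gradient exists, the chosen one is a gradient too, and uniqueness identifies
  the two up to a null set.\<close>

lemma distr_gradient_AE:
  assumes "open \<Omega>" "has_distr_gradient \<Omega> u G"
  shows "AE x in lborel. x \<in> \<Omega> \<longrightarrow> distr_gradient \<Omega> u x = G x"
proof -
  have "has_distr_gradient \<Omega> u (distr_gradient \<Omega> u)"
    unfolding distr_gradient_def by (rule someI[of "has_distr_gradient \<Omega> u", OF assms(2)])
  from has_distr_gradient_unique[OF assms(1) this assms(2)] show ?thesis .
qed

section \<open>Testing the equation\<close>

lemma Lvar_norm_AE_zero:
  fixes u :: "'a::euclidean_space \<Rightarrow> 'b::euclidean_space"
  assumes "AE x in lebesgue_on \<Omega>. u x = 0" "\<epsilon> > 0"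
  shows "Lvar_norm \<Omega> p u \<le> \<epsilon>"
  unfolding Lvar_norm_def
proof (rule cInf_lower)
  have "(\<integral>\<^sup>+x. ennreal ((norm (u x) / \<epsilon>) powr p x) \<partial>lebesgue_on \<Omega>) = (\<integral>\<^sup>+x. 0 \<partial>lebesgue_on \<Omega>)"
    by (rule nn_integral_cong_AE) (use assms(1) in \<open>auto elim: eventually_mono\<close>)
  then show "\<epsilon> \<in> {l. l > 0 \<and> (\<integral>\<^sup>+x. ennreal ((norm (u x) / l) powr p x) \<partial>lebesgue_on \<Omega>) \<le> 1}"
    using assms(2) by simp
qed (rule bdd_belowI[of _ 0], auto)

text \<open>The approximating element is u itself. What remains is that the norm of the zero
  function is small, and there the gradient selected by \<open>distr_gradient\<close> is known to
  vanish only almost everywhere. Two thirds of \<epsilon> keep the inequality strict.\<close>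

lemma compactly_supported_W1var0:
  assumes o: "open \<Omega>" and u: "u \<in> W1var \<Omega> p" "compactly_supported_in \<Omega> u"
  shows "u \<in> W1var0 \<Omega> p"
proof -
  have ob: "\<Omega> \<in> sets borel" using o by simp
  have "weak_grad (\<lambda>_. 0) (\<lambda>_. 0 :: 'a)" by (simp add: weak_grad_def)
  then have "has_distr_gradient \<Omega> (\<lambda>_. 0) (\<lambda>_. 0)" by (rule weak_grad_has_distr_gradient[OF o]) simp
  from distr_gradient_AE[OF o this] have d: "AE x in lebesgue_on \<Omega>. distr_gradient \<Omega> (\<lambda>_. 0) x = 0"
    unfolding AE_lebesgue_on[OF ob] .
  have "W1var_norm \<Omega> p (\<lambda>x. u x - u x) < \<epsilon>" if "\<epsilon> > 0" for \<epsilon>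
  proof -
    have e: "\<epsilon> / 3 > 0" using that by simp
    have "Lvar_norm \<Omega> p (\<lambda>x. 0 :: real) \<le> \<epsilon> / 3" by (rule Lvar_norm_AE_zero[OF _ e]) simp
    moreover have "Lvar_norm \<Omega> p (distr_gradient \<Omega> (\<lambda>x. 0)) \<le> \<epsilon> / 3" by (rule Lvar_norm_AE_zero[OF d e])
    ultimately have "Lvar_norm \<Omega> p (\<lambda>x. 0 :: real) \<le> \<epsilon> / 3" "Lvar_norm \<Omega> p (distr_gradient \<Omega> (\<lambda>x. 0)) \<le> \<epsilon> / 3" by auto
    then show ?thesis using that by (simp add: W1var_norm_def)
  qed
  with u show ?thesis unfolding W1var0_def by blast
qed

text \<open>The weak formulation is restated for Borel representatives on the whole space. The
  growth condition on \<Phi> is the one satisfied by a cutoff times a truncation of u; it puts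
  \<Phi> into L^p(x) because 1 + |G'| is there.\<close>

lemma weak_solution_test:
  fixes \<phi> u f p p' f' :: "'a::euclidean_space \<Rightarrow> real"
  assumes o: "open \<Omega>" and bd: "bounded \<Omega>"
    and p: "1 < p1" "\<And>x. x \<in> \<Omega> \<Longrightarrow> p1 \<le> p x \<and> p x \<le> p2"
    and p' [measurable]: "p' \<in> borel_measurable borel" and pp: "\<And>x. x \<in> \<Omega> \<Longrightarrow> p' x = p x"
    and sol: "weak_solution_px \<Omega> p f u" and fm: "f \<in> borel_measurable (lebesgue_on \<Omega>)"
    and f' [measurable]: "f' \<in> borel_measurable borel" and ff: "AE x in lborel. x \<in> \<Omega> \<longrightarrow> f x = f' x"
    and G: "has_distr_gradient \<Omega> u G" 
    and G' [measurable]: "G' \<in> borel_measurable borel" and GG: "AE x in lborel. x \<in> \<Omega> \<longrightarrow> G x = G' x"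
    and Gp: "integrable lborel (\<lambda>x. indicator \<Omega> x * norm (G' x) powr p' x)"
    and W: "weak_grad \<phi> \<Phi>" and A: "\<And>x. \<bar>\<phi> x\<bar> \<le> A" "\<And>x. norm (\<Phi> x) \<le> A * (1 + norm (G' x))"
    and K: "compact K" "K \<subseteq> \<Omega>" "\<And>x. x \<notin> K \<Longrightarrow> \<phi> x = 0 \<and> \<Phi> x = 0"
  shows "- (\<integral>x. (norm (G' x) powr (p' x - 2)) *\<^sub>R G' x \<bullet> \<Phi> x \<partial>lborel) = (\<integral>x. f' x * \<phi> x \<partial>lborel)"
proof -
  have ob [measurable]: "\<Omega> \<in> sets borel" using o by simp
  note Wm [measurable] = weak_gradD(3,4)[OF W]
  have A0: "A \<ge> 0" using A(1)[of 0] by linarith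
  have pl: "p \<in> borel_measurable (lebesgue_on \<Omega>)"
    using borel_imp_lebesgue_on[OF p', of \<Omega>] by (subst measurable_cong[of _ p p']) (auto simp: pp)
  have powm: "(\<lambda>x. norm (F x) powr p x) \<in> borel_measurable (lebesgue_on \<Omega>)"
    if "F \<in> borel_measurable (lebesgue_on \<Omega>)" for F :: "'a \<Rightarrow> 'a"
    using that pl by measurable
  have iO: "integrable lborel (indicator \<Omega> :: 'a \<Rightarrow> real)"
    using emeasure_bounded_finite[OF bd] by (intro integrable_real_indicator) auto
  have z: "\<And>x. x \<notin> \<Omega> \<Longrightarrow> \<phi> x = 0 \<and> \<Phi> x = 0" using K by blast
  have hd: "has_distr_gradient \<Omega> \<phi> \<Phi>" by (rule weak_grad_has_distr_gradient[OF o W z])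
  have p12: "0 \<le> p' x" "1 \<le> p' x" "p' x \<le> p2" if "x \<in> \<Omega>" for x using p(2)[OF that] p(1) pp[OF that] by auto
  have l1: "integrable (lebesgue_on \<Omega>) (\<lambda>x. norm (\<phi> x) powr p x)"
  proof (subst lebesgue_on_to_lborel(2)[OF ob])
    show "(\<lambda>x. norm (\<phi> x) powr p x) \<in> borel_measurable (lebesgue_on \<Omega>)"
      using borel_imp_lebesgue_on[OF Wm(1), of \<Omega>] pl by measurable
    show "AE x in lborel. x \<in> \<Omega> \<longrightarrow> norm (\<phi> x) powr p x = norm (\<phi> x) powr p' x" by (simp add: pp)
    show "integrable lborel (\<lambda>x. indicator \<Omega> x *\<^sub>R norm (\<phi> x) powr p' x)"
    proof (rule Bochner_Integration.integrable_bound)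
      show "integrable lborel (\<lambda>x. (1 + A powr p2) * indicator \<Omega> x)" using iO by (rule integrable_mult_right)
      have "norm (indicator \<Omega> x *\<^sub>R norm (\<phi> x) powr p' x) \<le> norm ((1 + A powr p2) * indicator \<Omega> x)" for x
      proof (cases "x \<in> \<Omega>")
        case True
        have "\<bar>\<phi> x\<bar> powr p' x \<le> 1 + \<bar>\<phi> x\<bar> powr p2" using p12[OF True] by (intro powr_mono_le_add) auto
        also have "\<bar>\<phi> x\<bar> powr p2 \<le> A powr p2" using A(1)[of x] p12[OF True] by (intro powr_mono2) auto
        finally show ?thesis using True by (simp add: add_nonneg_nonneg)
      qed simp
      then show "AE x in lborel. norm (indicator \<Omega> x *\<^sub>R norm (\<phi> x) powr p' x) \<le> norm ((1 + A powr p2) * indicator \<Omega> x)" by simp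
    qed measurable
  qed measurable
  have l2: "integrable (lebesgue_on \<Omega>) (\<lambda>x. norm (\<Phi> x) powr p x)"
  proof (subst lebesgue_on_to_lborel(2)[OF ob])
    show "(\<lambda>x. norm (\<Phi> x) powr p x) \<in> borel_measurable (lebesgue_on \<Omega>)"
      by (rule powm[OF borel_imp_lebesgue_on[OF Wm(2)]])
    show "AE x in lborel. x \<in> \<Omega> \<longrightarrow> norm (\<Phi> x) powr p x = norm (\<Phi> x) powr p' x" by (simp add: pp)
    show "integrable lborel (\<lambda>x. indicator \<Omega> x *\<^sub>R norm (\<Phi> x) powr p' x)"
    proof (rule Bochner_Integration.integrable_bound)
      let ?c = "2 powr p2 * (1 + A powr p2)"
      show "integrable lborel (\<lambda>x. ?c * (indicator \<Omega> x + indicator \<Omega> x * norm (G' x) powr p' x))"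
        using iO Gp by (intro integrable_mult_right Bochner_Integration.integrable_add)
      have "norm (indicator \<Omega> x *\<^sub>R norm (\<Phi> x) powr p' x) \<le> norm (?c * (indicator \<Omega> x + indicator \<Omega> x * norm (G' x) powr p' x))" for x
      proof (cases "x \<in> \<Omega>")
        case True
        have "norm (\<Phi> x) powr p' x \<le> (A * (1 + norm (G' x))) powr p' x" using A(2)[of x] p12[OF True] by (intro powr_mono2) auto
        also have "\<dots> = A powr p' x * (1 + norm (G' x)) powr p' x" using A0 by (simp add: powr_mult)
        also have "\<dots> \<le> (1 + A powr p2) * (2 powr p' x * (1 powr p' x + norm (G' x) powr p' x))"
          using p12[OF True] A0 by (intro mult_mono powr_mono_le_add powr_add_le) auto
        also have "\<dots> \<le> (1 + A powr p2) * (2 powr p2 * (1 + norm (G' x) powr p' x))"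
          using p12[OF True] powr_mono[of "p' x" p2 2]
          by (intro mult_left_mono) (auto simp: add_nonneg_nonneg intro!: mult_right_mono)
        finally have "norm (\<Phi> x) powr p' x \<le> ?c * (1 + norm (G' x) powr p' x)" by (simp only: mult_ac)
        moreover have "0 \<le> ?c * (1 + norm (G' x) powr p' x)" by (simp add: add_nonneg_nonneg)
        ultimately show ?thesis using True by (simp only: indicator_simps real_norm_def) simp
      qed simp
      then show "AE x in lborel. norm (indicator \<Omega> x *\<^sub>R norm (\<Phi> x) powr p' x) \<le> norm (?c * (indicator \<Omega> x + indicator \<Omega> x * norm (G' x) powr p' x))" by simp
    qed measurable
  qed measurable
  have W1: "\<phi> \<in> W1var \<Omega> p"
    unfolding W1var_def Lvar_def using l1 l2 hd borel_imp_lebesgue_on[OF Wm(1), of \<Omega>] borel_imp_lebesgue_on[OF Wm(2), of \<Omega>] by auto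
  have cs: "compactly_supported_in \<Omega> \<phi>"
    unfolding compactly_supported_in_def using K by (intro exI[of _ K]) auto
  have Li: "\<phi> \<in> Linfty \<Omega>" unfolding Linfty_def using borel_imp_lebesgue_on[OF Wm(1), of \<Omega>] A(1) by auto
  have eq: "- (LINT x|lebesgue_on \<Omega>. (norm (distr_gradient \<Omega> u x) powr (p x - 2)) *\<^sub>R distr_gradient \<Omega> u x \<bullet> distr_gradient \<Omega> \<phi> x)
          = (LINT x|lebesgue_on \<Omega>. f x * \<phi> x)"
    using sol Li compactly_supported_W1var0[OF o W1 cs] unfolding weak_solution_px_def by blast
  have du: "AE x in lborel. x \<in> \<Omega> \<longrightarrow> distr_gradient \<Omega> u x = G x" by (rule distr_gradient_AE[OF o G])
  have df: "AE x in lborel. x \<in> \<Omega> \<longrightarrow> distr_gradient \<Omega> \<phi> x = \<Phi> x" by (rule distr_gradient_AE[OF o hd])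
  have mu: "distr_gradient \<Omega> u \<in> borel_measurable (lebesgue_on \<Omega>)" "distr_gradient \<Omega> \<phi> \<in> borel_measurable (lebesgue_on \<Omega>)"
    unfolding distr_gradient_def
    by (rule has_distr_gradient_measurable(2)[OF o someI[of "has_distr_gradient \<Omega> _"]], rule G hd)+
  have 1: "(LINT x|lebesgue_on \<Omega>. (norm (distr_gradient \<Omega> u x) powr (p x - 2)) *\<^sub>R distr_gradient \<Omega> u x \<bullet> distr_gradient \<Omega> \<phi> x)
     = (\<integral>x. indicator \<Omega> x *\<^sub>R ((norm (G' x) powr (p' x - 2)) *\<^sub>R G' x \<bullet> \<Phi> x) \<partial>lborel)"
  proof (rule lebesgue_on_to_lborel(1)[OF ob])
    show "(\<lambda>x. (norm (distr_gradient \<Omega> u x) powr (p x - 2)) *\<^sub>R distr_gradient \<Omega> u x \<bullet> distr_gradient \<Omega> \<phi> x) \<in> borel_measurable (lebesgue_on \<Omega>)"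
      using mu pl by measurable
    show "AE x in lborel. x \<in> \<Omega> \<longrightarrow> (norm (distr_gradient \<Omega> u x) powr (p x - 2)) *\<^sub>R distr_gradient \<Omega> u x \<bullet> distr_gradient \<Omega> \<phi> x =
        (norm (G' x) powr (p' x - 2)) *\<^sub>R G' x \<bullet> \<Phi> x"
      using du df GG by eventually_elim (simp add: pp)
  qed measurable
  have 2: "(LINT x|lebesgue_on \<Omega>. f x * \<phi> x) = (\<integral>x. indicator \<Omega> x *\<^sub>R (f' x * \<phi> x) \<partial>lborel)"
  proof (rule lebesgue_on_to_lborel(1)[OF ob])
    show "(\<lambda>x. f x * \<phi> x) \<in> borel_measurable (lebesgue_on \<Omega>)"
      by (intro borel_measurable_times fm borel_imp_lebesgue_on[OF Wm(1)])
    show "AE x in lborel. x \<in> \<Omega> \<longrightarrow> f x * \<phi> x = f' x * \<phi> x" using ff by eventually_elim simp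
  qed measurable
  have "indicator \<Omega> x *\<^sub>R ((norm (G' x) powr (p' x - 2)) *\<^sub>R G' x \<bullet> \<Phi> x) = (norm (G' x) powr (p' x - 2)) *\<^sub>R G' x \<bullet> \<Phi> x"
    "indicator \<Omega> x *\<^sub>R (f' x * \<phi> x) = f' x * \<phi> x" for x
    using z[of x] by (cases "x \<in> \<Omega>"; simp)+
  with eq 1 2 show ?thesis by (simp only:)
qed

text \<open>The function u is replaced by \<zeta> u, which has a weak gradient on the whole space
  and agrees with u on the ball, so that the iteration applies. The equation enters as an abstract
  hypothesis, which allows the lemma to be used for both u and -u.\<close>

lemma bounded_above_of_tested_equation:
  fixes u p f :: "'a::euclidean_space \<Rightarrow> real"
  assumes C: "\<zeta> \<in> test_functions \<Omega>" "\<And>x. x \<in> cball x0 R \<Longrightarrow> \<zeta> x = 1" "cball x0 R \<subseteq> \<Omega>" and R: "R > 0"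
    and L: "local_grad \<Omega> u G"
    and m [measurable]: "p \<in> borel_measurable borel" "f \<in> borel_measurable borel"
    and q: "1 \<le> q" and p: "\<And>x. x \<in> ball x0 R \<Longrightarrow> q \<le> p x \<and> p x \<le> P"
    and qf: "1 < qf" "real DIM('a) / q < qf" and P: "P * (1 - q / real DIM('a)) < q"
    and intu: "(\<integral>\<^sup>+x. ennreal (indicator (ball x0 R) x * \<bar>u x\<bar> powr p x) \<partial>lborel) < \<infinity>"
    and intG: "(\<integral>\<^sup>+x. ennreal (indicator (ball x0 R) x * norm (G x) powr p x) \<partial>lborel) < \<infinity>"
    and intf: "(\<integral>\<^sup>+x. ennreal (indicator (ball x0 R) x * \<bar>f x\<bar> powr qf) \<partial>lborel) < \<infinity>"
    and eqn: "\<And>\<phi> \<Phi> A K. weak_grad \<phi> \<Phi> \<Longrightarrow> (\<And>x. \<bar>\<phi> x\<bar> \<le> A) \<Longrightarrow> (\<And>x. norm (\<Phi> x) \<le> A * (1 + norm (G x))) \<Longrightarrow>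
      compact K \<Longrightarrow> K \<subseteq> \<Omega> \<Longrightarrow> (\<And>x. x \<notin> K \<Longrightarrow> \<phi> x = 0 \<and> \<Phi> x = 0) \<Longrightarrow>
      - (\<integral>x. (norm (G x) powr (p x - 2)) *\<^sub>R G x \<bullet> \<Phi> x \<partial>lborel) = (\<integral>x. f x * \<phi> x \<partial>lborel)"
  shows "\<exists>M. AE x in lborel. x \<in> cball x0 (R / 4) \<longrightarrow> u x \<le> M"
proof -
  define U where "U x = \<zeta> x * u x" for x
  define H where "H x = \<zeta> x *\<^sub>R G x + u x *\<^sub>R grad \<zeta> x" for x
  have UH: "weak_grad U H" unfolding U_def[abs_def] H_def[abs_def] by (rule local_grad_weak_grad[OF L C(1)])
  have Uu: "U x = u x" if "x \<in> cball x0 R" for x using C(2)[OF that] by (simp add: U_def)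
  \<comment> \<open>The gradient of \<zeta> vanishes where \<zeta> is constant in a neighbourhood,
    hence the open ball instead of the closed one.\<close>
  have HG: "H x = G x" if "x \<in> ball x0 R" for x
  proof -
    have "(\<zeta> has_derivative (\<lambda>v. 0 \<bullet> v)) (at x)"
      by (rule has_derivative_transform_within_open[where s="ball x0 R" and f="\<lambda>_. 1"]) (use that C(2) in auto)
    then have "grad \<zeta> x = 0" by (rule grad_eqI)
    then show ?thesis using that C(2)[of x] by (simp add: H_def)
  qed
  obtain F where F: "F \<ge> 0" "(\<integral>\<^sup>+x. ennreal (indicator (ball x0 R) x * \<bar>f x\<bar> powr qf) \<partial>lborel) \<le> ennreal F"
    using intf by (cases "\<integral>\<^sup>+x. ennreal (indicator (ball x0 R) x * \<bar>f x\<bar> powr qf) \<partial>lborel") auto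
  have eU: "indicator (ball x0 R) x * \<bar>U x\<bar> powr p x = indicator (ball x0 R) x * \<bar>u x\<bar> powr p x"
    "indicator (ball x0 R) x * norm (H x) powr p x = indicator (ball x0 R) x * norm (G x) powr p x" for x
    using Uu[of x] HG[of x] by (cases "x \<in> ball x0 R"; simp)+
  interpret local_solution U p f H x0 R q P qf F
  proof
    show "weak_grad U H" by (rule UH)
    fix \<eta> :: "'a \<Rightarrow> real" and k l :: real
    assume E: "\<eta> \<in> test_functions (ball x0 R)" and k: "0 \<le> k" and l: "0 \<le> l"
    define \<phi> where "\<phi> x = \<eta> x * trunc k l (U x)" for x
    define \<Phi> where "\<Phi> x = \<eta> x *\<^sub>R (indicator {x. k < U x \<and> U x \<le> k + l} x *\<^sub>R H x) + trunc k l (U x) *\<^sub>R grad \<eta> x" for x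
    \<comment> \<open>As a difference of two positive parts, the truncation inherits its weak
      gradient from \<open>weak_grad_pos_part\<close>. The two strict indicators leave the band that
      is open below and closed above.\<close>
    have t: "trunc k l s = max (s - k) 0 - max (s - (k + l)) 0" for s using l by (auto simp: trunc_def)
    have "weak_grad (\<lambda>x. max (U x - k) 0 - max (U x - (k + l)) 0)
       (\<lambda>x. indicator {x. U x > k} x *\<^sub>R H x - indicator {x. U x > k + l} x *\<^sub>R H x)"
      using k l by (intro weak_grad_diff weak_grad_pos_part UH) auto
    moreover have "indicator {x. U x > k} x *\<^sub>R H x - indicator {x. U x > k + l} x *\<^sub>R H x =
        indicator {x. k < U x \<and> U x \<le> k + l} x *\<^sub>R H x" for x using l by (auto simp: indicator_def)
    ultimately have "weak_grad (\<lambda>x. trunc k l (U x)) (\<lambda>x. indicator {x. k < U x \<and> U x \<le> k + l} x *\<^sub>R H x)"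
      by (simp only: t)
    then have W: "weak_grad \<phi> \<Phi>"
      unfolding \<phi>_def[abs_def] \<Phi>_def[abs_def] by (rule weak_grad_mult_test[OF _ test_functions_mono[OF E subset_UNIV]])
    let ?K = "closure {x. \<eta> x \<noteq> 0}"
    note S = test_functions_support[OF E]
    obtain B where B: "B > 0" "\<And>x. \<bar>\<eta> x\<bar> \<le> B" using test_bounded[OF E] by blast
    obtain B' where B': "B' > 0" "\<And>x. norm (grad \<eta> x) \<le> B'" using grad_test_bounded[OF E] by blast
    have tb: "\<bar>trunc k l s\<bar> \<le> l" for s using l by (auto simp: trunc_def)
    have z: "\<phi> x = 0 \<and> \<Phi> x = 0" if "x \<notin> ?K" for x
      unfolding \<phi>_def \<Phi>_def using grad_test_0[OF S(1) that] by (simp only: mult_zero_left scaleR_zero_left scaleR_zero_right add_0)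
    \<comment> \<open>One constant has to bound the test function and both parts of its gradient: B
      l for the function itself, B for the multiple of G, and l B' for the term with the cutoff
      gradient.\<close>
    define A where "A = B * l + B + l * B'"
    have A: "B * l \<le> A" "B \<le> A" "l * B' \<le> A" "0 \<le> A" using B B' l by (auto simp: A_def)
    have "- (\<integral>x. (norm (G x) powr (p x - 2)) *\<^sub>R G x \<bullet> \<Phi> x \<partial>lborel) = (\<integral>x. f x * \<phi> x \<partial>lborel)"
    proof (rule eqn[OF W _ _ S(2) _ z])
      show "\<bar>\<phi> x\<bar> \<le> A" for x
        unfolding \<phi>_def abs_mult by (rule order_trans[OF mult_mono[OF B(2) tb] A(1)]) (use B in auto)
      show "norm (\<Phi> x) \<le> A * (1 + norm (G x))" for x
      proof (cases "x \<in> ?K")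
        case True
        then have x: "x \<in> ball x0 R" using S(3) by blast
        have "norm (\<Phi> x) \<le> norm (\<eta> x *\<^sub>R (indicator {x. k < U x \<and> U x \<le> k + l} x *\<^sub>R H x)) + norm (trunc k l (U x) *\<^sub>R grad \<eta> x)"
          unfolding \<Phi>_def by (rule norm_triangle_ineq)
        also have "norm (\<eta> x *\<^sub>R (indicator {x. k < U x \<and> U x \<le> k + l} x *\<^sub>R H x)) \<le> B * norm (G x)"
          unfolding HG[OF x] norm_scaleR using B(1) by (intro mult_mono B(2)) (auto simp: indicator_def)
        also have "norm (trunc k l (U x) *\<^sub>R grad \<eta> x) \<le> l * B'"
          unfolding norm_scaleR real_norm_def[symmetric] using l by (intro mult_mono B'(2)) (use tb in auto)
        also have "B * norm (G x) + l * B' \<le> A * norm (G x) + A"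
          using A by (intro add_mono mult_right_mono) auto
        finally show ?thesis by (simp add: distrib_left add.commute)
      next
        case False
        with z[OF False] A(4) show ?thesis by (simp add: add_nonneg_nonneg)
      qed
      show "?K \<subseteq> \<Omega>" using S(3) C(3) ball_subset_cball by blast
    qed
    moreover have "(norm (G x) powr (p x - 2)) *\<^sub>R G x \<bullet> \<Phi> x = (norm (H x) powr (p x - 2)) *\<^sub>R H x \<bullet> \<Phi> x" for x
    proof (cases "x \<in> ball x0 R")
      case False
      then have "x \<notin> ?K" using S(3) by blast
      with z show ?thesis by simp
    qed (simp add: HG)
    ultimately show "- (\<integral>x. (norm (H x) powr (p x - 2)) *\<^sub>R H x \<bullet>
            (\<eta> x *\<^sub>R (indicator {x. k < U x \<and> U x \<le> k + l} x *\<^sub>R H x) + trunc k l (U x) *\<^sub>R grad \<eta> x) \<partial>lborel)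
        = (\<integral>x. f x * (\<eta> x * trunc k l (U x)) \<partial>lborel)"
      by (simp only: \<Phi>_def \<phi>_def)
  qed (use R q qf P F intu intG p in \<open>simp_all only: eU m\<close>)
  obtain M where "AE x in lborel. x \<in> cball x0 (R / 4) \<longrightarrow> U x \<le> M" using locally_bounded_above by blast
  then have "AE x in lborel. x \<in> cball x0 (R / 4) \<longrightarrow> u x \<le> M"
    by eventually_elim (use Uu R in auto)
  then show ?thesis by blast
qed

section \<open>From one-sided bounds on small balls to local boundedness\<close>

lemma local_grad_uminus:
  assumes "local_grad \<Omega> u G"
  shows "local_grad \<Omega> (\<lambda>x. - u x) (\<lambda>x. - G x)"
  using assms unfolding local_grad_def by auto

text \<open>At d = 0 the conditions read n/a < qf and a (1 - a/n) < a, both strict, so they persist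
  for small d > 0. The exponent qf is taken strictly between max 1 (n/a) and Q, so as to leave room
  on both sides.\<close>

lemma exponent_window:
  fixes a n Q :: real
  assumes "1 < a" "0 < n" "max 1 (n / a) < Q"
  shows "\<exists>d>0. \<exists>qf. 1 < qf \<and> qf < Q \<and> 1 \<le> a - d \<and> n / (a - d) < qf \<and> (a + d) * (1 - (a - d) / n) < a - d"
proof -
  obtain qf where qf: "max 1 (n / a) < qf" "qf < Q" using dense[OF assms(3)] by blast
  have "((\<lambda>d. n / (a - d)) \<longlongrightarrow> n / (a - 0)) (at_right 0)" using assms by (intro tendsto_intros) auto
  then have 1: "eventually (\<lambda>d. n / (a - d) < qf) (at_right 0)" using qf by (intro order_tendstoD(2)) auto
  have "((\<lambda>d. (a + d) * (1 - (a - d) / n) - (a - d)) \<longlongrightarrow> (a + 0) * (1 - (a - 0) / n) - (a - 0)) (at_right 0)"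
    using assms by (intro tendsto_intros) auto
  moreover have "(a + 0) * (1 - (a - 0) / n) - (a - 0) < 0" using assms by (simp add: right_diff_distrib)
  ultimately have 2: "eventually (\<lambda>d. (a + d) * (1 - (a - d) / n) - (a - d) < 0) (at_right 0)"
    by (intro order_tendstoD(2))
  have 3: "eventually (\<lambda>d. d > 0 \<and> d < a - 1) (at_right (0::real))"
    using assms by (auto simp: eventually_at_right_field intro!: exI[of _ "a - 1"])
  have "eventually (\<lambda>d. n / (a - d) < qf \<and> (a + d) * (1 - (a - d) / n) - (a - d) < 0 \<and> d > 0 \<and> d < a - 1) (at_right 0)"
    using 1 2 3 by eventually_elim auto
  then obtain d where "n / (a - d) < qf \<and> (a + d) * (1 - (a - d) / n) - (a - d) < 0 \<and> d > 0 \<and> d < a - 1"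
    using eventually_happens'[OF trivial_limit_at_right_real] by blast
  with qf show ?thesis by (intro exI[of _ d] conjI exI[of _ qf]) auto
qed

lemma nn_integral_finite_of_le:
  fixes g h :: "'a::euclidean_space \<Rightarrow> real"
  assumes "integrable lborel g" "\<And>x. h x \<le> g x"
  shows "(\<integral>\<^sup>+x. ennreal (h x) \<partial>lborel) < \<infinity>"
proof -
  have "(\<integral>\<^sup>+x. ennreal (h x) \<partial>lborel) \<le> (\<integral>\<^sup>+x. ennreal (norm (g x)) \<partial>lborel)"
    using assms(2) by (intro nn_integral_mono ennreal_leI) (metis abs_ge_self order_trans real_norm_def)
  also have "\<dots> < \<infinity>" using assms(1) by (simp add: integrable_iff_bounded)
  finally show ?thesis .
qed

lemma locally_boundedI:
  fixes \<Omega> :: "'a::euclidean_space set"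
  assumes o: "open \<Omega>" and m: "u \<in> borel_measurable (lebesgue_on \<Omega>)"
    and b: "\<And>x. x \<in> \<Omega> \<Longrightarrow> \<exists>r>0. \<exists>M. AE y in lborel. y \<in> \<Omega> \<inter> ball x r \<longrightarrow> \<bar>u y\<bar> \<le> M"
  shows "locally_bounded \<Omega> u"
  unfolding locally_bounded_def
proof (intro allI impI)
  fix K assume K: "compact K \<and> K \<subseteq> \<Omega>"
  obtain r M where r: "\<And>x. x \<in> \<Omega> \<Longrightarrow> r x > 0" "\<And>x. x \<in> \<Omega> \<Longrightarrow> AE y in lborel. y \<in> \<Omega> \<inter> ball x (r x) \<longrightarrow> \<bar>u y\<bar> \<le> M x"
    using b by metis
  obtain C where C: "C \<subseteq> K" "finite C" "K \<subseteq> (\<Union>x\<in>C. ball x (r x))"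
  proof (rule compactE_image[of K K "\<lambda>x. ball x (r x)"])
    show "K \<subseteq> (\<Union>x\<in>K. ball x (r x))"
    proof
      fix x assume "x \<in> K"
      then have "x \<in> ball x (r x)" using r(1)[of x] K by auto
      with \<open>x \<in> K\<close> show "x \<in> (\<Union>x\<in>K. ball x (r x))" by blast
    qed
  qed (use K in auto)
  have "AE y in lborel. \<forall>x\<in>C. y \<in> \<Omega> \<inter> ball x (r x) \<longrightarrow> \<bar>u y\<bar> \<le> M x"
    using C K r(2) by (intro AE_finite_allI C) blast
  then have "AE y in lborel. y \<in> K \<longrightarrow> \<bar>u y\<bar> \<le> (\<Sum>x\<in>C. \<bar>M x\<bar>)"
  proof eventually_elim
    case (elim y)
    show ?case
    proof
      assume "y \<in> K"
      then obtain x where x: "x \<in> C" "y \<in> ball x (r x)" using C(3) by blast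
      have "\<bar>u y\<bar> \<le> M x" using elim x \<open>y \<in> K\<close> K by blast
      also have "\<dots> \<le> \<bar>M x\<bar>" by simp
      also have "\<dots> \<le> (\<Sum>x\<in>C. \<bar>M x\<bar>)" using x C by (intro member_le_sum) auto
      finally show "\<bar>u y\<bar> \<le> (\<Sum>x\<in>C. \<bar>M x\<bar>)" .
    qed
  qed
  then have "AE y in lebesgue_on K. \<bar>u y\<bar> \<le> (\<Sum>x\<in>C. \<bar>M x\<bar>)"
    using K compact_borel by (subst AE_lebesgue_on) auto
  moreover have "u \<in> borel_measurable (lebesgue_on K)"
    using K m measurable_restrict_mono by blast
  ultimately show "u \<in> Linfty K" unfolding Linfty_def by blast
qed

theorem corollary2p1:
  fixes \<Omega> :: "'a::euclidean_space set"
    and p q0 f u :: "'a \<Rightarrow> real"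
    and p1 p2 :: real
  assumes "open \<Omega>" and "bounded \<Omega>"
    and "1 < p1" and "\<And>x. x \<in> \<Omega> \<Longrightarrow> p1 \<le> p x \<and> p x \<le> p2"
    and "continuous_on (closure \<Omega>) p"
    and "log_Holder \<Omega> p"
    and "continuous_on \<Omega> q0"
    and "\<And>x. x \<in> \<Omega> \<Longrightarrow> max 1 (real DIM('a) / p x) < q0 x"
    and "f \<in> Lvar \<Omega> q0"
    and "weak_solution_px \<Omega> p f u"
  shows "locally_bounded \<Omega> u"
proof -
  note o = assms(1) and bd = assms(2) and p = assms(3,4) and sol = assms(10)
  have ob [measurable]: "\<Omega> \<in> sets borel" using o by simp
  have pc: "continuous_on \<Omega> p" using assms(5) closure_subset by (rule continuous_on_subset)
  obtain G where G: "G \<in> Lvar \<Omega> p" "has_distr_gradient \<Omega> u G" and uL: "u \<in> Lvar \<Omega> p"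
    using sol unfolding weak_solution_px_def W1var_def by blast
  have um: "u \<in> borel_measurable (lebesgue_on \<Omega>)" "integrable (lebesgue_on \<Omega>) (\<lambda>x. norm (u x) powr p x)"
    using uL by (auto simp: Lvar_def)
  have Gm: "G \<in> borel_measurable (lebesgue_on \<Omega>)" "integrable (lebesgue_on \<Omega>) (\<lambda>x. norm (G x) powr p x)"
    using G(1) by (auto simp: Lvar_def)
  have fm: "f \<in> borel_measurable (lebesgue_on \<Omega>)" "integrable (lebesgue_on \<Omega>) (\<lambda>x. norm (f x) powr q0 x)"
    using assms(9) by (auto simp: Lvar_def)
  obtain u' where u' [measurable]: "u' \<in> borel_measurable borel" and uu: "AE x in lborel. x \<in> \<Omega> \<longrightarrow> u x = u' x"
    using borel_representative[OF ob um(1)] by blast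
  obtain G' where G' [measurable]: "G' \<in> borel_measurable borel" and GG: "AE x in lborel. x \<in> \<Omega> \<longrightarrow> G x = G' x"
    using borel_representative[OF ob Gm(1)] by blast
  obtain f' where f' [measurable]: "f' \<in> borel_measurable borel" and ff: "AE x in lborel. x \<in> \<Omega> \<longrightarrow> f x = f' x"
    using borel_representative[OF ob fm(1)] by blast
  \<comment> \<open>The exponents are continuous on the Borel set \<Omega>; extended by zero they
    are Borel functions on the whole space.\<close>
  define p' where "p' x = indicator \<Omega> x *\<^sub>R p x" for x
  define q' where "q' x = indicator \<Omega> x *\<^sub>R q0 x" for x
  have p' [measurable]: "p' \<in> borel_measurable borel"
    unfolding p'_def[abs_def] by (rule borel_measurable_continuous_on_indicator[OF ob pc])
  have q' [measurable]: "q' \<in> borel_measurable borel"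
    unfolding q'_def[abs_def] by (rule borel_measurable_continuous_on_indicator[OF ob assms(7)])
  have pp: "p' x = p x" "q' x = q0 x" if "x \<in> \<Omega>" for x using that by (simp_all add: p'_def q'_def)
  have "AE x in lborel. x \<in> \<Omega> \<longrightarrow> norm (u x) powr p x = norm (u' x) powr p' x" using uu by eventually_elim (simp add: pp)
  then have iu: "integrable lborel (\<lambda>x. indicator \<Omega> x *\<^sub>R norm (u' x) powr p' x)"
    by (subst lebesgue_on_to_lborel(2)[OF ob borel_measurable_integrable[OF um(2)], symmetric]) (use um in auto)
  have "AE x in lborel. x \<in> \<Omega> \<longrightarrow> norm (G x) powr p x = norm (G' x) powr p' x" using GG by eventually_elim (simp add: pp)
  then have iG: "integrable lborel (\<lambda>x. indicator \<Omega> x *\<^sub>R norm (G' x) powr p' x)"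
    by (subst lebesgue_on_to_lborel(2)[OF ob borel_measurable_integrable[OF Gm(2)], symmetric]) (use Gm in auto)
  have "AE x in lborel. x \<in> \<Omega> \<longrightarrow> norm (f x) powr q0 x = norm (f' x) powr q' x" using ff by eventually_elim (simp add: pp)
  then have if': "integrable lborel (\<lambda>x. indicator \<Omega> x *\<^sub>R norm (f' x) powr q' x)"
    by (subst lebesgue_on_to_lborel(2)[OF ob borel_measurable_integrable[OF fm(2)], symmetric]) (use fm in auto)
  have iO: "integrable lborel (indicator \<Omega> :: 'a \<Rightarrow> real)"
    using emeasure_bounded_finite[OF bd] by (intro integrable_real_indicator) auto
  have L: "local_grad \<Omega> u' G'" by (rule has_distr_gradient_local_grad[OF o G(2) u' G' uu GG])
  have test: "- (\<integral>x. (norm (G' x) powr (p' x - 2)) *\<^sub>R G' x \<bullet> \<Phi> x \<partial>lborel) = (\<integral>x. f' x * \<phi> x \<partial>lborel)"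
    if "weak_grad \<phi> \<Phi>" "\<And>x. \<bar>\<phi> x\<bar> \<le> A" "\<And>x. norm (\<Phi> x) \<le> A * (1 + norm (G' x))"
      "compact K" "K \<subseteq> \<Omega>" "\<And>x. x \<notin> K \<Longrightarrow> \<phi> x = 0 \<and> \<Phi> x = 0" for \<phi> \<Phi> A K
    by (rule weak_solution_test[OF o bd p p' pp(1) sol fm(1) f' ff G(2) G' GG iG[unfolded real_scaleR_def] that])
  show ?thesis
  proof (rule locally_boundedI[OF o um(1)])
    fix x0 assume x0: "x0 \<in> \<Omega>"
    have a: "1 < p x0" using p x0 by force
    \<comment> \<open>Near x0 the exponents are replaced by constants: q = p(x0) - d, P = p(x0) + d,
      and qf below q0. Continuity of p and q0 at x0 then provides the ball on which these bounds
      hold.\<close>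
    obtain d qf where d: "d > 0" "1 < qf" "qf < q0 x0" "1 \<le> p x0 - d" "real DIM('a) / (p x0 - d) < qf"
      "(p x0 + d) * (1 - (p x0 - d) / real DIM('a)) < p x0 - d"
      using exponent_window[OF a _ assms(8)[OF x0]] by auto
    obtain R2 \<zeta> where R2: "R2 > 0" "\<zeta> \<in> test_functions \<Omega>" "\<forall>y\<in>cball x0 R2. \<zeta> y = 1" "cball x0 R2 \<subseteq> \<Omega>"
      using cutoff_exists[OF o x0] by blast
    have "isCont p x0" "isCont q0 x0"
      using pc assms(7) x0 o by (auto simp: continuous_on_eq_continuous_at)
    then have "(p \<longlongrightarrow> p x0) (nhds x0)" "(q0 \<longlongrightarrow> q0 x0) (nhds x0)"
      by (auto simp: isCont_def tendsto_at_iff_tendsto_nhds)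
    then have "eventually (\<lambda>y. dist (p y) (p x0) < d) (nhds x0)" "eventually (\<lambda>y. qf < q0 y) (nhds x0)"
      using d by (auto intro: tendstoD order_tendstoD)
    then have "eventually (\<lambda>y. dist (p y) (p x0) < d \<and> qf < q0 y) (nhds x0)" by eventually_elim auto
    then obtain R1 where R1: "R1 > 0" "\<And>y. dist y x0 < R1 \<Longrightarrow> dist (p y) (p x0) < d \<and> qf < q0 y"
      unfolding eventually_nhds_metric by blast
    define R where "R = min R1 R2"
    have R: "R > 0" "cball x0 R \<subseteq> cball x0 R2" using R1 R2 by (auto simp: R_def)
    have bO: "x \<in> \<Omega>" if "x \<in> ball x0 R" for x using that R R2(4) by force
    have pb: "p x0 - d \<le> p' x \<and> p' x \<le> p x0 + d" "qf \<le> q' x" if "x \<in> ball x0 R" for x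
      using R1(2)[of x] that pp[OF bO[OF that]] by (auto simp: R_def dist_commute dist_real_def)
    have \<zeta>: "\<And>x. x \<in> cball x0 R \<Longrightarrow> \<zeta> x = 1" "cball x0 R \<subseteq> \<Omega>" using R R2 by auto
    have bi: "indicator (ball x0 R) x * c \<le> indicator \<Omega> x *\<^sub>R c" if "c \<ge> 0" for x and c :: real
      using that bO[of x] by (auto simp: indicator_def)
    have intu: "(\<integral>\<^sup>+x. ennreal (indicator (ball x0 R) x * \<bar>u' x\<bar> powr p' x) \<partial>lborel) < \<infinity>"
      by (rule nn_integral_finite_of_le[OF iu]) (use bi in \<open>simp add: real_norm_def del: real_scaleR_def\<close>)
    have intG: "(\<integral>\<^sup>+x. ennreal (indicator (ball x0 R) x * norm (G' x) powr p' x) \<partial>lborel) < \<infinity>"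
      by (rule nn_integral_finite_of_le[OF iG]) (use bi in simp)
    have intf: "(\<integral>\<^sup>+x. ennreal (indicator (ball x0 R) x * \<bar>f' x\<bar> powr qf) \<partial>lborel) < \<infinity>"
    proof (rule nn_integral_finite_of_le[OF Bochner_Integration.integrable_add[OF iO if']])
      fix x
      show "indicator (ball x0 R) x * \<bar>f' x\<bar> powr qf \<le> indicator \<Omega> x + indicator \<Omega> x *\<^sub>R norm (f' x) powr q' x"
      proof (cases "x \<in> ball x0 R")
        case True
        have "\<bar>f' x\<bar> powr qf \<le> 1 + \<bar>f' x\<bar> powr q' x" using pb(2)[OF True] d by (intro powr_mono_le_add) auto
        then show ?thesis using True bO[OF True] by simp
      qed simp
    qed
    have "\<exists>M. AE x in lborel. x \<in> cball x0 (R / 4) \<longrightarrow> u' x \<le> M"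
      by (rule bounded_above_of_tested_equation[OF R2(2) \<zeta> R(1) L p' f' d(4) pb(1) d(2) d(5) d(6) intu intG intf test])
    then obtain M1 where M1: "AE x in lborel. x \<in> cball x0 (R / 4) \<longrightarrow> u' x \<le> M1" by blast
    \<comment> \<open>The operator is odd, so -u' satisfies the equation with right-hand side -f',
      while all integrability conditions involve absolute values only. The upper bound for -u' is
      the lower bound for u'.\<close>
    have "\<exists>M. AE x in lborel. x \<in> cball x0 (R / 4) \<longrightarrow> - u' x \<le> M"
    proof (rule bounded_above_of_tested_equation[OF R2(2) \<zeta> R(1) local_grad_uminus[OF L] p' _ d(4) pb(1) d(2) d(5) d(6)])
      show "(\<lambda>x. - f' x) \<in> borel_measurable borel" by simp
      show "- (\<integral>x. (norm (- G' x) powr (p' x - 2)) *\<^sub>R (- G' x) \<bullet> \<Phi> x \<partial>lborel) = (\<integral>x. - f' x * \<phi> x \<partial>lborel)"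
        if "weak_grad \<phi> \<Phi>" "\<And>x. \<bar>\<phi> x\<bar> \<le> A" "\<And>x. norm (\<Phi> x) \<le> A * (1 + norm (- G' x))"
          "compact K" "K \<subseteq> \<Omega>" "\<And>x. x \<notin> K \<Longrightarrow> \<phi> x = 0 \<and> \<Phi> x = 0" for \<phi> \<Phi> A K
      proof -
        have "- (\<integral>x. (norm (G' x) powr (p' x - 2)) *\<^sub>R G' x \<bullet> \<Phi> x \<partial>lborel) = (\<integral>x. f' x * \<phi> x \<partial>lborel)"
          by (rule test[OF that(1) that(2) _ that(4-6)]) (use that(3) in simp)
        then show ?thesis by simp
      qed
    qed (use intu intG intf in simp_all)
    then obtain M2 where M2: "AE x in lborel. x \<in> cball x0 (R / 4) \<longrightarrow> - u' x \<le> M2" by blast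
    have "AE y in lborel. y \<in> \<Omega> \<inter> ball x0 (R / 4) \<longrightarrow> \<bar>u y\<bar> \<le> max M1 M2"
      using M1 M2 uu by eventually_elim auto
    then show "\<exists>r>0. \<exists>M. AE y in lborel. y \<in> \<Omega> \<inter> ball x0 r \<longrightarrow> \<bar>u y\<bar> \<le> M"
      using R(1) by (intro exI[of _ "R / 4"]) auto
  qed
qed

end
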